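(* For every integer $m\ge 2$, there exist algorithms solving the conjugacy problem and the conjugacy search problem of $H_m$ in time polynomial in the sum of the lengths of the input words.
   Context: Let $F = F(a_1,\ldots,a_m)$ be the free group of rank $m$ and let $\varphi \in \mathrm{Aut}(F)$ be given by $\varphi(a_1)=a_1$ and $\varphi(a_i)=a_i a_{i-1}$ for $2\le i\le m$. Define $H_m = F\rtimes_\varphi \mathbb{Z} = \langle a_1,\ldots,a_m,s \mid s^{-1}a_i s=\varphi(a_i),\ 1\le i\le m\rangle$. The conjugacy problem for $H_m$: given words $u,v$ on $a_1^{\pm1},\ldots,a_m^{\pm1},s^{\pm1}$, decide whether or not they represent conjugate elements of $H_m$. The conjugacy search problem for $H_m$: given words $u,v$ on $a_1^{\pm1},\ldots,a_m^{\pm1},s^{\pm1}$ that represent conjugate elements of $H_m$, output a word $w$ on $a_1^{\pm1},\ldots,a_m^{\pm1},s^{\pm1}$ such that $uw=wv$ in $H_m$. Here $m$ is fixed (it is not part of the input). *)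

theory Defs
  imports "HOL-Algebra.Group" "HOL-Computational_Algebra.Polynomial"
begin

section \<open>Groups given by presentations\<close>

text \<open>The letter \<open>(x, True)\<close> stands for the generator \<open>x\<close>, the letter \<open>(x, False)\<close> for its inverse.
  Words need not be reduced.\<close>

type_synonym 'g word = "('g \<times> bool) list"

definition words :: "'g set \<Rightarrow> 'g word set" where
  "words X = lists (X \<times> UNIV)"

text \<open>A pair \<open>(l, r)\<close> of words in \<open>R\<close> is the defining relation \<open>l = r\<close>.\<close>

inductive pres_eq :: "'g set \<Rightarrow> ('g word \<times> 'g word) set \<Rightarrow> 'g word \<Rightarrow> 'g word \<Rightarrow> bool"
  for X R where
  refl: "w \<in> words X \<Longrightarrow> pres_eq X R w w"
| sym: "pres_eq X R u v \<Longrightarrow> pres_eq X R v u"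
| trans: "pres_eq X R u v \<Longrightarrow> pres_eq X R v w \<Longrightarrow> pres_eq X R u w"
| cancel: "u \<in> words X \<Longrightarrow> v \<in> words X \<Longrightarrow> x \<in> X \<Longrightarrow>
    pres_eq X R (u @ [(x, b), (x, \<not> b)] @ v) (u @ v)"
| rel: "u \<in> words X \<Longrightarrow> v \<in> words X \<Longrightarrow> (l, r) \<in> R \<Longrightarrow>
    pres_eq X R (u @ l @ v) (u @ r @ v)"

definition pres_class :: "'g set \<Rightarrow> ('g word \<times> 'g word) set \<Rightarrow> 'g word \<Rightarrow> 'g word set" where
  "pres_class X R w = {w'. pres_eq X R w w'}"

definition presented_group ::
  "'g set \<Rightarrow> ('g word \<times> 'g word) set \<Rightarrow> 'g word set monoid" where
  "presented_group X R =
    \<lparr>carrier = pres_class X R ` words X,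
     monoid.mult = (\<lambda>P Q. {w. \<exists>p\<in>P. \<exists>q\<in>Q. pres_eq X R (p @ q) w}),
     monoid.one = pres_class X R []\<rparr>"

lemma words_append [simp]: "u @ v \<in> words X \<longleftrightarrow> u \<in> words X \<and> v \<in> words X"
  by (auto simp: words_def)

lemma words_Nil [simp]: "[] \<in> words X"
  by (simp add: words_def)

lemma words_Cons [simp]: "a # w \<in> words X \<longleftrightarrow> fst a \<in> X \<and> w \<in> words X"
  by (cases a) (auto simp: words_def)

lemma pres_eq_words:
  assumes "R \<subseteq> words X \<times> words X" and "pres_eq X R u v"
  shows "u \<in> words X" and "v \<in> words X"
proof -
  have "u \<in> words X \<and> v \<in> words X"
    using assms(2)
  proof induction
    case (rel u v l r)
    then have "l \<in> words X" "r \<in> words X" using assms(1) by blast+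
    with rel show ?case by simp
  qed simp_all
  then show "u \<in> words X" and "v \<in> words X" by simp_all
qed

lemma pres_eq_context:
  assumes "pres_eq X R u v" and "p \<in> words X" and "q \<in> words X"
  shows "pres_eq X R (p @ u @ q) (p @ v @ q)"
  using assms
proof (induction)
  case (cancel u v x b)
  then show ?case using pres_eq.cancel[of "p @ u" X "v @ q" x R b] by simp
next
  case (rel u v l r)
  then show ?case using pres_eq.rel[of "p @ u" X "v @ q" l r R] by simp
next
  case (refl w)
  then show ?case by (simp add: pres_eq.refl)
next
  case (sym u v)
  then show ?case by (blast intro: pres_eq.sym)
next
  case (trans u v w)
  then show ?case by (blast intro: pres_eq.trans)
qed

lemma pres_eq_append:
  assumes "R \<subseteq> words X \<times> words X" and "pres_eq X R u u'" and "pres_eq X R v v'"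
  shows "pres_eq X R (u @ v) (u' @ v')"
proof (rule pres_eq.trans)
  show "pres_eq X R (u @ v) (u' @ v)"
    using pres_eq_context[OF assms(2), of "[]" v] pres_eq_words[OF assms(1,3)] by simp
  show "pres_eq X R (u' @ v) (u' @ v')"
    using pres_eq_context[OF assms(3), of u' "[]"] pres_eq_words[OF assms(1,2)] by simp
qed

lemma pres_class_eq_iff:
  assumes "u \<in> words X"
  shows "pres_class X R u = pres_class X R v \<longleftrightarrow> pres_eq X R u v"
proof
  assume "pres_class X R u = pres_class X R v"
  moreover have "u \<in> pres_class X R u" using assms by (simp add: pres_class_def pres_eq.refl)
  ultimately show "pres_eq X R u v" by (simp add: pres_class_def pres_eq.sym)
next
  assume uv: "pres_eq X R u v"
  show "pres_class X R u = pres_class X R v"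
    using pres_eq.trans[OF uv] pres_eq.trans[OF pres_eq.sym[OF uv]]
    by (auto simp: pres_class_def)
qed

lemma pres_class_mult:
  assumes "R \<subseteq> words X \<times> words X" and "u \<in> words X" and "v \<in> words X"
  shows "pres_class X R u \<otimes>\<^bsub>presented_group X R\<^esub> pres_class X R v = pres_class X R (u @ v)"
proof -
  have "(\<exists>p. pres_eq X R u p \<and> (\<exists>q. pres_eq X R v q \<and> pres_eq X R (p @ q) w)) \<longleftrightarrow>
      pres_eq X R (u @ v) w" for w
    using pres_eq_append[OF assms(1)] pres_eq.refl[OF assms(2)] pres_eq.refl[OF assms(3)]
    by (meson pres_eq.trans)
  then show ?thesis
    by (simp add: presented_group_def pres_class_def Bex_def)
qed

definition inv_word :: "'g word \<Rightarrow> 'g word" where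
  "inv_word w = rev (map (\<lambda>(x, b). (x, \<not> b)) w)"

lemma inv_word_words: "w \<in> words X \<Longrightarrow> inv_word w \<in> words X"
  by (induction w) (auto simp: inv_word_def)

lemma pres_eq_inv_word:
  assumes "w \<in> words X"
  shows "pres_eq X R (inv_word w @ w) []"
  using assms
proof (induction w)
  case Nil
  then show ?case by (simp add: inv_word_def pres_eq.refl)
next
  case (Cons a w)
  obtain x b where a: "a = (x, b)" by (cases a)
  have "pres_eq X R (inv_word w @ [(x, \<not> b), (x, \<not> \<not> b)] @ w) (inv_word w @ w)"
    using Cons.prems inv_word_words a by (intro pres_eq.cancel) auto
  moreover have "pres_eq X R (inv_word w @ w) []" using Cons by simp
  ultimately have "pres_eq X R (inv_word w @ [(x, \<not> b), (x, \<not> \<not> b)] @ w) []"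
    by (rule pres_eq.trans)
  then show ?case by (simp add: a inv_word_def)
qed

lemma group_presented_group:
  assumes R: "R \<subseteq> words X \<times> words X"
  shows "group (presented_group X R)"
proof (rule groupI)
  have c: "carrier (presented_group X R) = pres_class X R ` words X"
    and o: "\<one>\<^bsub>presented_group X R\<^esub> = pres_class X R []"
    by (simp_all add: presented_group_def)
  note m = pres_class_mult[OF R]
  show "\<one>\<^bsub>presented_group X R\<^esub> \<in> carrier (presented_group X R)"
    by (simp add: c o)
  fix x assume "x \<in> carrier (presented_group X R)"
  then obtain u where u: "u \<in> words X" "x = pres_class X R u" by (auto simp: c)
  show "\<one>\<^bsub>presented_group X R\<^esub> \<otimes>\<^bsub>presented_group X R\<^esub> x = x"
    using u by (simp add: o m)
  show "\<exists>y\<in>carrier (presented_group X R). y \<otimes>\<^bsub>presented_group X R\<^esub> x = \<one>\<^bsub>presented_group X R\<^esub>"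
    using u inv_word_words[of u X] pres_eq_inv_word[of u X R]
    by (auto simp: c o m pres_class_eq_iff intro!: bexI[of _ "inv_word u"])
  fix y assume "y \<in> carrier (presented_group X R)"
  then obtain v where v: "v \<in> words X" "y = pres_class X R v" by (auto simp: c)
  show "x \<otimes>\<^bsub>presented_group X R\<^esub> y \<in> carrier (presented_group X R)"
    using u v by (auto simp: c m)
  fix z assume "z \<in> carrier (presented_group X R)"
  then obtain w where w: "w \<in> words X" "z = pres_class X R w" by (auto simp: c)
  show "x \<otimes>\<^bsub>presented_group X R\<^esub> y \<otimes>\<^bsub>presented_group X R\<^esub> z =
      x \<otimes>\<^bsub>presented_group X R\<^esub> (y \<otimes>\<^bsub>presented_group X R\<^esub> z)"
    using u v w by (simp add: m)
qed

section \<open>The groups $H_m$\<close>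

datatype gen = Gen_a nat | Gen_s

definition H_gens :: "nat \<Rightarrow> gen set" where
  "H_gens m = Gen_a ` {1..m} \<union> {Gen_s}"

text \<open>The value of the automorphism $\varphi$ of the free group on the generator $a_i$.\<close>

definition phi :: "nat \<Rightarrow> gen word" where
  "phi i = (if i = 1 then [(Gen_a 1, True)] else [(Gen_a i, True), (Gen_a (i - 1), True)])"

definition H_rels :: "nat \<Rightarrow> (gen word \<times> gen word) set" where
  "H_rels m = {([(Gen_s, False), (Gen_a i, True), (Gen_s, True)], phi i) | i. i \<in> {1..m}}"

text \<open>The relations $s^{-1} a_i s = \varphi(a_i)$ present the semidirect product of the free group
  on $a_1, \ldots, a_m$ with the infinite cyclic group generated by $s$, acting through $\varphi$.\<close>

definition H :: "nat \<Rightarrow> gen word set monoid" where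
  "H m = presented_group (H_gens m) (H_rels m)"

definition H_elem :: "nat \<Rightarrow> gen word \<Rightarrow> gen word set" where
  "H_elem m w = pres_class (H_gens m) (H_rels m) w"

lemma group_H: "group (H m)"
  unfolding H_def
proof (rule group_presented_group)
  have "phi i \<in> words (H_gens m)" if "i \<in> {1..m}" for i
  proof (cases "i = 1")
    case False
    then have "i - 1 \<in> {1..m}" using that by auto
    with that False show ?thesis by (auto simp: phi_def H_gens_def)
  qed (use that in \<open>simp add: phi_def H_gens_def\<close>)
  then show "H_rels m \<subseteq> words (H_gens m) \<times> words (H_gens m)"
    by (auto simp: H_rels_def H_gens_def)
qed

definition conjugate :: "('a, 'b) monoid_scheme \<Rightarrow> 'a \<Rightarrow> 'a \<Rightarrow> bool" where
  "conjugate G a b \<longleftrightarrow> (\<exists>g\<in>carrier G. inv\<^bsub>G\<^esub> g \<otimes>\<^bsub>G\<^esub> a \<otimes>\<^bsub>G\<^esub> g = b)"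

section \<open>Model of computation\<close>

text \<open>
  Algorithms are while-programs operating on stacks of symbols.  A program mentions only finitely
  many stacks and finitely many symbols, and an elementary step pushes one given symbol, pops one
  symbol, or inspects the top of one stack, at unit cost.  This is the multi-tape Turing machine
  up to a constant factor in the running time: a tape is a pair of stacks (the cells to the left
  and to the right of the head), and a stack is a tape used at one end only; the control state of
  a machine can be kept as a symbol on a further stack.
\<close>

datatype 'a prog =
    Skip
  | Push nat 'a
  | Pop nat
  | Seq "'a prog" "'a prog"
  | IfTop nat 'a "'a prog" "'a prog"
  | WhileNonempty nat "'a prog"

type_synonym 'a store = "nat \<Rightarrow> 'a list"

text \<open>\<open>exec c s t s'\<close>: started in \<open>s\<close>, the program \<open>c\<close> halts after exactly \<open>t\<close> steps in \<open>s'\<close>.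
  Popping the empty stack leaves it empty, and \<open>IfTop\<close> takes the second branch on it.\<close>

inductive exec :: "'a prog \<Rightarrow> 'a store \<Rightarrow> nat \<Rightarrow> 'a store \<Rightarrow> bool" where
  Skip: "exec Skip s 1 s"
| Push: "exec (Push x a) s 1 (s(x := a # s x))"
| Pop: "exec (Pop x) s 1 (s(x := tl (s x)))"
| Seq: "exec c s t s' \<Longrightarrow> exec d s' t' s'' \<Longrightarrow> exec (Seq c d) s (t + t') s''"
| IfTrue: "s x \<noteq> [] \<and> hd (s x) = a \<Longrightarrow> exec c s t s' \<Longrightarrow> exec (IfTop x a c d) s (1 + t) s'"
| IfFalse: "\<not> (s x \<noteq> [] \<and> hd (s x) = a) \<Longrightarrow> exec d s t s' \<Longrightarrow> exec (IfTop x a c d) s (1 + t) s'"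
| WhileFalse: "s x = [] \<Longrightarrow> exec (WhileNonempty x c) s 1 s"
| WhileTrue: "s x \<noteq> [] \<Longrightarrow> exec c s t s' \<Longrightarrow> exec (WhileNonempty x c) s' t' s'' \<Longrightarrow>
    exec (WhileNonempty x c) s (1 + t + t') s''"

inductive_cases exec_elims:
  "exec Skip s t s'" "exec (Push x a) s t s'" "exec (Pop x) s t s'" "exec (Seq c d) s t s'"
  "exec (IfTop x a c d) s t s'"

inductive_cases exec_While_elim: "exec (WhileNonempty x c) s t s'"

lemma exec_deterministic:
  "exec c s t s' \<Longrightarrow> exec c s u s'' \<Longrightarrow> t = u \<and> s' = s''"
proof (induction arbitrary: u s'' rule: exec.induct)
  case (WhileTrue s x c t s' t' s2)
  from WhileTrue.prems WhileTrue.hyps(1) obtain t1 r t1' where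
    "u = Suc (t1 + t1')" "exec c s t1 r" "exec (WhileNonempty x c) r t1' s''"
    by (blast elim: exec_While_elim)
  then show ?case using WhileTrue.IH(1)[of t1 r] WhileTrue.IH(2)[of t1' s''] by simp
next
  case (WhileFalse s x c)
  then show ?case by (fastforce elim: exec_While_elim)
next
  case (Seq c s t s' d t' s2)
  from Seq.prems obtain t1 r t1' where
    "u = t1 + t1'" "exec c s t1 r" "exec d r t1' s''"
    by (blast elim: exec_elims(4))
  then show ?case using Seq.IH(1)[of t1 r] Seq.IH(2)[of t1' s''] by simp
next
  case (IfTrue s x a c t s' d)
  from IfTrue.prems IfTrue.hyps(1) obtain t1 where "u = Suc t1" "exec c s t1 s''"
    by (blast elim: exec_elims(5))
  then show ?case using IfTrue.IH[of t1 s''] by simp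
next
  case (IfFalse s x a d t s' c)
  from IfFalse.prems IfFalse.hyps(1) obtain t1 where "u = Suc t1" "exec d s t1 s''"
    by (blast elim: exec_elims(5))
  then show ?case using IfFalse.IH[of t1 s''] by simp
next
  case (Skip s)
  then show ?case by (fastforce elim: exec_elims(1))
next
  case (Push x a s)
  then show ?case by (fastforce elim: exec_elims(2))
next
  case (Pop x s)
  then show ?case by (fastforce elim: exec_elims(3))
qed

definition input :: "'a list \<Rightarrow> 'a list \<Rightarrow> 'a store" where
  "input u v = (\<lambda>_. [])(0 := u, 1 := v)"

text \<open>On every input \<open>(u, v) \<in> D\<close> the program halts within a number of steps bounded by a
  polynomial in the sum of the lengths of \<open>u\<close> and \<open>v\<close>, and the final content of stack 0
  satisfies \<open>spec u v\<close>.\<close>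

definition poly_time_algorithm ::
  "'a prog \<Rightarrow> ('a list \<times> 'a list) set \<Rightarrow> ('a list \<Rightarrow> 'a list \<Rightarrow> 'a list \<Rightarrow> bool) \<Rightarrow> bool" where
  "poly_time_algorithm c D spec \<longleftrightarrow>
    (\<exists>p :: nat poly. \<forall>(u, v)\<in>D. \<exists>t s.
       exec c (input u v) t s \<and> t \<le> poly p (length u + length v) \<and> spec u v (s 0))"

text \<open>A program answers ``yes'' by halting with stack 0 nonempty and ``no'' by halting with
  stack 0 empty.\<close>

definition solves_conjugacy_problem_in_poly_time :: "nat \<Rightarrow> (gen \<times> bool) prog \<Rightarrow> bool" where
  "solves_conjugacy_problem_in_poly_time m c \<longleftrightarrow>
    poly_time_algorithm c (words (H_gens m) \<times> words (H_gens m))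
      (\<lambda>u v out. out \<noteq> [] \<longleftrightarrow> conjugate (H m) (H_elem m u) (H_elem m v))"

definition solves_conjugacy_search_problem_in_poly_time :: "nat \<Rightarrow> (gen \<times> bool) prog \<Rightarrow> bool" where
  "solves_conjugacy_search_problem_in_poly_time m c \<longleftrightarrow>
    poly_time_algorithm c
      {(u, v). u \<in> words (H_gens m) \<and> v \<in> words (H_gens m) \<and>
               conjugate (H m) (H_elem m u) (H_elem m v)}
      (\<lambda>u v w. w \<in> words (H_gens m) \<and>
         H_elem m u \<otimes>\<^bsub>H m\<^esub> H_elem m w = H_elem m w \<otimes>\<^bsub>H m\<^esub> H_elem m v)"

end

(*
  H_m is an iterated HNN extension: a_k^-1 s a_k = s a_(k-1)^-1, so H_k arises from H_(k-1) by adding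
  the stable letter a_k with infinite cyclic edge groups, and Britton's lemma becomes a statement
  about reduced words of the free group F.  Two elements of H_k that are not conjugate into H_(k-1)
  move an axis of the Bass-Serre tree; a conjugator maps an edge on one axis to an edge on the other,
  and both edges may be taken on the paths read off from the words.  Hence some conjugator has the
  form t^-1 s^i r with t, r suffixes of the two normal forms.  The exponent i is bounded linearly,
  because phi^i(x) = y forces |i| to be at most linear in |x| + |y| unless phi fixes x: this follows
  from exponent sums and, where these vanish, from the positivity of the words phi^i(a_k), i >= 0.
  So all candidates can be tried.  Conjugacy classes of H_(k-1) fuse in H_k only along the edge
  groups, which is dealt with by conjugating powers of a_k^-1 s a_k to powers of s.  A polynomial
  time test for equality is obtained by moving all letters s to the front: phi grows polynomially.
*)
theory Submission
  imports Defs "HOL-Library.Sublist"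
begin

section \<open>Free groups\<close>

text \<open>An edge of the Bass-Serre tree appears as a place in a reduced word: before a letter a_k
  or behind a letter a_k^-1. The asymmetry is forced. Since \<phi>^i(a_k) = a_k p with p in the
  smaller free factor, an initial a_k and a final a_k^-1 stay where they are under \<phi>^i, whereas
  an initial a_k^-1 moves behind p^-1. Everything that is traced through powers of \<phi> is
  therefore phrased with these two places.

  The delicate point is fusion: elements of H_(k-1) may be conjugate in H_k only, possibly through
  several ranks. The remedy is a choice of representatives. Each class is pushed down to the rank k
  at which descent stops, and there a representative conjugate in H_k to a_(k+1)^-1 s^p a_(k+1) is
  replaced by s^p. For the remaining ones an exponent sum rules out any contact with edge groups at
  higher ranks, so conjugacy in H_m is decided in H_k itself.

  Running times are not counted for the algorithm as a whole. All searches are folds over words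
  whose accumulator does not grow, and every candidate is verified by one equality test; the one
  place where sizes could explode is the iteration of \<phi> in the normal form.\<close>

definition linv :: "'g \<times> bool \<Rightarrow> 'g \<times> bool" where
  "linv l = (fst l, \<not> snd l)"

lemma linv_linv [simp]: "linv (linv l) = l"
  by (simp add: linv_def)

lemma linv_neq [simp]: "linv l \<noteq> l" "l \<noteq> linv l"
  by (cases l; simp add: linv_def)+

lemma fst_linv [simp]: "fst (linv l) = fst l"
  by (simp add: linv_def)

lemma linv_inj [simp]: "linv l = linv l' \<longleftrightarrow> l = l'"
  by (metis linv_linv)

lemma inv_word_simps [simp]:
  "inv_word [] = []" "inv_word (l # w) = inv_word w @ [linv l]"
  by (simp_all add: inv_word_def linv_def split: prod.split)

lemma inv_word_append [simp]: "inv_word (u @ v) = inv_word v @ inv_word u"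
  by (simp add: inv_word_def)

lemma inv_word_inv_word [simp]: "inv_word (inv_word w) = w"
  by (induction w) auto

lemma fst_set_inv_word [simp]: "fst ` set (inv_word w) = fst ` set w"
  by (induction w) auto

text \<open>Left multiplication by a letter. As \<open>ccons l\<close> and
  \<open>ccons (linv l)\<close> are mutually inverse on reduced words, words act there by
  permutations (van der Waerden), and the group laws follow without a confluence argument.\<close>

definition ccons :: "'g \<times> bool \<Rightarrow> 'g word \<Rightarrow> 'g word" where
  "ccons l w = (if w \<noteq> [] \<and> hd w = linv l then tl w else l # w)"

definition red :: "'g word \<Rightarrow> 'g word" where
  "red w = foldr ccons w []"

fun reduced :: "'g word \<Rightarrow> bool" where
  "reduced [] = True"
| "reduced [l] = True"
| "reduced (l # k # w) = (k \<noteq> linv l \<and> reduced (k # w))"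

lemma red_Nil [simp]: "red [] = []"
  by (simp add: red_def)

lemma red_Cons: "red (l # w) = ccons l (red w)"
  by (simp add: red_def)

lemma reduced_Cons: "reduced (l # w) \<longleftrightarrow> reduced w \<and> (w = [] \<or> hd w \<noteq> linv l)"
  by (cases w) auto

lemma reduced_append:
  "reduced (u @ v) \<longleftrightarrow> reduced u \<and> reduced v \<and> (u = [] \<or> v = [] \<or> hd v \<noteq> linv (last u))"
  by (induction u) (auto simp: reduced_Cons)

lemma reduced_ccons: "reduced w \<Longrightarrow> reduced (ccons l w)"
  by (cases w) (auto simp: ccons_def reduced_Cons)

lemma reduced_red [simp]: "reduced (red w)"
  by (induction w) (auto simp: red_Cons reduced_ccons)

lemma red_reduced [simp]: "reduced w \<Longrightarrow> red w = w"
  by (induction w) (auto simp: red_Cons reduced_Cons ccons_def)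

lemma ccons_ccons: "reduced w \<Longrightarrow> ccons l (ccons (linv l) w) = w"
  by (cases w) (auto simp: ccons_def reduced_Cons)

lemma foldr_ccons_reduced: "reduced w \<Longrightarrow> reduced (foldr ccons u w)"
  by (induction u) (auto simp: reduced_ccons)

lemma red_append: "red (u @ v) = foldr ccons u (red v)"
  by (simp add: red_def)

lemma foldr_ccons_inverse: "reduced w \<Longrightarrow> foldr ccons (u @ inv_word u) w = w"
proof (induction u arbitrary: w)
  case (Cons l u)
  then have "foldr ccons u (foldr ccons (inv_word u) (ccons (linv l) w)) = ccons (linv l) w"
    using Cons.IH[OF reduced_ccons[OF Cons.prems]] by simp
  then show ?case using ccons_ccons[OF Cons.prems] by simp
qed simp

lemma foldr_ccons_ccons:
  "reduced w \<Longrightarrow> reduced z \<Longrightarrow> foldr ccons (ccons l w) z = ccons l (foldr ccons w z)"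
proof (cases "w \<noteq> [] \<and> hd w = linv l")
  case True
  assume *: "reduced w" "reduced z"
  from True obtain w' where w: "w = linv l # w'" by (cases w) auto
  have "ccons l (ccons (linv l) (foldr ccons w' z)) = foldr ccons w' z"
    using * by (simp add: ccons_ccons foldr_ccons_reduced)
  then show ?thesis by (simp add: w ccons_def)
qed (auto simp: ccons_def)

lemma foldr_ccons_red: "reduced z \<Longrightarrow> foldr ccons (red u) z = foldr ccons u z"
  by (induction u) (auto simp: red_Cons foldr_ccons_ccons)

lemma red_append_red_left: "red (red u @ v) = red (u @ v)"
  by (simp add: red_append foldr_ccons_red)

lemma red_append_red_right: "red (u @ red v) = red (u @ v)"
  by (simp add: red_append)

lemma red_append_inv_word: "red (u @ inv_word u) = []"
  using foldr_ccons_inverse[of "[]" u] by (simp add: red_def)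

lemma set_ccons: "set (ccons l w) \<subseteq> insert l (set w)"
  by (cases w) (auto simp: ccons_def)

lemma set_red: "set (red w) \<subseteq> set w"
  by (induction w) (use set_ccons in \<open>fastforce simp: red_Cons\<close>)+

lemma filter_red: "length (filter P (red w)) \<le> length (filter P w)"
proof (induction w)
  case (Cons l w)
  have "length (filter P (ccons l (red w))) \<le> length (filter P (l # red w))"
    by (cases "red w") (auto simp: ccons_def)
  then show ?case using Cons by (auto simp: red_Cons split: if_splits)
qed simp

text \<open>Only one block at the seam disappears: the last letter of \<open>u\<close> either
  cancels against the head of \<open>v\<close>, exposing a shorter problem, or blocks all
  cancellation.\<close>

lemma red_cancellation:
  assumes "reduced u" "reduced v"
  shows "\<exists>u' c v'. u = u' @ c \<and> v = inv_word c @ v' \<and> red (u @ v) = u' @ v'"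
  using assms
proof (induction u arbitrary: v rule: rev_induct)
  case Nil
  then show ?case by simp
next
  case (snoc l u)
  show ?case
  proof (cases "v \<noteq> [] \<and> hd v = linv l")
    case True
    then obtain w where v: "v = linv l # w" by (cases v) auto
    have r: "reduced u" "reduced w" using snoc.prems v by (auto simp: reduced_append reduced_Cons)
    have "red v = v" using snoc.prems by simp
    then have "red ((u @ [l]) @ v) = foldr ccons u (ccons l (linv l # w))"
      unfolding red_append by (simp add: v)
    also have "ccons l (linv l # w) = w" by (simp add: ccons_def)
    finally have "red ((u @ [l]) @ v) = red (u @ w)" using r by (simp add: red_append)
    with snoc.IH[OF r] obtain u' c v' where
      "u = u' @ c" "w = inv_word c @ v'" "red ((u @ [l]) @ v) = u' @ v'" by metis
    moreover from this v have "v = inv_word (c @ [l]) @ v'" by simp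
    ultimately show ?thesis
      by (intro exI[of _ u'] exI[of _ "c @ [l]"] exI[of _ v']) (simp only: append_assoc simp_thms)
  next
    case False
    then have "reduced ((u @ [l]) @ v)" using snoc.prems
      by (simp only: reduced_append[of "u @ [l]"]) auto
    then have "red ((u @ [l]) @ v) = (u @ [l]) @ v" by (rule red_reduced)
    then show ?thesis by (intro exI[of _ "u @ [l]"] exI[of _ "[]"] exI[of _ v]) simp
  qed
qed

lemma reduced_inv_word: "reduced w \<Longrightarrow> reduced (inv_word w)"
proof (induction w)
  case (Cons l w)
  then show ?case
    by (cases w) (auto simp: reduced_append reduced_Cons)
qed simp

section \<open>The free group as a type and its universal property\<close>

typedef 'g fg = "{w :: 'g word. reduced w}"
  morphisms wd mk by (intro exI[of _ "[]"]) simp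

lemma reduced_wd [simp]: "reduced (wd x)"
  using wd by auto

definition fg_of :: "'g word \<Rightarrow> 'g fg" where
  "fg_of w = mk (red w)"

lemma wd_fg_of [simp]: "wd (fg_of w) = red w"
  by (simp add: fg_of_def mk_inverse)

lemma fg_of_wd [simp]: "fg_of (wd x) = x"
  by (simp add: fg_of_def wd_inverse)

text \<open>The free group is written additively because the type class \<open>group_add\<close> does not
  assume commutativity.\<close>

instantiation fg :: (type) group_add
begin

definition zero_fg :: "'a fg" where "zero_fg = fg_of []"
definition plus_fg :: "'a fg \<Rightarrow> 'a fg \<Rightarrow> 'a fg" where "plus_fg x y = fg_of (wd x @ wd y)"
definition uminus_fg :: "'a fg \<Rightarrow> 'a fg" where "uminus_fg x = fg_of (inv_word (wd x))"
definition minus_fg :: "'a fg \<Rightarrow> 'a fg \<Rightarrow> 'a fg" where "minus_fg x y = x + - y"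

instance
proof
  fix a b c :: "'a fg"
  show "a + b + c = a + (b + c)"
    by (simp add: plus_fg_def flip: wd_inject) (simp add: red_append_red_left red_append_red_right)
  show "0 + a = a" "a + 0 = a"
    by (simp_all add: plus_fg_def zero_fg_def)
  show "- a + a = 0"
    using red_append_inv_word[of "inv_word (wd a)"]
    by (simp add: plus_fg_def zero_fg_def uminus_fg_def red_append_red_left flip: wd_inject)
  show "a + - b = a - b" by (simp add: minus_fg_def)
qed

end

lemma wd_zero [simp]: "wd 0 = []"
  by (simp add: zero_fg_def)

lemma wd_plus: "wd (x + y) = red (wd x @ wd y)"
  by (simp add: plus_fg_def)

lemma wd_uminus: "wd (- x) = inv_word (wd x)"
  by (simp add: uminus_fg_def reduced_inv_word)

lemma wd_eq_Nil_iff [simp]: "wd x = [] \<longleftrightarrow> x = 0"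
  by (metis wd_inject wd_zero)

lemma fg_of_append: "fg_of (u @ v) = fg_of u + fg_of v"
  by (simp add: red_append_red_left red_append_red_right wd_plus flip: wd_inject)

lemma fg_of_Nil [simp]: "fg_of [] = 0"
  by (simp add: zero_fg_def)

lemma fg_of_inv_word: "fg_of (inv_word w) = - fg_of w"
proof -
  have "fg_of (inv_word w) + fg_of w = 0"
    using red_append_inv_word[of "inv_word w"] by (simp flip: fg_of_append wd_inject)
  then show ?thesis by (simp add: eq_neg_iff_add_eq_0)
qed

definition gn :: "'g \<Rightarrow> 'g fg" where
  "gn g = fg_of [(g, True)]"

lemma wd_gn [simp]: "wd (gn g) = [(g, True)]"
  by (simp add: gn_def)

lemma wd_uminus_gn [simp]: "wd (- gn g) = [(g, False)]"
  by (simp add: wd_uminus linv_def)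

definition slet :: "('g \<Rightarrow> 'b::group_add) \<Rightarrow> 'g \<times> bool \<Rightarrow> 'b" where
  "slet f l = (if snd l then f (fst l) else - f (fst l))"

text \<open>The homomorphism given by the universal property. The target is an arbitrary group, so
  that it serves for \<phi> as well as for exponent sums with values in the integers.\<close>

definition ext :: "('g \<Rightarrow> 'b::group_add) \<Rightarrow> 'g fg \<Rightarrow> 'b" where
  "ext f x = sum_list (map (slet f) (wd x))"

lemma slet_linv: "slet f (linv l) = - slet f l"
  by (simp add: slet_def linv_def)

lemma sum_list_ccons: "sum_list (map (slet f) (ccons l w)) = slet f l + sum_list (map (slet f) w)"
  by (cases w) (auto simp: ccons_def slet_linv add.assoc[symmetric])

lemma sum_list_red: "sum_list (map (slet f) (red w)) = sum_list (map (slet f) w)"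
  by (induction w) (auto simp: red_Cons sum_list_ccons)

lemma ext_fg_of: "ext f (fg_of w) = sum_list (map (slet f) w)"
  by (simp add: ext_def sum_list_red)

lemma ext_plus: "ext f (x + y) = ext f x + ext f y"
  by (simp add: ext_def wd_plus sum_list_red)

lemma ext_zero [simp]: "ext f 0 = 0"
  by (simp add: ext_def)

lemma ext_gn [simp]: "ext f (gn g) = f g"
  by (simp add: ext_def slet_def)

lemma ext_uminus: "ext f (- x) = - ext f x"
  by (metis add.right_inverse ext_plus ext_zero neg_eq_iff_add_eq_0)

lemma ext_diff: "ext f (x - y) = ext f x - ext f y"
  by (metis add_uminus_conv_diff ext_plus ext_uminus)

lemma fg_of_Cons: "fg_of (l # w) = slet gn l + fg_of w"
proof -
  have "fg_of [l] = slet gn l"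
    by (cases l) (auto simp: slet_def wd_uminus linv_def simp flip: wd_inject)
  then show ?thesis using fg_of_append[of "[l]" w] by simp
qed

lemma fg_hom_uminus:
  fixes h :: "'g fg \<Rightarrow> 'b::group_add"
  assumes "\<And>x y. h (x + y) = h x + h y"
  shows "h (- x) = - h x" "h 0 = 0"
proof -
  have "h 0 + h 0 = h 0 + 0" using assms[of 0 0] by (simp only: add_0_right)
  then show z: "h 0 = 0" by (rule add_left_imp_eq)
  show "h (- x) = - h x" using assms[of "- x" x] z by (simp add: eq_neg_iff_add_eq_0)
qed

lemma fg_hom_eq_ext:
  fixes h :: "'g fg \<Rightarrow> 'b::group_add"
  assumes "\<And>x y. h (x + y) = h x + h y"
  shows "h x = ext (\<lambda>g. h (gn g)) x"
proof -
  have "h (fg_of w) = sum_list (map (slet (\<lambda>g. h (gn g))) w)" for w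
    by (induction w)
      (auto simp: fg_of_Cons assms slet_def fg_hom_uminus[of h, OF assms])
  then show ?thesis by (metis ext_def fg_of_wd)
qed

lemma ext_ext: "ext f (ext g x) = ext (\<lambda>a. ext f (g a)) x"
  using fg_hom_eq_ext[of "\<lambda>x. ext f (ext g x)" x] by (simp add: ext_plus)

lemma ext_id: "ext gn x = x"
  by (rule fg_hom_eq_ext[of "\<lambda>x. x" x, symmetric]) simp

lemma wd_plus_reduced: "reduced (wd x @ wd y) \<Longrightarrow> wd (x + y) = wd x @ wd y"
  by (simp add: wd_plus)

lemma wd_split:
  assumes "wd x = u @ v"
  shows "x = fg_of u + fg_of v" "wd (fg_of u) = u" "wd (fg_of v) = v"
proof -
  have "reduced (u @ v)" using assms reduced_wd[of x] by simp
  then show "wd (fg_of u) = u" "wd (fg_of v) = v" by (auto simp: reduced_append)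
  show "x = fg_of u + fg_of v" unfolding fg_of_append[symmetric] assms[symmetric] by simp
qed

lemma wd_plus_cancellation:
  obtains x' c y' where "wd x = wd x' @ wd c" "wd y = wd (- c) @ wd y'" "wd (x + y) = wd x' @ wd y'"
    "x = x' + c" "y = - c + y'"
proof -
  from red_cancellation[of "wd x" "wd y"] obtain u c v where
    *: "wd x = u @ c" "wd y = inv_word c @ v" "red (wd x @ wd y) = u @ v" by auto
  note x = wd_split[OF *(1)] and y = wd_split[OF *(2)]
  show ?thesis
  proof (rule that[of "fg_of u" "fg_of c" "fg_of v"])
    show "x = fg_of u + fg_of c" by (rule x(1))
    show "y = - fg_of c + fg_of v" using y(1) by (simp only: fg_of_inv_word)
    show "wd x = wd (fg_of u) @ wd (fg_of c)" unfolding x(2,3) by (rule *)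
    show "wd y = wd (- fg_of c) @ wd (fg_of v)" unfolding y(3) wd_uminus x(3) by (rule *)
    show "wd (x + y) = wd (fg_of u) @ wd (fg_of v)" unfolding y(3) x(2) wd_plus by (rule *)
  qed
qed

section \<open>The automorphism and the filtration by rank\<close>

declare One_nat_def [simp del]

abbreviation ag :: "nat \<Rightarrow> gen fg" where "ag k \<equiv> gn (Gen_a k)"
abbreviation sg :: "gen fg" where "sg \<equiv> gn Gen_s"

text \<open>The automorphism is extended to the free group on all generators by fixing $s$, so that it
  can be applied to a normal form $s^p x$ as a whole; $a_0$ is a dummy generator.\<close>

primrec phi_img :: "gen \<Rightarrow> gen fg" where
  "phi_img (Gen_a k) = (if k \<le> 1 then ag k else ag k + ag (k - 1))"
| "phi_img Gen_s = sg"

text \<open>Applying the inverse of \<phi> to \<phi>(a_k) = a_k a_(k-1) and solving for the image of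
  a_k gives this recursion.\<close>

fun phi_inv_a :: "nat \<Rightarrow> gen fg" where
  "phi_inv_a 0 = ag 0"
| "phi_inv_a (Suc 0) = ag 1"
| "phi_inv_a (Suc (Suc k)) = ag (Suc (Suc k)) - phi_inv_a (Suc k)"

primrec phi_inv_img :: "gen \<Rightarrow> gen fg" where
  "phi_inv_img (Gen_a k) = phi_inv_a k"
| "phi_inv_img Gen_s = sg"

definition ph1 :: "gen fg \<Rightarrow> gen fg" where "ph1 = ext phi_img"
definition ph1' :: "gen fg \<Rightarrow> gen fg" where "ph1' = ext phi_inv_img"

lemma ph1_plus: "ph1 (x + y) = ph1 x + ph1 y"
  by (simp add: ph1_def ext_plus)

lemma ph1'_plus: "ph1' (x + y) = ph1' x + ph1' y"
  by (simp add: ph1'_def ext_plus)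

lemma ph1_phi_inv_a: "ph1 (phi_inv_a k) = ag k"
  by (induction k rule: phi_inv_a.induct) (auto simp: ph1_def ext_diff One_nat_def)

lemma ph1'_phi_img: "ph1' (phi_img g) = gn g"
proof (cases g)
  case (Gen_a k)
  then show ?thesis
    by (cases k rule: phi_inv_a.cases) (auto simp: ph1'_def ext_plus One_nat_def)
qed (simp add: ph1'_def)

lemma ph1_phi_inv_img: "ph1 (phi_inv_img g) = gn g"
  by (cases g) (auto simp: ph1_phi_inv_a, simp add: ph1_def)

lemma ph1_ph1' [simp]: "ph1 (ph1' x) = x"
  using ph1_phi_inv_img by (simp add: ph1_def ph1'_def ext_ext ext_id)

lemma ph1'_ph1 [simp]: "ph1' (ph1 x) = x"
  using ph1'_phi_img by (simp add: ph1_def ph1'_def ext_ext ext_id)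

definition ph :: "int \<Rightarrow> gen fg \<Rightarrow> gen fg" where
  "ph i = (if i \<ge> 0 then ph1 ^^ nat i else ph1' ^^ nat (- i))"

lemma ph_0 [simp]: "ph 0 x = x"
  by (simp add: ph_def)

lemma ph_1: "ph 1 x = ph1 x"
  by (simp add: ph_def)

lemma ph_plus_1: "ph (i + 1) x = ph1 (ph i x)"
proof (cases "i \<ge> 0")
  case True
  then have "nat (i + 1) = Suc (nat i)" by simp
  with True show ?thesis by (simp add: ph_def)
next
  case False
  then have "nat (- i) = Suc (nat (- (i + 1)))" by simp
  with False show ?thesis by (auto simp: ph_def)
qed

lemma ph_minus_1: "ph (i - 1) x = ph1' (ph i x)"
  by (metis diff_add_cancel ph1'_ph1 ph_plus_1)

lemma ph_add: "ph (i + j) x = ph i (ph j x)"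
proof (induction i rule: int_induct[where k = 0])
  case (step1 i)
  then show ?case by (metis add.commute add.left_commute ph_plus_1)
next
  case (step2 i)
  then show ?case by (metis diff_add_eq ph_minus_1)
qed simp

lemma ph_hom [simp]: "ph i (x + y) = ph i x + ph i y"
proof (induction i rule: int_induct[where k = 0])
  case (step1 i)
  then show ?case by (simp add: ph_plus_1 ph1_plus)
next
  case (step2 i)
  then show ?case by (simp add: ph_minus_1 ph1'_plus)
qed simp

lemma ph_uminus [simp]: "ph i (- x) = - ph i x"
  by (rule fg_hom_uminus(1)) simp

lemma ph_zero [simp]: "ph i 0 = 0"
  by (rule fg_hom_uminus(2)[of "ph i"]) simp

lemma ph_diff [simp]: "ph i (x - y) = ph i x - ph i y"
  by (simp only: diff_conv_add_uminus ph_hom ph_uminus)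

lemma ph_ph: "ph i (ph j x) = ph (i + j) x"
  by (simp add: ph_add)

lemma ph_cancel [simp]: "ph (- i) (ph i x) = x" "ph i (ph (- i) x) = x"
  by (simp_all add: ph_ph)

lemma ph_inj [simp]: "ph i x = ph i y \<longleftrightarrow> x = y"
  by (metis ph_cancel(1))

lemma ph_eq_0 [simp]: "ph i x = 0 \<longleftrightarrow> x = 0"
  using ph_inj[of i x 0] by simp

lemma ph_sg [simp]: "ph i sg = sg"
proof (induction i rule: int_induct[where k = 0])
  case (step1 i)
  then show ?case by (simp add: ph_plus_1 ph1_def)
next
  case (step2 i)
  then show ?case by (simp add: ph_minus_1 ph1'_def)
qed simp

definition L :: "nat \<Rightarrow> gen fg set" where
  "L k = {x. fst ` set (wd x) \<subseteq> Gen_a ` {1..k}}"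

lemma L_zero [simp]: "0 \<in> L k"
  by (simp add: L_def)

lemma L_mono: "k \<le> n \<Longrightarrow> x \<in> L k \<Longrightarrow> x \<in> L n"
  unfolding L_def using image_mono[of "{1..k}" "{1..n}" Gen_a] by auto

lemma L_plus [simp]:
  assumes "x \<in> L k" and "y \<in> L k"
  shows "x + y \<in> L k"
proof -
  have "fst ` set (wd (x + y)) \<subseteq> fst ` set (wd x @ wd y)"
    unfolding wd_plus by (intro image_mono set_red)
  also have "\<dots> = fst ` set (wd x) \<union> fst ` set (wd y)" by (simp add: image_Un)
  also have "\<dots> \<subseteq> Gen_a ` {1..k}" using assms by (simp add: L_def)
  finally show ?thesis by (simp add: L_def)
qed

lemma L_uminus [simp]: "- x \<in> L k \<longleftrightarrow> x \<in> L k"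
  by (simp add: L_def wd_uminus)

lemma L_diff [simp]: "x \<in> L k \<Longrightarrow> y \<in> L k \<Longrightarrow> x - y \<in> L k"
  using L_plus[of x k "- y"] by simp

lemma L_ag [simp]: "ag j \<in> L k \<longleftrightarrow> 1 \<le> j \<and> j \<le> k"
  by (auto simp: L_def)

lemma L_add_right: "y \<in> L k \<Longrightarrow> x + y \<in> L k \<longleftrightarrow> x \<in> L k"
  using L_diff[of "x + y" k y] by auto

lemma ext_L:
  assumes "\<And>j. 1 \<le> j \<Longrightarrow> j \<le> k \<Longrightarrow> f (Gen_a j) \<in> L n" and "x \<in> L k"
  shows "ext f x \<in> L n"
proof -
  have "sum_list (map (slet f) w) \<in> L n" if "fst ` set w \<subseteq> Gen_a ` {1..k}" for w
    using that
  proof (induction w)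
    case (Cons l w)
    then have "slet f l \<in> L n" using assms(1) by (auto simp: slet_def)
    with Cons show ?case by simp
  qed simp
  then show ?thesis using assms(2) by (simp add: ext_def L_def)
qed

lemma phi_inv_a_L: "1 \<le> k \<Longrightarrow> phi_inv_a k \<in> L k"
proof (induction k rule: phi_inv_a.induct)
  case (3 k)
  then have "phi_inv_a (Suc k) \<in> L (Suc (Suc k))" using L_mono[of "Suc k" "Suc (Suc k)"] by simp
  then show ?case by simp
qed auto

lemma ph_L [simp]: "ph i x \<in> L k \<longleftrightarrow> x \<in> L k"
proof -
  have *: "ph i x \<in> L k" if "x \<in> L k" for i x
  proof (induction i rule: int_induct[where k = 0])
    case (step1 i)
    have "ag j + ag (j - 1) \<in> L k" if "1 \<le> j" "j \<le> k" "j \<noteq> 1" for j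
      using that by (intro L_plus) auto
    with step1 show ?case unfolding ph_plus_1 ph1_def by (intro ext_L[of k]) auto
  next
    case (step2 i)
    then show ?case unfolding ph_minus_1 ph1'_def
      by (intro ext_L[of k]) (auto intro: L_mono[OF _ phi_inv_a_L])
  qed (use that in simp)
  then show ?thesis by (metis ph_cancel(1))
qed

text \<open>\<open>P k i\<close> is the element $p$ with $\varphi^i(a_k) = a_k p$.\<close>

definition P :: "nat \<Rightarrow> int \<Rightarrow> gen fg" where
  "P k i = - ag k + ph i (ag k)"

lemma ph_ag: "ph i (ag k) = ag k + P k i"
  by (simp add: P_def add.assoc[symmetric])

lemma P_0 [simp]: "P k 0 = 0"
  by (simp add: P_def)

lemma P_plus_1: "k \<ge> 2 \<Longrightarrow> P k (i + 1) = P k i + ph i (ag (k - 1))"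
  by (simp add: P_def ph_add ph_1 ph1_def add.assoc)

lemma P_le_1: "k \<le> 1 \<Longrightarrow> P k i = 0"
proof (induction i rule: int_induct[where k = 0])
  case (step1 i)
  then show ?case by (simp add: P_def ph_add ph_1 ph1_def)
next
  case (step2 i)
  have "P k i = P k (i - 1)" using step2.prems ph_add[of "i - 1" 1 "ag k"]
    by (simp add: P_def ph_1 ph1_def)
  then show ?case using step2 by simp
qed simp

lemma P_L [simp]: "P k i \<in> L (k - 1)"
proof (cases "k \<ge> 2")
  case True
  then show ?thesis
  proof (induction i rule: int_induct[where k = 0])
    case (step1 i)
    then show ?case by (simp add: P_plus_1)
  next
    case (step2 i)
    then have "P k (i - 1) + ph (i - 1) (ag (k - 1)) \<in> L (k - 1)"
      using P_plus_1[OF True, of "i - 1"] by simp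
    then show ?case using True L_add_right[of "ph (i - 1) (ag (k - 1))"] by simp
  qed simp
next
  case False
  then show ?thesis using P_le_1[of k i] by simp
qed

text \<open>Deliberately one-sided: a_k is mapped to a_k p and keeps its place at the front, while
  a_k^-1 is mapped to p^-1 a_k^-1. Hence \<open>St\<close>, unlike \<open>Sn\<close> below, is
  invariant under \<phi>^i on \<open>L k\<close>.\<close>

definition St :: "nat \<Rightarrow> gen fg \<Rightarrow> bool" where
  "St k x \<longleftrightarrow> wd x \<noteq> [] \<and> hd (wd x) = (Gen_a k, True)"

definition cnt :: "nat \<Rightarrow> gen fg \<Rightarrow> nat" where
  "cnt k x = length (filter (\<lambda>l. fst l = Gen_a k) (wd x))"

lemma St_uminus: "St k (- x) \<longleftrightarrow> wd x \<noteq> [] \<and> last (wd x) = (Gen_a k, False)"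
  by (cases "wd x" rule: rev_cases) (auto simp: St_def wd_uminus linv_def)

lemma cnt_uminus [simp]: "cnt k (- x) = cnt k x"
proof -
  have "length (filter (\<lambda>l. fst l = Gen_a k) (inv_word w)) = length (filter (\<lambda>l. fst l = Gen_a k) w)" for w
    by (induction w) auto
  then show ?thesis by (simp add: cnt_def wd_uminus)
qed

lemma cnt_zero [simp]: "cnt k 0 = 0"
  by (simp add: cnt_def)

lemma cnt_plus: "cnt k (x + y) \<le> cnt k x + cnt k y"
  using filter_red[of "\<lambda>l. fst l = Gen_a k" "wd x @ wd y"] by (simp add: cnt_def wd_plus)

lemma L_notin:
  assumes "x \<in> L (k - 1)"
  shows "Gen_a k \<notin> fst ` set (wd x)"
proof -
  have "Gen_a k \<notin> Gen_a ` {1..k - 1}" by auto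
  with assms show ?thesis unfolding L_def by blast
qed

lemma Gen_a_image_less: "Gen_a ` {1..k} - {Gen_a k} \<subseteq> Gen_a ` {1..k - 1}"
proof -
  have "{1..k} \<subseteq> insert k {1..k - 1}" by auto
  then show ?thesis by blast
qed

lemma cnt_0_iff: "x \<in> L k \<Longrightarrow> cnt k x = 0 \<longleftrightarrow> x \<in> L (k - 1)"
proof
  assume "x \<in> L k" "cnt k x = 0"
  then have "fst ` set (wd x) \<subseteq> Gen_a ` {1..k} - {Gen_a k}"
    by (auto simp: L_def cnt_def filter_empty_conv)
  also have "\<dots> \<subseteq> Gen_a ` {1..k - 1}" by (rule Gen_a_image_less)
  finally show "x \<in> L (k - 1)" by (simp add: L_def)
next
  assume "x \<in> L (k - 1)"
  then have "\<forall>l\<in>set (wd x). fst l \<noteq> Gen_a k" using L_notin[of x k] by (metis image_eqI)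
  then show "cnt k x = 0" by (simp add: cnt_def filter_empty_conv)
qed

lemma L_cnt [simp]: "x \<in> L (k - 1) \<Longrightarrow> cnt k x = 0"
  using cnt_0_iff[of x k] L_mono[of "k - 1" k x] by simp

lemma L_not_St [simp]: "x \<in> L (k - 1) \<Longrightarrow> \<not> St k x"
  using L_notin[of x k] by (cases "wd x") (auto simp: St_def)

definition Sn :: "nat \<Rightarrow> gen fg \<Rightarrow> bool" where
  "Sn k x \<longleftrightarrow> wd x \<noteq> [] \<and> hd (wd x) = (Gen_a k, False)"

lemma L_not_Sn [simp]: "x \<in> L (k - 1) \<Longrightarrow> \<not> Sn k x"
  using L_notin[of x k] by (cases "wd x") (auto simp: Sn_def)

lemma last_wd_neq:
  assumes "w \<in> L (k - 1)" and "w \<noteq> 0"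
  shows "fst (last (wd w)) \<noteq> Gen_a k"
proof -
  have "last (wd w) \<in> set (wd w)" using assms(2) by simp
  then show ?thesis using L_notin[OF assms(1)] by (metis image_eqI)
qed

lemma wd_pos:
  assumes "w \<in> L (k - 1)" and "\<not> Sn k z"
  shows "wd (w + ag k + z) = wd w @ (Gen_a k, True) # wd z"
proof -
  have "reduced (wd w @ (Gen_a k, True) # wd z)"
    using assms(2) last_wd_neq[OF assms(1)]
    by (cases "w = 0") (auto simp: reduced_append reduced_Cons Sn_def linv_def)
  then show ?thesis by (simp add: wd_plus red_append_red_left)
qed

lemma wd_neg:
  assumes "w \<in> L (k - 1)" and "\<not> St k z"
  shows "wd (w - ag k + z) = wd w @ (Gen_a k, False) # wd z"
proof -
  have "reduced (wd w @ (Gen_a k, False) # wd z)"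
    using assms(2) last_wd_neq[OF assms(1)]
    by (cases "w = 0") (auto simp: reduced_append reduced_Cons St_def linv_def)
  moreover have "wd (w + - ag k + z) = red (wd w @ (Gen_a k, False) # wd z)"
    by (simp only: wd_plus red_append_red_left wd_uminus_gn append.simps append_assoc)
  ultimately show ?thesis by simp
qed

lemma first_split:
  assumes "x \<in> L k" and "x \<notin> L (k - 1)"
  obtains (pos) w z where "w \<in> L (k - 1)" "z \<in> L k" "\<not> Sn k z" "x = w + ag k + z"
      "wd x = wd w @ (Gen_a k, True) # wd z"
    | (neg) w z where "w \<in> L (k - 1)" "z \<in> L k" "\<not> St k z" "x = w - ag k + z"
      "wd x = wd w @ (Gen_a k, False) # wd z"
proof -
  have "cnt k x \<noteq> 0" using assms cnt_0_iff by auto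
  then have "\<exists>l\<in>set (wd x). fst l = Gen_a k" by (auto simp: cnt_def filter_empty_conv)
  then obtain u b v where uv: "wd x = u @ (Gen_a k, b) # v" "\<forall>l\<in>set u. fst l \<noteq> Gen_a k"
    using split_list_first_prop[of "wd x" "\<lambda>l. fst l = Gen_a k"] by (metis prod.collapse)
  have r: "reduced (u @ (Gen_a k, b) # v)" by (metis uv(1) reduced_wd)
  then have uv': "red u = u" "red v = v" by (auto simp: reduced_append reduced_Cons)
  have "fst ` set u \<subseteq> Gen_a ` {1..k} - {Gen_a k}" using assms(1) uv by (auto simp: L_def)
  also have "\<dots> \<subseteq> Gen_a ` {1..k - 1}" by (rule Gen_a_image_less)
  finally have w: "fg_of u \<in> L (k - 1)" by (simp add: L_def uv')
  have "set v \<subseteq> set (wd x)" using uv(1) by auto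
  then have "fst ` set v \<subseteq> fst ` set (wd x)" by (rule image_mono)
  also have "\<dots> \<subseteq> Gen_a ` {1..k}" using assms(1) by (simp add: L_def)
  finally have z: "fg_of v \<in> L k" by (simp add: L_def uv')
  have x: "x = fg_of u + fg_of [(Gen_a k, b)] + fg_of v"
    using fg_of_append[of u "(Gen_a k, b) # v"] fg_of_append[of "[(Gen_a k, b)]" v]
    by (simp add: add.assoc flip: uv(1))
  show ?thesis
  proof (cases b)
    case True
    show ?thesis
    proof (rule pos[OF w z])
      show "\<not> Sn k (fg_of v)" using r uv' True
        by (auto simp: Sn_def reduced_append reduced_Cons linv_def)
      show "x = fg_of u + ag k + fg_of v" using x True by (simp add: gn_def)
      show "wd x = wd (fg_of u) @ (Gen_a k, True) # wd (fg_of v)" using uv(1) uv' True by simp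
    qed
  next
    case False
    then have a: "fg_of [(Gen_a k, b)] = - ag k" by (simp flip: wd_inject)
    show ?thesis
    proof (rule neg[OF w z])
      show "\<not> St k (fg_of v)" using r uv' False
        by (auto simp: St_def reduced_append reduced_Cons linv_def)
      show "x = fg_of u - ag k + fg_of v" using x a by simp
      show "wd x = wd (fg_of u) @ (Gen_a k, False) # wd (fg_of v)" using uv(1) uv' False by simp
    qed
  qed
qed

lemma St_pos: "\<not> Sn k z \<Longrightarrow> St k (ag k + z)"
  using wd_pos[of 0 k z] by (simp add: St_def)

lemma St_ag_iff: "St k (ag k + z) \<longleftrightarrow> \<not> Sn k z"
proof
  assume "St k (ag k + z)"
  show "\<not> Sn k z"
  proof
    assume "Sn k z"
    then obtain v where v: "wd z = (Gen_a k, False) # v" by (cases "wd z") (auto simp: Sn_def)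
    have r: "reduced ((Gen_a k, False) # v)" using v reduced_wd[of z] by simp
    then have "red ((Gen_a k, False) # v) = (Gen_a k, False) # v" by (rule red_reduced)
    then have "wd (ag k + z) = v" by (simp add: wd_plus v red_Cons[of "(Gen_a k, True)"] ccons_def linv_def)
    with r \<open>St k (ag k + z)\<close> show False by (auto simp: St_def reduced_Cons linv_def)
  qed
qed (rule St_pos)

lemma St_pos_L: "w \<in> L (k - 1) \<Longrightarrow> \<not> Sn k z \<Longrightarrow> St k (w + ag k + z) \<longleftrightarrow> w = 0"
  using wd_pos[of w k z] L_not_St[of w k] by (cases "w = 0") (auto simp: St_def)

lemma Sn_pos_L: "w \<in> L (k - 1) \<Longrightarrow> \<not> Sn k z \<Longrightarrow> \<not> Sn k (w + ag k + z)"
  using wd_pos[of w k z] L_not_Sn[of w k] by (cases "w = 0") (auto simp: Sn_def)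

lemma Sn_neg_L: "w \<in> L (k - 1) \<Longrightarrow> \<not> St k z \<Longrightarrow> Sn k (w - ag k + z) \<longleftrightarrow> w = 0"
  using wd_neg[of w k z] L_not_Sn[of w k] by (cases "w = 0") (auto simp: Sn_def)

lemma St_neg_L: "w \<in> L (k - 1) \<Longrightarrow> \<not> St k z \<Longrightarrow> \<not> St k (w - ag k + z)"
  using wd_neg[of w k z] L_not_St[of w k] by (cases "w = 0") (auto simp: St_def)

lemma cnt_pos: "w \<in> L (k - 1) \<Longrightarrow> \<not> Sn k z \<Longrightarrow> cnt k (w + ag k + z) = Suc (cnt k z)"
  using wd_pos[of w k z] L_cnt[of w k] by (simp add: cnt_def)

lemma cnt_neg: "w \<in> L (k - 1) \<Longrightarrow> \<not> St k z \<Longrightarrow> cnt k (w - ag k + z) = Suc (cnt k z)"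
  using wd_neg[of w k z] L_cnt[of w k] by (simp add: cnt_def)

lemma P_conj_eq_0: "P k i + ph i w - P k i = 0 \<longleftrightarrow> w = 0"
proof
  assume "P k i + ph i w - P k i = 0"
  then have "P k i + ph i w = P k i + 0" by simp
  then have "ph i w = 0" by (rule add_left_imp_eq)
  then show "w = 0" by simp
qed simp

lemma L_level: "x \<in> L k \<Longrightarrow> x \<notin> L (k - 1) \<Longrightarrow> ag k \<in> L k"
  by (cases "k = 0") auto

text \<open>Britton's lemma in word form. New cancellation of letters a_k could arise only inside
  a_k w a_k^-1 or a_k^-1 w a_k. There w becomes p \<phi>^i(w) p^-1 or \<phi>^i(w), which is trivial
  only if w is.\<close>

lemma ph_St_cnt:
  assumes "x \<in> L k"
  shows "(St k (ph i x) \<longleftrightarrow> St k x) \<and> cnt k (ph i x) = cnt k x"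
  using assms
proof (induction "length (wd x)" arbitrary: x rule: less_induct)
  case less
  show ?case
  proof (cases "x \<in> L (k - 1)")
    case True
    then show ?thesis by simp
  next
    case False
    note a = L_level[OF less.prems False]
    from less.prems False show ?thesis
    proof (cases rule: first_split)
      case (pos w z)
      \<comment> \<open>The image of the letter a_k puts \<open>P k i\<close> in front of the image
        of \<open>z\<close>; this must not bring a letter a_k^-1 next to a_k.\<close>
      have z': "\<not> Sn k (P k i + ph i z)"
      proof (cases "z \<in> L (k - 1)")
        case True
        then show ?thesis by simp
      next
        case False
        from pos(2) False show ?thesis
        proof (cases rule: first_split)
          case zpos: (pos w' z')
          have "wd (ag k + z') = (Gen_a k, True) # wd z'" using wd_pos[of 0 k z'] zpos by simp
          then have "St k (ph i (ag k + z'))" using less.hyps[of "ag k + z'"] pos(5) zpos a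
            by (simp add: St_def)
          then have *: "St k (ag k + (P k i + ph i z'))" by (simp add: ph_ag add.assoc)
          then have "\<not> Sn k (P k i + ph i z')" unfolding St_ag_iff .
          then show ?thesis using Sn_pos_L[of "P k i + ph i w'" k "P k i + ph i z'"] zpos
            by (simp add: ph_ag add.assoc)
        next
          case zneg: (neg w' z')
          have "w' \<noteq> 0" using pos(3) zneg Sn_neg_L[of w' k z'] by simp
          then have "P k i + ph i w' - P k i \<noteq> 0" unfolding P_conj_eq_0 .
          moreover have "\<not> St k (ph i z')" using less.hyps[of z'] zneg pos(5) by simp
          ultimately have "\<not> Sn k ((P k i + ph i w' - P k i) - ag k + ph i z')"
            using Sn_neg_L[of "P k i + ph i w' - P k i" k "ph i z'"] zneg(1)
              by (metis L_diff L_plus P_L ph_L)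
          then show ?thesis using zneg
            by (simp add: ph_ag add.assoc minus_add diff_conv_add_uminus del: add_uminus_conv_diff)
        qed
      qed
      have eq: "ph i x = ph i w + ag k + (P k i + ph i z)"
        using pos by (simp add: ph_ag add.assoc)
      have "z \<in> L k" "length (wd z) < length (wd x)" using pos by auto
      then have "cnt k (ph i z) = cnt k z" using less.hyps by blast
      moreover have "cnt k (P k i + ph i z) = cnt k (ph i z)"
      proof (rule antisym)
        show "cnt k (P k i + ph i z) \<le> cnt k (ph i z)"
          using cnt_plus[of k "P k i" "ph i z"] by simp
        show "cnt k (ph i z) \<le> cnt k (P k i + ph i z)"
          using cnt_plus[of k "- P k i" "P k i + ph i z"] by (simp add: add.assoc[symmetric])
      qed
      ultimately show ?thesis
        unfolding eq using pos z' by (simp add: St_pos_L cnt_pos)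
    next
      case (neg w z)
      have hyp: "\<not> St k (ph i z)" "cnt k (ph i z) = cnt k z" using less.hyps[of z] neg by auto
      have eq: "ph i x = (ph i w - P k i) - ag k + ph i z"
        using neg by (simp add: ph_ag add.assoc minus_add diff_conv_add_uminus del: add_uminus_conv_diff)
      show ?thesis unfolding eq using hyp neg by (simp add: St_neg_L cnt_neg)
    qed
  qed
qed

section \<open>Cuts and twisted conjugacy\<close>

text \<open>The seam between \<open>x\<close> and \<open>y\<close> lies before a letter $a_k$ or behind a letter $a_k^{-1}$, as
  an edge of the Bass-Serre tree does; if both conditions held, the two letters would cancel.\<close>

definition Cut :: "nat \<Rightarrow> gen fg \<Rightarrow> gen fg \<Rightarrow> bool" where
  "Cut k x y \<longleftrightarrow> St k y \<noteq> St k (- x)"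

lemma ph_St: "x \<in> L k \<Longrightarrow> St k (ph i x) \<longleftrightarrow> St k x"
  using ph_St_cnt by blast

lemma ph_cnt: "x \<in> L k \<Longrightarrow> cnt k (ph i x) = cnt k x"
  using ph_St_cnt by blast

lemma Cut_ph: "x \<in> L k \<Longrightarrow> y \<in> L k \<Longrightarrow> Cut k (ph i x) (ph i y) \<longleftrightarrow> Cut k x y"
  unfolding Cut_def ph_uminus[symmetric] by (simp add: ph_St del: ph_uminus)

lemma wd_Cut:
  assumes "Cut k x y"
  shows "wd (x + y) = wd x @ wd y"
proof (rule wd_plus_reduced)
  show "reduced (wd x @ wd y)"
    using assms unfolding Cut_def St_uminus unfolding St_def reduced_append
    by (auto simp: linv_def prod_eq_iff)
qed

lemma Cut_L:
  assumes "Cut k x y" and "x + y \<in> L n"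
  shows "x \<in> L n" "y \<in> L n"
  using assms(2) by (simp_all add: L_def wd_Cut[OF assms(1)] image_Un)

lemma St_append: "wd x = u @ v \<Longrightarrow> u \<noteq> [] \<Longrightarrow> St k x \<longleftrightarrow> hd u = (Gen_a k, True)"
  by (auto simp: St_def)

lemma St_uminus_append: "wd x = u @ v \<Longrightarrow> v \<noteq> [] \<Longrightarrow> St k (- x) \<longleftrightarrow> last v = (Gen_a k, False)"
  by (auto simp: St_uminus)

lemma St_wd: "x \<noteq> 0 \<Longrightarrow> St k x \<longleftrightarrow> hd (wd x) = (Gen_a k, True)"
  by (simp add: St_def)

lemma St_wd_uminus: "x \<noteq> 0 \<Longrightarrow> St k (- x) \<longleftrightarrow> last (wd x) = (Gen_a k, False)"
  by (simp add: St_uminus)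

lemma St_sum:
  assumes "wd (x + y) = wd x @ wd y"
  shows "x \<noteq> 0 \<Longrightarrow> St k (x + y) \<longleftrightarrow> St k x" "y \<noteq> 0 \<Longrightarrow> St k (- (x + y)) \<longleftrightarrow> St k (- y)"
  using St_append[OF assms, of k] St_wd[of x k] St_uminus_append[OF assms, of k] St_wd_uminus[of y k]
  by auto

lemma St_zero [simp]: "\<not> St k 0"
  by (simp add: St_def)

lemma cnt_sum: "wd (x + y) = wd x @ wd y \<Longrightarrow> cnt k (x + y) = cnt k x + cnt k y"
  by (simp add: cnt_def)

text \<open>Cancellation with \<open>c\<close> cannot use up all letters a_k or a_k^-1 of
  \<open>y\<close>, so a nonempty initial part of \<open>y\<close> survives, and with it the first
  letter.\<close>

lemma St_add:
  assumes "cnt k c < cnt k y"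
  shows "St k (y + c) \<longleftrightarrow> St k y"
proof -
  obtain y' d c' where *: "wd y = wd y' @ wd d" "wd c = wd (- d) @ wd c'" "wd (y + c) = wd y' @ wd c'"
    using wd_plus_cancellation[of y c] by metis
  have "cnt k y = cnt k y' + cnt k d" using *(1) by (simp add: cnt_def)
  moreover have "cnt k c = cnt k (- d) + cnt k c'" using *(2) unfolding cnt_def by simp
  ultimately have "cnt k y' \<noteq> 0" using assms by simp
  then have "wd y' \<noteq> []" by (auto simp: cnt_def)
  then show ?thesis using St_append[OF *(1)] St_append[OF *(3)] by simp
qed

text \<open>The seam in the middle of a long word is out of reach of short factors multiplied on at
  the two ends; this replaces the overlap of two axes in the tree.\<close>

lemma Cut_survive:
  assumes "Cut k u v" "cnt k a < cnt k u" "cnt k b < cnt k v"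
  shows "Cut k (a + u) (v + b)"
proof -
  have "St k (- u + - a) \<longleftrightarrow> St k (- u)" using assms(2) by (intro St_add) simp
  then show ?thesis using assms(1) St_add[OF assms(3)] by (simp add: Cut_def minus_add)
qed

text \<open>The seam of \<open>z1\<close> and \<open>z2\<close> lies in what survives of
  \<open>x\<close>, in what survives of \<open>y\<close>, or exactly where the cancelled block was;
  the first two cases inherit the cut directly.\<close>

lemma Cut_trace:
  assumes "Cut k z1 z2" and "z1 + z2 = x + y"
  shows "(\<exists>x1 x2. x = x1 + x2 \<and> Cut k x1 x2 \<and> z2 = x2 + y) \<or> (\<exists>y1. y = y1 + z2 \<and> Cut k y1 z2)"
proof -
  obtain x' c y' where *: "wd x = wd x' @ wd c" "wd y = wd (- c) @ wd y'" "wd (x + y) = wd x' @ wd y'"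
    "x = x' + c" "y = - c + y'"
    by (rule wd_plus_cancellation)
  have "wd z1 @ wd z2 = wd x' @ wd y'" using wd_Cut[OF assms(1)] assms(2) *(3) by simp
  then consider us where "wd x' = wd z1 @ us" "wd z2 = us @ wd y'"
    | us where "us \<noteq> []" "wd z1 = wd x' @ us" "wd y' = us @ wd z2"
    by (fastforce simp: append_eq_append_conv2)
  then show ?thesis
  proof cases
    case (1 us)
    note x' = wd_split[OF 1(1)]
    have z1: "fg_of (wd z1) = z1" by simp
    have x: "x = z1 + (fg_of us + c)" using *(4) x'(1) by (simp add: add.assoc)
    have z2: "z2 = (fg_of us + c) + y"
      using wd_split(1)[OF 1(2)] *(5) by (simp add: add.assoc)
    show ?thesis
    proof (cases "us = []")
      case False
      have "wd (fg_of us + c) = us @ wd c"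
        using *(1) reduced_wd[of x] x'(3) unfolding 1(1) by (simp add: wd_plus reduced_append)
      then have "St k (fg_of us + c) \<longleftrightarrow> St k z2"
        using St_append[of "fg_of us + c" us] St_append[OF 1(2)] False by blast
      then have "Cut k z1 (fg_of us + c)" using assms(1) by (simp add: Cut_def)
      then show ?thesis using x z2 by blast
    next
      case True
      then have eq: "x' = z1" "z2 = y'" using 1 by (simp_all add: wd_inject)
      show ?thesis
      \<comment> \<open>The seam is where \<open>c\<close> met its inverse. If the part before it
        ends in a_k^-1, then \<open>c\<close> cannot start with a_k, so the cut is seen inside
        \<open>x\<close>; otherwise the part behind it starts with a_k and the cut is seen inside
        \<open>y\<close>.\<close>
      proof (cases "St k (- z1)")
        case True
        have "\<not> St k c"
          using True *(1) reduced_wd[of x] unfolding eq St_uminus unfolding St_def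
          by (auto simp: linv_def reduced_append)
        then have "Cut k z1 c" using True by (simp add: Cut_def)
        moreover have "z2 = c + y" using eq *(5) by (simp add: add.assoc[symmetric])
        ultimately show ?thesis using *(4) eq by blast
      next
        case False
        then have "St k y'" using assms(1) eq by (simp add: Cut_def)
        moreover have "reduced (wd (- c) @ wd y')" using *(2) reduced_wd[of y] by simp
        ultimately have "\<not> St k (- (- c))"
          unfolding St_uminus[of k "- c"] unfolding St_def reduced_append by (auto simp: linv_def)
        with \<open>St k y'\<close> have "Cut k (- c) y'" by (simp add: Cut_def)
        then show ?thesis using *(5) eq by blast
      qed
    qed
  next
    case (2 us)
    note y' = wd_split[OF 2(3)]
    have w: "wd y = (wd (- c) @ us) @ wd z2" using *(2) 2(3) by simp
    note y = wd_split[OF w]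
    have "St k (- fg_of (wd (- c) @ us)) \<longleftrightarrow> St k (- z1)"
      using St_uminus_append[OF y(2), of k] St_uminus_append[OF 2(2), of k] 2(1) by simp
    then have "Cut k (fg_of (wd (- c) @ us)) z2" using assms(1) by (simp add: Cut_def)
    then show ?thesis using y(1) by auto
  qed
qed

text \<open>\<open>tc k p x y\<close> expresses that $s^p x$ and $s^p y$ are conjugate in $H_k$, namely by
  $s^j g$.\<close>

definition tc :: "nat \<Rightarrow> int \<Rightarrow> gen fg \<Rightarrow> gen fg \<Rightarrow> bool" where
  "tc k p x y \<longleftrightarrow> (\<exists>j. \<exists>g\<in>L k. y = - ph p g + ph j x + g)"

lemma tcI: "g \<in> L k \<Longrightarrow> y = - ph p g + ph j x + g \<Longrightarrow> tc k p x y"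
  unfolding tc_def by blast

lemma tc_refl [simp]: "tc k p x x"
  by (rule tcI[of 0 _ _ _ 0]) simp_all

lemma tc_trans:
  assumes "tc k p x y" and "tc k p y z"
  shows "tc k p x z"
proof -
  from assms obtain i g j h where "g \<in> L k" "h \<in> L k"
    and y: "y = - ph p g + ph i x + g" and z: "z = - ph p h + ph j y + h"
    unfolding tc_def by blast
  show ?thesis
  proof (rule tcI)
    show "ph j g + h \<in> L k" using \<open>g \<in> L k\<close> \<open>h \<in> L k\<close> by simp
    show "z = - ph p (ph j g + h) + ph (j + i) x + (ph j g + h)"
      unfolding z y by (simp add: ph_ph minus_add add.assoc add.commute[of p j] del: add_uminus_conv_diff)
  qed
qed

lemma tc_sym:
  assumes "tc k p x y"
  shows "tc k p y x"
proof -
  from assms obtain i g where "g \<in> L k" and y: "y = - ph p g + ph i x + g"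
    unfolding tc_def by blast
  show ?thesis
  proof (rule tcI)
    show "- ph (- i) g \<in> L k" using \<open>g \<in> L k\<close> by simp
    show "x = - ph p (- ph (- i) g) + ph (- i) y + - ph (- i) g"
      unfolding y by (simp add: ph_ph add.assoc add.commute[of p "- i"] del: add_uminus_conv_diff)
  qed
qed

lemma tc_L: "tc k p x y \<Longrightarrow> x \<in> L k \<Longrightarrow> y \<in> L k"
  unfolding tc_def by auto

lemma Sn_iff: "Sn k x \<longleftrightarrow> wd x \<noteq> [] \<and> last (wd (- x)) = (Gen_a k, True)"
  by (cases "wd x") (auto simp: Sn_def wd_uminus linv_def prod_eq_iff)

text \<open>Conjugating $s^p x$ by a suffix $t$ of $x$ rotates the word: $t s^p x t^{-1}$ is
  $s^p \varphi^p(t) x t^{-1}$.  The suffix is the inverse of a conjugator of minimal length, which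
  cannot cancel against the rest of the word.\<close>

lemma elliptic_suffix:
  assumes x: "x \<in> L k" and tc: "tc k p x z" and z: "z \<in> L (k - 1)"
  shows "\<exists>t\<in>L k. suffix (wd t) (wd x) \<and> ph p t + x - t \<in> L (k - 1)"
proof -
  define Q where "Q g \<longleftrightarrow> g \<in> L k \<and> - ph p g + x + g \<in> L (k - 1)" for g
  from tc obtain j g0 where g0: "g0 \<in> L k" "z = - ph p g0 + ph j x + g0"
    unfolding tc_def by blast
  have "ph (- j) z = - ph p (ph (- j) g0) + x + ph (- j) g0"
    unfolding g0(2) by (simp add: ph_ph add.commute[of p] del: add_uminus_conv_diff)
  then have "Q (ph (- j) g0)" using g0(1) z ph_L[of "- j" z] by (simp add: Q_def)
  then obtain g where g: "Q g" and min: "\<And>h. Q h \<Longrightarrow> length (wd g) \<le> length (wd h)"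
    using ex_has_least_nat[of Q _ "\<lambda>x. length (wd x)"] by blast
  define y where "y = - ph p g + x + g"
  have y: "y \<in> L (k - 1)" using g by (simp add: Q_def y_def)
  have gL: "g \<in> L k" using g by (simp add: Q_def)
  have x_eq: "x = ph p g + y - g" by (simp add: y_def add.assoc[symmetric])
  show ?thesis
  proof (cases "wd g" rule: rev_cases)
    case Nil
    then show ?thesis using y by (intro bexI[of _ 0]) (auto simp: y_def)
  next
    case (snoc u l)
    note sp = wd_split[OF snoc]
    define g' where "g' = fg_of u"
    have len: "length (wd g') < length (wd g)" using snoc sp(2) by (simp add: g'_def)
    have LL: "fg_of [l] \<in> L k" "g' \<in> L k"
      using gL snoc sp(2,3) unfolding L_def g'_def by (auto simp del: wd_fg_of)
    have contra: "- ph p g' + x + g' \<notin> L (k - 1)"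
      using min[of g'] len LL unfolding Q_def by auto
    have g_eq: "g = g' + fg_of [l]" using sp(1) by (simp add: g'_def)
    have c_eq: "- ph p g' + x + g' = ph p (fg_of [l]) + y - fg_of [l]"
      unfolding x_eq unfolding g_eq by (simp add: add.assoc minus_add diff_conv_add_uminus del: add_uminus_conv_diff)
    have red: "reduced (u @ [l])" using snoc reduced_wd[of g] by simp
    \<comment> \<open>Here \<open>l\<close> is the last letter of the minimal conjugator. If it had
      smaller rank, it could be omitted. If it is a_k or a_k^-1, then what follows its image in
      \<open>ph p g + y\<close>, namely \<open>P k p + y\<close> or \<open>y\<close>, is nontrivial
      by minimality, so this word does not end in \<open>l\<close>.\<close>
    have *: "\<not> (wd (ph p g + y) \<noteq> [] \<and> last (wd (ph p g + y)) = l)"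
    proof (cases "fst l = Gen_a k")
      case False
      then have "fg_of [l] \<in> L (k - 1)"
        using cnt_0_iff[OF LL(1)] sp(3) by (simp add: cnt_def)
      then show ?thesis using contra y unfolding c_eq by simp
    next
      case l: True
      show ?thesis
      proof (cases "snd l")
        case True
        then have l: "l = (Gen_a k, True)" using l by (simp add: prod_eq_iff)
        then have gl: "fg_of [l] = ag k" by (simp add: gn_def)
        have "P k p + y \<noteq> 0"
        proof
          assume "P k p + y = 0"
          then have "ph p (fg_of [l]) + y - fg_of [l] = 0" unfolding gl ph_ag by (simp add: add.assoc)
          with contra show False unfolding c_eq by simp
        qed
        moreover have "\<not> St k (- g')"
          using red sp(2) unfolding St_uminus g'_def by (auto simp: l reduced_append linv_def)
        ultimately have "\<not> Sn k (- (P k p + y) - ag k + - ph p g')"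
          using Sn_neg_L[of "- (P k p + y)" k "- ph p g'"] y ph_St[of "- g'" k p] LL
          by (simp del: minus_add)
        also have "- (P k p + y) - ag k + - ph p g' = - (ph p g + y)"
          unfolding g_eq gl by (simp add: ph_ag minus_add add.assoc diff_conv_add_uminus del: add_uminus_conv_diff)
        finally show ?thesis unfolding Sn_iff l by simp
      next
        case False
        then have l: "l = (Gen_a k, False)" using l by (simp add: prod_eq_iff)
        then have gl: "fg_of [l] = - ag k" by (simp flip: wd_inject)
        have "\<not> Sn k (- g')"
          using red sp(2) unfolding Sn_iff g'_def by (auto simp: l reduced_append linv_def)
        then have "St k (ag k - g')" using St_ag_iff[of k "- g'"] by simp
        moreover have "ag k - g' \<in> L k" using LL gl by auto
        ultimately have "St k (ag k + (P k p + - ph p g'))"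
          using ph_St[of "ag k - g'" k p] by (simp add: ph_ag add.assoc diff_conv_add_uminus del: add_uminus_conv_diff)
        then have "\<not> Sn k (P k p + - ph p g')" unfolding St_ag_iff .
        moreover have "y \<noteq> 0"
        proof
          assume "y = 0"
          then have "ph p (fg_of [l]) + y - fg_of [l] = - P k p" unfolding gl by (simp add: ph_ag minus_add add.assoc diff_conv_add_uminus del: add_uminus_conv_diff)
          with contra show False unfolding c_eq by simp
        qed
        ultimately have "\<not> St k (- y + ag k + (P k p + - ph p g'))"
          using St_pos_L[of "- y" k "P k p + - ph p g'"] y by simp
        also have "- y + ag k + (P k p + - ph p g') = - (ph p g + y)"
          unfolding g_eq gl by (simp add: ph_ag minus_add add.assoc diff_conv_add_uminus del: add_uminus_conv_diff)
        finally show ?thesis unfolding St_uminus l by simp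
      qed
    qed
    have "wd (- g) = linv l # inv_word u" unfolding wd_uminus snoc by simp
    then have "reduced (wd (ph p g + y) @ wd (- g))"
      using * reduced_wd[of "- g"] unfolding reduced_append by auto
    then have "wd (ph p g + y + - g) = wd (ph p g + y) @ wd (- g)" by (rule wd_plus_reduced)
    also have "ph p g + y + - g = x" using x_eq by simp
    finally have "suffix (wd (- g)) (wd x)" by (auto simp: suffix_def)
    then show ?thesis using gL y by (intro bexI[of _ "- g"]) (auto simp: y_def)
  qed
qed

lemma wd_first_unique:
  assumes "wd a @ l # u = wd b @ l' # v" "a \<in> L (k - 1)" "b \<in> L (k - 1)"
    "fst l = Gen_a k" "fst l' = Gen_a k"
  shows "a = b \<and> l = l'"
proof -
  have *: "takeWhile (\<lambda>l. fst l \<noteq> Gen_a k) (wd c @ l # w) = wd c"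
    if "c \<in> L (k - 1)" "fst l = Gen_a k" for c l w
  proof -
    have "\<forall>l\<in>set (wd c). fst l \<noteq> Gen_a k" using L_notin[OF that(1)] by (metis image_eqI)
    then show ?thesis using that(2) by (simp add: takeWhile_append2)
  qed
  have "wd a = wd b" using *[OF assms(2,4), of u] *[OF assms(3,5), of v] assms(1) by simp
  then show ?thesis using assms(1) by (simp add: wd_inject)
qed

text \<open>$H_n$ is the HNN extension of $H_{n-1}$ with stable letter $a_n$, whose edge groups are
  generated by $s$ and $a_n^{-1} s a_n$; the last two cases are those of an element conjugate to
  $s^p$ or to $a_n^{-1} s^p a_n$.\<close>

lemma tc_elliptic:
  assumes x: "x \<in> L (n - 1)" and y: "y \<in> L (n - 1)" and "tc n p x y"
  shows "tc (n - 1) p x y \<or> tc (n - 1) p x 0 \<or> tc (n - 1) p x (- P n p)"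
proof -
  from assms(3) obtain j g where g: "g \<in> L n" and y_eq: "y = - ph p g + ph j x + g"
    unfolding tc_def by blast
  \<comment> \<open>If \<open>g\<close> involves a_n, the parts before the first a_n or a_n^-1 agree
    on both sides. This equation of smaller rank says that s^j w conjugates s^p x to s^p or to
    a_n^-1 s^p a_n, according to the sign of that letter.\<close>
  have eq: "ph p g + y = ph j x + g" unfolding y_eq by (simp add: add.assoc[symmetric])
  show ?thesis
  proof (cases "g \<in> L (n - 1)")
    case True
    then show ?thesis using y_eq tcI by blast
  next
    case False
    note a = L_level[OF g False]
    from g False show ?thesis
    proof (cases rule: first_split)
      case (pos w z)
      have "wd (ph j x + w + ag n + z) = wd (ph j x + w) @ (Gen_a n, True) # wd z"
        using pos x by (intro wd_pos) auto
      moreover have "wd (ph p w + ag n + (P n p + ph p z + y)) =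
          wd (ph p w) @ (Gen_a n, True) # wd (P n p + ph p z + y)"
      proof (rule wd_pos)
        have St: "St n (ag n + z)" using pos by (intro St_pos)
        have L: "ag n + z \<in> L n" using pos a by simp
        have "cnt n (ag n + z) = Suc (cnt n z)" using cnt_pos[of 0 n z] pos by simp
        then have "St n (ph p (ag n + z) + y)"
          using y St ph_St[OF L, of p] ph_cnt[OF L, of p] by (subst St_add) (simp_all del: ph_hom)
        then show "\<not> Sn n (P n p + ph p z + y)" by (simp add: ph_ag add.assoc St_ag_iff)
      qed (use pos in simp)
      moreover have "ph j x + w + ag n + z = ph p w + ag n + (P n p + ph p z + y)"
        using eq unfolding pos(4) by (simp add: ph_ag add.assoc)
      ultimately have "wd (ph j x + w) @ (Gen_a n, True) # wd z =
          wd (ph p w) @ (Gen_a n, True) # wd (P n p + ph p z + y)" by simp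
      from wd_first_unique[OF this, of n] have "ph j x + w = ph p w" using pos x by simp
      then have "0 = - ph p w + ph j x + w" by (simp add: add.assoc)
      then show ?thesis using pos tcI by blast
    next
      case (neg w z)
      have "wd (ph j x + w - ag n + z) = wd (ph j x + w) @ (Gen_a n, False) # wd z"
        using neg x by (intro wd_neg) auto
      moreover have "wd (ph p w - P n p - ag n + (ph p z + y)) =
          wd (ph p w - P n p) @ (Gen_a n, False) # wd (ph p z + y)"
      proof (rule wd_neg)
        show "\<not> St n (ph p z + y)"
        proof (cases "cnt n z = 0")
          case True
          then have "z \<in> L (n - 1)" using cnt_0_iff neg by blast
          then show ?thesis using y by simp
        next
          case False
          then show ?thesis using neg y by (subst St_add) (auto simp: ph_St ph_cnt)
        qed
      qed (use neg in simp)
      moreover have "ph j x + w - ag n + z = ph p w - P n p - ag n + (ph p z + y)"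
        using eq unfolding neg(4)
        by (simp add: ph_ag add.assoc minus_add diff_conv_add_uminus del: add_uminus_conv_diff)
      ultimately have "wd (ph j x + w) @ (Gen_a n, False) # wd z =
          wd (ph p w - P n p) @ (Gen_a n, False) # wd (ph p z + y)" by simp
      from wd_first_unique[OF this, of n] have "ph j x + w = ph p w - P n p" using neg x by simp
      then have "- P n p = - ph p w + ph j x + w" by (simp add: add.assoc diff_conv_add_uminus del: add_uminus_conv_diff)
      then show ?thesis using neg tcI by blast
    qed
  qed
qed

section \<open>Twisted conjugacy outside the smaller free factor\<close>

lemma fg_of_single: "fg_of [(g, True)] = gn g" "fg_of [(g, False)] = - gn g"
  by (simp add: gn_def) (simp flip: wd_inject)

lemma fg_of_wd_Cons:
  "wd x = (g, True) # v \<Longrightarrow> x = gn g + fg_of v" "wd x = (g, False) # v \<Longrightarrow> x = - gn g + fg_of v"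
  using wd_split(1)[of x "[(g, True)]" v] wd_split(1)[of x "[(g, False)]" v]
  by (simp_all add: fg_of_single)

lemma St_imp_cnt: "St k x \<Longrightarrow> 1 \<le> cnt k x"
  by (cases "wd x") (auto simp: St_def cnt_def)

lemma Cut_cnt: "Cut k x x \<Longrightarrow> 1 \<le> cnt k x"
  using St_imp_cnt[of k x] St_imp_cnt[of k "- x"] by (auto simp: Cut_def)

text \<open>Chosen such that (s^p x)^n = s^(np) X_n, where X_n is \<open>Xp p x n\<close>.\<close>

primrec Xp :: "int \<Rightarrow> gen fg \<Rightarrow> nat \<Rightarrow> gen fg" where
  "Xp p x 0 = 0"
| "Xp p x (Suc n) = ph (int n * p) x + Xp p x n"

lemma Xp_L: "x \<in> L k \<Longrightarrow> Xp p x n \<in> L k"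
  by (induction n) auto

lemma Xp_add: "Xp p x (n + m) = ph (int m * p) (Xp p x n) + Xp p x m"
  by (induction n) (simp_all add: ph_ph add.assoc distrib_right add.commute)

text \<open>Both sides are X_(n+1): the element s^p x commutes with its n-th power.\<close>

lemma Xp_twist: "ph p (Xp p x n) + x = ph (int n * p) x + Xp p x n"
proof (induction n)
  case (Suc n)
  have "ph p (Xp p x (Suc n)) + x = ph (p + int n * p) x + (ph p (Xp p x n) + x)"
    by (simp add: ph_ph add.assoc)
  also have "\<dots> = ph (int (Suc n) * p) x + Xp p x (Suc n)"
    unfolding Suc.IH by (simp add: distrib_right add.assoc)
  finally show ?case .
qed simp

lemma Xp_tc: "y = - ph p g + x + g \<Longrightarrow> Xp p y n = - ph (int n * p) g + Xp p x n + g"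
proof (induction n)
  case (Suc n)
  have "ph (int n * p) y = - ph (int (Suc n) * p) g + ph (int n * p) x + ph (int n * p) g"
    unfolding Suc.prems by (simp add: ph_ph distrib_right add.commute)
  then show ?case using Suc.IH[OF Suc.prems] by (simp add: add.assoc)
qed simp

text \<open>A cut at the seam of x with itself makes s^p x cyclically reduced: by invariance of
  \<open>St\<close> all seams of X_n are cuts, nothing cancels, and each factor contributes a letter
  a_k or a_k^-1.\<close>

lemma Xp_nice:
  assumes "x \<in> L k" and "Cut k x x"
  shows "n \<ge> 1 \<Longrightarrow> (St k (Xp p x n) \<longleftrightarrow> St k x) \<and> (St k (- Xp p x n) \<longleftrightarrow> St k (- x)) \<and> n \<le> cnt k (Xp p x n)"
proof (induction n rule: nat_induct_at_least)
  case base
  show ?case using Cut_cnt[OF assms(2)] by (simp add: One_nat_def)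
next
  case (Suc n)
  let ?y = "ph (int n * p) x"
  have st: "St k ?y \<longleftrightarrow> St k x" "St k (- ?y) \<longleftrightarrow> St k (- x)"
    using assms(1) ph_St[of "- x" k "int n * p"] by (simp_all add: ph_St)
  have "Cut k ?y (Xp p x n)" using assms(2) Suc.IH st by (simp add: Cut_def)
  note w = wd_Cut[OF this]
  have nz: "?y \<noteq> 0" "Xp p x n \<noteq> 0" using assms(2) Suc by (auto simp: Cut_def)
  have "Suc n \<le> cnt k (?y + Xp p x n)"
    using Cut_cnt[OF assms(2)] Suc.IH cnt_sum[OF w, of k] assms(1) by (simp add: ph_cnt)
  moreover have "St k (?y + Xp p x n) \<longleftrightarrow> St k x" using St_sum(1)[OF w nz(1), of k] st by blast
  moreover have "St k (- (?y + Xp p x n)) \<longleftrightarrow> St k (- x)"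
    using St_sum(2)[OF w nz(2), of k] Suc.IH by blast
  ultimately show ?case unfolding Xp.simps by blast
qed

lemma Cut_trace_Xp:
  assumes "Cut k z1 z2" and "z1 + z2 = Xp p y n" and "y \<in> L k"
  shows "\<exists>m y1 y2. y = y1 + y2 \<and> Cut k y1 y2 \<and> z2 = ph (int m * p) y2 + Xp p y m"
  using assms(1,2)
proof (induction n arbitrary: z1)
  case 0
  then have "wd z1 @ wd z2 = []" using wd_Cut[of k z1 z2] by simp
  then show ?case using 0 by (simp add: Cut_def)
next
  case (Suc n)
  from Cut_trace[OF Suc.prems(1), of "ph (int n * p) y" "Xp p y n"] Suc.prems(2)
  consider x1 x2 where "ph (int n * p) y = x1 + x2" "Cut k x1 x2" "z2 = x2 + Xp p y n"
    | y1 where "Xp p y n = y1 + z2" "Cut k y1 z2" by auto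
  then show ?case
  proof cases
    case (1 x1 x2)
    have "x1 + x2 \<in> L k" unfolding 1(1)[symmetric] using assms(3) by simp
    note xL = Cut_L[OF 1(2) this]
    have "y = ph (- (int n * p)) (x1 + x2)" unfolding 1(1)[symmetric] by (rule ph_cancel(1)[symmetric])
    moreover have "Cut k (ph (- (int n * p)) x1) (ph (- (int n * p)) x2)"
      using 1(2) xL by (simp add: Cut_ph)
    moreover have "z2 = ph (int n * p) (ph (- (int n * p)) x2) + Xp p y n" using 1(3) by simp
    ultimately show ?thesis unfolding ph_hom by blast
  next
    case (2 y1)
    then show ?thesis using Suc.IH[of y1] by simp
  qed
qed

text \<open>With $X_n = \varphi^{(n-1)p}(x)\cdots\varphi^p(x)\,x$, conjugating $s^p x$ to $s^p y$ makes the
  word of $Y_{2n}$ share its middle part with that of $X_{2n}$; the seam in the middle of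
  $X_{2n}$ is a cut of $Y_{2n}$, hence comes from a cut of one of the factors of $Y_{2n}$.\<close>

lemma hyperbolic_suffix:
  assumes x: "x \<in> L k" "Cut k x x" and y: "y \<in> L k" and tc: "tc k p x y"
  shows "\<exists>r\<in>L k. \<exists>i. suffix (wd r) (wd y) \<and> ph p r + y - r = ph i x"
proof -
  from tc obtain j g where g: "g \<in> L k" and y_eq: "y = - ph p g + ph j x + g"
    unfolding tc_def by blast
  define x' where "x' = ph j x"
  have x': "x' \<in> L k" "Cut k x' x'" using x by (simp_all add: x'_def Cut_ph)
  \<comment> \<open>X_2n is the product of the halves \<open>U\<close> and \<open>V\<close> defined
    next. Each has at least n letters a_k or a_k^-1, more than \<open>g\<close>, so the seam between
    them survives conjugation.\<close>
  define n where "n = Suc (cnt k g)"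
  define U where "U = ph (int n * p) (Xp p x' n)"
  define V where "V = Xp p x' n"
  have V: "V \<in> L k" "St k V \<longleftrightarrow> St k x'" "St k (- V) \<longleftrightarrow> St k (- x')" "n \<le> cnt k V"
    using Xp_nice[OF x', of n p] Xp_L[OF x'(1), of p n] by (simp_all add: V_def n_def)
  have U: "St k (- U) \<longleftrightarrow> St k (- x')" "n \<le> cnt k U"
    using V ph_St[of "- V" k "int n * p"] ph_cnt[of V k "int n * p"]
    unfolding U_def V_def[symmetric] by simp_all
  have UV: "Cut k U V" using x'(2) U V by (simp add: Cut_def)
  have "Cut k (- ph (int (n + n) * p) g + U) (V + g)"
    using U V g by (intro Cut_survive[OF UV]) (simp_all add: ph_cnt n_def)
  moreover have "- ph (int (n + n) * p) g + U + (V + g) = Xp p y (n + n)"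
    unfolding Xp_tc[OF y_eq[folded x'_def], of "n + n"] unfolding U_def V_def Xp_add
    by (simp only: add.assoc)
  ultimately obtain m y1 r where r: "y = y1 + r" "Cut k y1 r" "V + g = ph (int m * p) r + Xp p y m"
    using Cut_trace_Xp[OF _ _ y] by metis
  have rL: "r \<in> L k" using Cut_L[OF r(2)] r(1) y by simp
  have suf: "suffix (wd r) (wd y)" using wd_Cut[OF r(2)] r(1) by (auto simp: suffix_def)
  \<comment> \<open>This and the next equation compute the same conjugate of s^p y: once through
    \<open>V + g\<close>, leading back to x, once through the suffix \<open>r\<close> found in
    y.\<close>
  have 1: "ph p (V + g) + y - (V + g) = ph (int n * p) x'"
  proof -
    have "ph p (V + g) + y - (V + g) = ph p V + x' - V"
      unfolding y_eq x'_def by (simp add: add.assoc minus_add diff_conv_add_uminus del: add_uminus_conv_diff)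
    also have "\<dots> = ph (int n * p) x'"
      unfolding V_def Xp_twist by (simp add: add.assoc)
    finally show ?thesis .
  qed
  have 2: "ph p (V + g) + y - (V + g) = ph (int m * p) (ph p r + y - r)"
  proof -
    have "ph p (V + g) + y - (V + g) =
        ph (p + int m * p) r + (ph p (Xp p y m) + y) - Xp p y m - ph (int m * p) r"
      unfolding r(3) by (simp add: ph_ph add.assoc minus_add diff_conv_add_uminus del: add_uminus_conv_diff)
    also have "\<dots> = ph (int m * p) (ph p r + y - r)"
      unfolding Xp_twist by (simp add: ph_ph add.assoc add.commute[of p] diff_conv_add_uminus del: add_uminus_conv_diff)
    finally show ?thesis .
  qed
  have "ph p r + y - r = ph (- (int m * p)) (ph (int n * p) x')"
    using 1 2 ph_cancel(1)[of "int m * p" "ph p r + y - r"] by simp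
  then have "ph p r + y - r = ph (- (int m * p) + (int n * p + j)) x" by (simp add: x'_def ph_ph)
  then show ?thesis using rL suf by blast
qed

definition elliptic :: "nat \<Rightarrow> int \<Rightarrow> gen fg \<Rightarrow> bool" where
  "elliptic k p x \<longleftrightarrow> (\<exists>z\<in>L (k - 1). tc k p x z)"

text \<open>Cyclic reduction. A representative with fewest letters a_k and a_k^-1 cannot both start
  with a_k and end in a_k^-1, as conjugation by a_k would remove both; a rotation makes at least one
  of the two hold. Exactly one of them is what \<open>Cut k y y\<close> means.\<close>

lemma nice_exists:
  assumes x: "x \<in> L k" and ell: "\<not> elliptic k p x"
  shows "\<exists>y\<in>L k. tc k p x y \<and> Cut k y y"
proof -
  obtain y where y: "tc k p x y" and min: "\<And>z. tc k p x z \<Longrightarrow> cnt k y \<le> cnt k z"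
    using ex_has_least_nat[of "tc k p x" x "cnt k"] by auto
  have yL: "y \<in> L k" using tc_L[OF y x] .
  have conj: "tc k p x (- ph p g + z + g)" if "tc k p x z" "g \<in> L k" for z g
    using that tc_trans tcI[of g k _ p 0 z] by (metis ph_0)
  have y': "y \<notin> L (k - 1)" using ell y by (auto simp: elliptic_def)
  note a = L_level[OF yL y']
  have both: "\<not> (St k z \<and> St k (- z))" if z: "tc k p x z" and "cnt k z \<le> cnt k y" for z
  proof
    assume st: "St k z \<and> St k (- z)"
    obtain v where v: "wd z = (Gen_a k, True) # v" using st by (cases "wd z") (auto simp: St_def)
    have "last (wd z) = (Gen_a k, False)" using st by (simp add: St_uminus)
    then obtain w where w: "wd z = (Gen_a k, True) # w @ [(Gen_a k, False)]"
      using v by (cases v rule: rev_cases) (auto split: if_splits)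
    have "z = ag k + fg_of w - ag k"
      using fg_of_wd_Cons(1)[OF w] by (simp add: fg_of_append fg_of_single add.assoc diff_conv_add_uminus del: add_uminus_conv_diff)
    then have z_eq: "- ag k + z + ag k = fg_of w" by (simp add: add.assoc)
    have "- ph p (ag k) + z + ag k = - P k p + fg_of w"
      unfolding z_eq[symmetric] by (simp add: ph_ag minus_add add.assoc diff_conv_add_uminus del: add_uminus_conv_diff)
    then have "tc k p x (- P k p + fg_of w)" using conj[OF z a] by simp
    then have "cnt k y \<le> cnt k (- P k p + fg_of w)" by (rule min)
    also have "\<dots> \<le> cnt k (fg_of w)" using cnt_plus[of k "- P k p" "fg_of w"] by simp
    also have "\<dots> \<le> length (filter (\<lambda>l. fst l = Gen_a k) w)" by (simp add: cnt_def filter_red)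
    also have "\<dots> < cnt k z" by (simp add: cnt_def w)
    finally show False using that(2) by simp
  qed
  have "\<exists>z. tc k p x z \<and> cnt k z \<le> cnt k y \<and> (St k z \<or> St k (- z))"
    using yL y'
  proof (cases rule: first_split)
    case (pos w z)
    let ?z = "ag k + z + ph (- p) w"
    have "- ph p (ph (- p) w) + y + ph (- p) w = ?z"
      unfolding pos(4) by (simp add: add.assoc[symmetric])
    then have "tc k p x ?z" using conj[OF y, of "ph (- p) w"] pos L_mono[of "k - 1" k w] by simp
    moreover have c: "cnt k (ag k + z) = Suc (cnt k z)" using cnt_pos[of 0 k z] pos by simp
    have "St k ?z" using c St_pos[OF pos(3)] pos(1) by (subst St_add) auto
    moreover have "cnt k ?z \<le> cnt k y"
      using cnt_plus[of k "ag k + z" "ph (- p) w"] c cnt_pos[OF pos(1,3)] pos by simp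
    ultimately show ?thesis by blast
  next
    case (neg w z)
    let ?g = "ph (- p) (w - ag k)" let ?z = "z + ?g"
    have "- ph p ?g + y + ?g = ?z"
      unfolding neg(4) by (simp add: add.assoc diff_conv_add_uminus minus_add del: add_uminus_conv_diff)
    moreover have "?g \<in> L k" using neg a L_mono[of "k - 1" k w] by simp
    ultimately have z: "tc k p x ?z" using conj[OF y, of ?g] by simp
    define h where "h = P k (- p) - ph (- p) w - z"
    have g_eq: "- ?z = ag k + h"
      by (simp add: h_def ph_ag minus_add add.assoc diff_conv_add_uminus del: add_uminus_conv_diff)
    have hc: "cnt k h \<le> cnt k z"
      using cnt_plus[of k "P k (- p) - ph (- p) w" "- z"] neg unfolding h_def
      by (simp add: diff_conv_add_uminus add.assoc del: add_uminus_conv_diff) 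
    have yc: "cnt k y = Suc (cnt k z)" using cnt_neg[OF neg(1,3)] neg by simp
    \<comment> \<open>Otherwise a_k would cancel against \<open>h\<close>, and the rotated element
      would have fewer letters a_k and a_k^-1 than the minimum.\<close>
    have "\<not> Sn k h"
    proof
      assume sn: "Sn k h"
      then obtain v where v: "wd h = (Gen_a k, False) # v" by (cases "wd h") (auto simp: Sn_def)
      have eq: "ag k + h = fg_of v"
        using fg_of_wd_Cons(2)[OF v] by (simp add: add.assoc[symmetric])
      have "cnt k (- ?z) \<le> length (filter (\<lambda>l. fst l = Gen_a k) v)"
        unfolding g_eq eq cnt_def wd_fg_of by (rule filter_red)
      then have "cnt k ?z \<le> length (filter (\<lambda>l. fst l = Gen_a k) v)" unfolding cnt_uminus .
      also have "\<dots> < cnt k h" by (simp add: cnt_def v)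
      finally show False using min[OF z] hc yc by simp
    qed
    then have "St k (- ?z)" unfolding g_eq by (rule St_pos)
    moreover have "cnt k (- ?z) \<le> cnt k y"
      using cnt_plus[of k "ag k" h] hc yc unfolding g_eq by (simp add: cnt_def)
    then have "cnt k ?z \<le> cnt k y" unfolding cnt_uminus .
    ultimately show ?thesis using z by blast
  qed
  then obtain z where "tc k p x z" "cnt k z \<le> cnt k y" "St k z \<or> St k (- z)" by blast
  then show ?thesis using both[of z] tc_L[OF _ x] by (auto simp: Cut_def)
qed

text \<open>Both elements are compared with one cyclically reduced conjugate z: rotation by suitable
  suffixes turns each into some \<phi>^i(z), so the two rotated elements differ by a power of \<phi>
  only.\<close>

theorem hyperbolic_conjugate:
  assumes x: "x \<in> L k" and y: "y \<in> L k" and tc: "tc k p x y" and ell: "\<not> elliptic k p x"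
  shows "\<exists>t\<in>L k. \<exists>r\<in>L k. \<exists>i. suffix (wd t) (wd x) \<and> suffix (wd r) (wd y) \<and>
    ph p r + y - r = ph i (ph p t + x - t)"
proof -
  obtain z where z: "z \<in> L k" "tc k p x z" "Cut k z z" using nice_exists[OF x ell] by blast
  obtain t i where t: "t \<in> L k" "suffix (wd t) (wd x)" "ph p t + x - t = ph i z"
    using hyperbolic_suffix[OF z(1,3) x tc_sym[OF z(2)]] by blast
  obtain r j where r: "r \<in> L k" "suffix (wd r) (wd y)" "ph p r + y - r = ph j z"
    using hyperbolic_suffix[OF z(1,3) y tc_trans[OF tc_sym[OF z(2)] tc]] by blast
  have "ph p r + y - r = ph (j - i) (ph p t + x - t)" unfolding t(3) r(3) by (simp add: ph_ph)
  with t r show ?thesis by blast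
qed

section \<open>Bounds on the exponent\<close>

abbreviation len :: "'g fg \<Rightarrow> nat" where "len x \<equiv> length (wd x)"

lemma length_red: "length (red w) \<le> length w"
  using filter_red[of "\<lambda>_. True" w] by simp

lemma len_plus: "len (x + y) \<le> len x + len y"
  using length_red[of "wd x @ wd y"] by (simp add: wd_plus)

lemma cnt_le_len: "cnt k x \<le> len x"
  by (simp add: cnt_def)

section \<open>Exponent sums\<close>

definition expsum :: "nat \<Rightarrow> gen fg \<Rightarrow> int" where
  "expsum j = ext (\<lambda>g. if g = Gen_a j then 1 else 0)"

lemma expsum_simps [simp]: "expsum j (x + y) = expsum j x + expsum j y" "expsum j (- x) = - expsum j x" "expsum j 0 = 0"
  "expsum j (x - y) = expsum j x - expsum j y" "expsum j (gn g) = (if g = Gen_a j then 1 else 0)"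
  by (simp_all add: expsum_def ext_plus ext_uminus ext_diff)

lemma expsum_le_len: "\<bar>expsum j x\<bar> \<le> int (len x)"
proof -
  have "\<bar>sum_list (map (slet (\<lambda>g. if g = Gen_a j then 1 else 0 :: int)) w)\<bar> \<le> int (length w)" for w
    by (induction w) (auto simp: slet_def)
  then show ?thesis by (simp add: expsum_def ext_def)
qed

lemma ext_cong:
  assumes "\<And>l. l \<in> set (wd x) \<Longrightarrow> f (fst l) = g (fst l)"
  shows "ext f x = ext g x"
proof -
  have "map (slet f) (wd x) = map (slet g) (wd x)" using assms by (auto simp: slet_def)
  then show ?thesis unfolding ext_def by (rule arg_cong)
qed

lemma L_ext_cong: "x \<in> L k \<Longrightarrow> (\<And>j. 1 \<le> j \<Longrightarrow> j \<le> k \<Longrightarrow> f (Gen_a j) = g (Gen_a j)) \<Longrightarrow> ext f x = ext g x"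
  by (rule ext_cong) (auto simp: L_def)

lemma expsum_L: "x \<in> L k \<Longrightarrow> k < j \<Longrightarrow> expsum j x = 0"
proof -
  assume "x \<in> L k" "k < j"
  then have "expsum j x = ext (\<lambda>_. 0) x" unfolding expsum_def by (intro L_ext_cong) auto
  also have "\<dots> = 0" using fg_hom_eq_ext[of "\<lambda>_. 0 :: int" x] by simp
  finally show ?thesis .
qed

text \<open>On the abelianization \<phi> is unipotent: each a_(j+1) contributes one further a_j. For
  j = 0 this breaks down, since a_1 is fixed.\<close>

lemma expsum_ph1:
  assumes "j \<ge> 1"
  shows "expsum j (ph1 x) = expsum j x + expsum (Suc j) x"
proof -
  have *: "expsum j (ph1 (gn g)) = expsum j (gn g) + expsum (Suc j) (gn g)" for g
    using assms by (cases g) (auto simp: ph1_def)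
  have "expsum j (ph1 x) = ext (\<lambda>g. expsum j (ph1 (gn g))) x"
    by (rule fg_hom_eq_ext[of "\<lambda>x. expsum j (ph1 x)"]) (simp add: ph1_plus)
  also have "\<dots> = expsum j x + expsum (Suc j) x"
    unfolding * by (rule fg_hom_eq_ext[of "\<lambda>x. expsum j x + expsum (Suc j) x", symmetric]) simp
  finally show ?thesis .
qed

lemma ph1_ph: "ph1 (ph (i - 1) x) = ph i x"
  using ph_plus_1[of "i - 1" x] by simp

lemma expsum_top: "x \<in> L k \<Longrightarrow> k \<ge> 1 \<Longrightarrow> expsum k (ph i x) = expsum k x"
proof (induction i rule: int_induct[where k = 0])
  case (step1 i)
  then show ?case by (simp add: ph_plus_1 expsum_ph1 expsum_L[of "ph i x" k])
next
  case (step2 i)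
  then show ?case using expsum_ph1[of k "ph (i - 1) x"] by (simp add: ph1_ph expsum_L[of "ph (i - 1) x" k])
qed simp

text \<open>Growth linear in i bounds |i| by the lengths as soon as the slope is nonzero. If the top
  exponent sum vanishes, \<open>expsum_top2\<close> gives the same one rank lower.\<close>

lemma expsum_top1: "x \<in> L (Suc k) \<Longrightarrow> k \<ge> 1 \<Longrightarrow> expsum k (ph i x) = expsum k x + i * expsum (Suc k) x"
proof (induction i rule: int_induct[where k = 0])
  case (step1 i)
  then show ?case by (simp add: ph_plus_1 expsum_ph1 expsum_top[of x "Suc k"] distrib_right)
next
  case (step2 i)
  then show ?case using expsum_ph1[of k "ph (i - 1) x"]
    by (simp add: ph1_ph expsum_top[of x "Suc k"] left_diff_distrib)
qed simp

lemma expsum_top2: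
  assumes "x \<in> L (Suc (Suc k))" "k \<ge> 1" "expsum (Suc (Suc k)) x = 0"
  shows "expsum k (ph i x) = expsum k x + i * expsum (Suc k) x"
proof (induction i rule: int_induct[where k = 0])
  case (step1 i)
  then show ?case using assms by (simp add: ph_plus_1 expsum_ph1 expsum_top1[of x "Suc k"] distrib_right)
next
  case (step2 i)
  then show ?case using assms expsum_ph1[of k "ph (i - 1) x"]
    by (simp add: ph1_ph expsum_top1[of x "Suc k"] left_diff_distrib)
qed simp

section \<open>Positive words and the case of vanishing exponent sums\<close>

definition positive :: "'g fg \<Rightarrow> bool" where
  "positive x \<longleftrightarrow> (\<forall>l\<in>set (wd x). snd l)"

lemma positive_wd_plus:
  assumes "positive x" "positive y"
  shows "wd (x + y) = wd x @ wd y"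
proof (rule wd_plus_reduced)
  show "reduced (wd x @ wd y)"
  proof (cases "x = 0 \<or> y = 0")
    case False
    then have "last (wd x) \<in> set (wd x)" "hd (wd y) \<in> set (wd y)" by auto
    then have "snd (last (wd x))" "snd (hd (wd y))" using assms by (auto simp: positive_def)
    then show ?thesis by (auto simp: reduced_append linv_def prod_eq_iff)
  qed auto
qed

lemma positive_plus: "positive x \<Longrightarrow> positive y \<Longrightarrow> positive (x + y)"
  using positive_wd_plus[of x y] by (auto simp: positive_def)

lemma positive_simps [simp]: "positive 0" "positive (gn g)"
  by (simp_all add: positive_def)

lemma positive_not_St_uminus: "positive x \<Longrightarrow> \<not> St k (- x)"
  using last_in_set[of "wd x"] unfolding St_uminus positive_def by (metis snd_conv)

lemma positive_ex: "positive x \<Longrightarrow> expsum k x = int (cnt k x)"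
proof -
  assume "positive x"
  have "sum_list (map (slet (\<lambda>g. if g = Gen_a k then 1 else 0)) w) =
      int (length (filter (\<lambda>l. fst l = Gen_a k) w))" if "\<forall>l\<in>set w. snd l" for w
    using that by (induction w) (auto simp: slet_def)
  then show ?thesis using \<open>positive x\<close> by (simp add: expsum_def ext_def cnt_def positive_def)
qed

text \<open>For k \<ge> 1 this is the product a_k \<phi>(a_k) ... \<phi>^(j-1)(a_k), a positive word
  with exactly j letters a_k.\<close>

abbreviation PP :: "nat \<Rightarrow> nat \<Rightarrow> gen fg" where
  "PP k j \<equiv> P (Suc k) (int j)"

lemma P_add: "P k (i + j) = P k i + ph i (P k j)"
  unfolding P_def by (simp add: ph_ph add.assoc)

lemma PP_Suc: "k \<ge> 1 \<Longrightarrow> PP k (Suc j) = PP k j + (ag k + P k (int j))"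
  using P_plus_1[of "Suc k" "int j"] by (simp add: ph_ag add.commute)

lemma positive_PP: "positive (P k (int j))"
proof (induction k arbitrary: j)
  case 0
  then show ?case by (simp add: P_le_1)
next
  case (Suc k)
  show ?case
  proof (cases "k = 0")
    case True
    then show ?thesis by (simp add: P_le_1 One_nat_def)
  next
    case False
    show ?thesis
    proof (induction j)
      case (Suc j)
      then show ?case using False PP_Suc[of k j] \<open>\<And>j. positive (P k (int j))\<close>
        by (simp add: positive_plus del: of_nat_Suc)
    qed simp
  qed
qed

lemma PP_L: "PP k j \<in> L k"
  using P_L[of "Suc k" "int j"] by simp

lemma cnt_PP: "k \<ge> 1 \<Longrightarrow> cnt k (PP k j) = j"
proof (induction j)
  case (Suc j)
  have "wd (ag k + P k (int j)) = wd (ag k) @ wd (P k (int j))"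
    by (rule positive_wd_plus) (simp_all add: positive_PP)
  from cnt_sum[OF this, of k] have "cnt k (ag k + P k (int j)) = 1" by (simp add: cnt_def[of k "ag k"])
  moreover have "wd (PP k (Suc j)) = wd (PP k j) @ wd (ag k + P k (int j))"
    unfolding PP_Suc[OF Suc.prems] by (rule positive_wd_plus) (simp_all add: positive_PP positive_plus)
  ultimately show ?case using Suc cnt_sum[of "PP k j" "ag k + P k (int j)" k]
    by (simp add: PP_Suc del: of_nat_Suc)
qed simp

lemma St_PP: "k \<ge> 1 \<Longrightarrow> St k (PP k (Suc j))"
proof (induction j)
  case 0
  then show ?case using PP_Suc[of k 0] by (simp add: St_def del: of_nat_Suc)
next
  case (Suc j)
  have "wd (PP k (Suc (Suc j))) = wd (PP k (Suc j)) @ wd (ag k + P k (int (Suc j)))"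
    unfolding PP_Suc[OF Suc.prems, of "Suc j"]
    by (rule positive_wd_plus) (simp_all add: positive_PP positive_plus del: of_nat_Suc)
  then show ?case using Suc by (auto simp: St_def simp del: of_nat_Suc)
qed

lemma Cut_PP:
  assumes "k \<ge> 1" "n \<ge> 1"
  shows "Cut k (PP k j) (ph (int j) (PP k n))" "PP k (j + n) = PP k j + ph (int j) (PP k n)"
proof -
  have "St k (PP k n)" using St_PP[OF assms(1), of "n - 1"] assms(2) by (simp add: Suc_diff_Suc)
  then show "Cut k (PP k j) (ph (int j) (PP k n))"
    using positive_not_St_uminus[OF positive_PP] by (simp add: Cut_def ph_St PP_L)
  show "PP k (j + n) = PP k j + ph (int j) (PP k n)" using P_add by simp
qed

lemma append_Cons_count_unique:
  assumes "a @ l # u = b @ l # v" "length (filter Q a) = length (filter Q b)" "Q l"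
  shows "a = b"
proof -
  have "a' = []" if "c @ l # v = (c @ a') @ l # u" "length (filter Q (c @ a')) = length (filter Q c)"
    for c a' u v :: "'a list"
    using that assms(3) by (cases a') auto
  moreover from assms(1) obtain us where "a = b @ us \<or> a @ us = b"
    by (auto simp: append_eq_append_conv2)
  ultimately show ?thesis using assms by (metis append_Nil2)
qed

text \<open>Both $Y P_j$ and $P_j$ are followed by the letter $a_k$ in the common reduced word of
  $Y P_i = P_i \varphi^i(w)$, inside its positive initial part, and they contain $a_k$ equally often.\<close>

lemma conj_PP_bound:
  assumes k: "k \<ge> 1" and w: "w \<in> L k" and Y: "Y \<in> L k" and eq: "Y + PP k i = PP k i + ph (int i) w"
    and expsum: "expsum k Y = 0"
  shows "Y = 0 \<or> i \<le> 2 * len Y + len w + 2"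
proof (rule disjCI)
  assume big: "\<not> i \<le> 2 * len Y + len w + 2"
  \<comment> \<open>The value of j exceeds the number of letters of \<open>Y\<close>, so the seam
    behind P_j survives on the left side; n makes P_(j+n) longer than Y P_j; and i - (j + n) >
    \<open>len w\<close> protects the seam on the right side. Together they account for the bound 2
    \<open>len Y\<close> + \<open>len w\<close> + 2.\<close>
  define j where "j = len Y + 1"
  define n where "n = len Y + 1"
  let ?S1 = "ph (int j) (PP k (i - j))" and ?S2 = "ph (int (j + n)) (PP k (i - (j + n)))"
  have ij: "i - j \<ge> 1" "i = j + (i - j)" "i - (j + n) \<ge> 1" "i = (j + n) + (i - (j + n))" "n \<ge> 1"
    "len w < i - (j + n)"
    using big by (simp_all add: j_def n_def)
  note C1 = Cut_PP[OF k ij(1), of j] and C2 = Cut_PP[OF k ij(3), of "j + n"] and C3 = Cut_PP[OF k ij(5), of j]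
  have cnt_ph_PP: "cnt k (ph (int q) (PP k r)) = r" for q r
    using k by (simp only: ph_cnt PP_L cnt_PP)
  have Yj: "cnt k Y < j" and wj: "cnt k w < i - (j + n)"
    using cnt_le_len[of k Y] cnt_le_len[of k w] ij(6) by (simp_all add: j_def)
  have "Cut k (Y + PP k j) (?S1 + 0)"
    using C1(1)
  proof (rule Cut_survive)
    show "cnt k Y < cnt k (PP k j)" using Yj cnt_PP[OF k, of j] by simp
    show "cnt k 0 < cnt k ?S1" unfolding cnt_zero cnt_ph_PP using ij(1) by linarith
  qed
  then have 1: "wd (Y + PP k j + ?S1) = wd (Y + PP k j) @ wd ?S1" by (intro wd_Cut) simp
  have "Cut k (0 + PP k (j + n)) (?S2 + ph (int i) w)"
    using C2(1)
  proof (rule Cut_survive)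
    show "cnt k 0 < cnt k (PP k (j + n))" unfolding cnt_PP[OF k] using Yj by simp
    show "cnt k (ph (int i) w) < cnt k ?S2" unfolding cnt_ph_PP ph_cnt[OF w] by (rule wj)
  qed
  then have 2: "wd (PP k (j + n) + (?S2 + ph (int i) w)) = wd (PP k (j + n)) @ wd (?S2 + ph (int i) w)"
    by (intro wd_Cut) simp
  have e1: "Y + PP k j + ?S1 = Y + PP k i" using C1(2) ij(2) by (simp add: add.assoc)
  have e2: "PP k (j + n) + (?S2 + ph (int i) w) = PP k i + ph (int i) w"
    using C2(2) ij(4) by (simp add: add.assoc)
  have e: "wd (Y + PP k j) @ wd ?S1 = wd (PP k (j + n)) @ wd (?S2 + ph (int i) w)"
    unfolding 1[symmetric] 2[symmetric] e1 e2 eq ..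
  have 3: "wd (PP k (j + n)) = wd (PP k j) @ wd (ph (int j) (PP k n))"
    unfolding C3(2) using C3(1) by (rule wd_Cut)
  have "n \<le> len (ph (int j) (PP k n))"
    using cnt_le_len[of k "ph (int j) (PP k n)"] k by (simp add: ph_cnt PP_L cnt_PP)
  then have "len (Y + PP k j) < len (PP k (j + n))"
    using len_plus[of Y "PP k j"] 3 by (simp add: n_def)
  with e obtain us where us: "us \<noteq> []" "wd (PP k (j + n)) = wd (Y + PP k j) @ us"
    "wd ?S1 = us @ wd (?S2 + ph (int i) w)"
    by (fastforce simp: append_eq_append_conv2)
  have St: "St k (PP k n')" if "n' \<ge> 1" for n' using St_PP[OF k, of "n' - 1"] that by (simp add: Suc_diff_Suc)
  have "St k ?S1" using St[OF ij(1)] by (simp add: ph_St PP_L)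
  then obtain us' where us': "us = (Gen_a k, True) # us'" using us by (cases us) (auto simp: St_def)
  have "St k (ph (int j) (PP k n))" using St[OF ij(5)] by (simp add: ph_St PP_L)
  then obtain vs where vs: "wd (ph (int j) (PP k n)) = (Gen_a k, True) # vs"
    by (cases "wd (ph (int j) (PP k n))") (auto simp: St_def)
  \<comment> \<open>A prefix of a positive word is positive, so its number of letters a_k is its
    exponent sum, and \<open>Y\<close> contributes nothing to that.\<close>
  have "positive (Y + PP k j)" using positive_PP[of "Suc k" "j + n"] us(2) by (simp add: positive_def)
  then have "cnt k (Y + PP k j) = j" using positive_ex[of "Y + PP k j" k] expsum positive_ex[OF positive_PP, of k "Suc k" j] k
    by (simp add: cnt_PP)
  then have "wd (Y + PP k j) = wd (PP k j)"
    using append_Cons_count_unique[of "wd (Y + PP k j)" "(Gen_a k, True)" us' "wd (PP k j)" vs "\<lambda>l. fst l = Gen_a k"]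
      us(2) us' 3 vs cnt_PP[OF k, of j] by (simp add: cnt_def)
  then have "Y + PP k j = 0 + PP k j" by (simp add: wd_inject)
  then show "Y = 0" by (rule add_right_imp_eq)
qed

lemma conj_P_bound:
  assumes k: "k \<ge> 1" and w: "w \<in> L k" and i: "i \<ge> 0" and Y: "Y = P (Suc k) i + ph i w - P (Suc k) i"
    and expsum: "expsum k Y = 0"
  shows "w = 0 \<or> i \<le> int (2 * len Y + len w + 2)"
proof -
  have PL: "P (Suc k) i \<in> L k" using P_L[of "Suc k" i] by simp
  have "Y + PP k (nat i) = PP k (nat i) + ph (int (nat i)) w"
    using i unfolding Y by (simp add: add.assoc diff_conv_add_uminus del: add_uminus_conv_diff)
  then have "Y = 0 \<or> nat i \<le> 2 * len Y + len w + 2"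
    using PL w expsum by (intro conj_PP_bound[OF k w]) (simp_all add: Y)
  moreover have "Y = 0 \<longleftrightarrow> w = 0" unfolding Y by (rule P_conj_eq_0)
  ultimately show ?thesis by linarith
qed

lemma L_0: "x \<in> L 0 \<Longrightarrow> x = 0"
  by (simp add: L_def)

lemma ph1_L1: "x \<in> L 1 \<Longrightarrow> ph1 x = x"
  unfolding ph1_def using L_ext_cong[of x 1 phi_img gn] by (simp add: ext_id)

lemma ag1_commute: "x \<in> L 1 \<Longrightarrow> ag 1 + x - ag 1 = x"
proof -
  assume "x \<in> L 1"
  have "ag 1 + x - ag 1 = ext (\<lambda>g. ag 1 + gn g - ag 1) x"
    by (rule fg_hom_eq_ext[of "\<lambda>x. ag 1 + x - ag 1"])
      (simp add: add.assoc diff_conv_add_uminus del: add_uminus_conv_diff)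
  also have "\<dots> = ext gn x"
  proof (rule L_ext_cong[OF \<open>x \<in> L 1\<close>])
    fix j :: nat
    assume "1 \<le> j" "j \<le> 1"
    then have "j = 1" by simp
    then show "ag 1 + ag j - ag 1 = ag j" by simp
  qed
  also have "\<dots> = x" by (rule ext_id)
  finally show ?thesis .
qed

lemma ph1_fixed: "ph1 x = x \<Longrightarrow> ph i x = x"
proof (induction i rule: int_induct[where k = 0])
  case (step2 i)
  then show ?case by (metis ph1'_ph1 ph_minus_1)
qed (simp_all add: ph_plus_1)

text \<open>The constants come from a w a^-1: passing to w costs two letters in the bound of
  \<open>conj_P_bound\<close>, and 2 (c + 2) + (d + 2) + 2 \<le> 3 (c + d) + 8. The other cases stay
  below this.\<close>

definition ph_bounded :: "gen fg \<Rightarrow> bool" where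
  "ph_bounded x \<longleftrightarrow> ph1 x = x \<or> (\<forall>i. \<bar>i\<bar> \<le> int (3 * (len x + len (ph i x)) + 8))"

lemma ph_bounded_ex:
  assumes "x \<in> L (Suc k)" "k \<ge> 1" "expsum (Suc k) x \<noteq> 0"
  shows "ph_bounded x"
proof -
  have "\<bar>i\<bar> \<le> int (3 * (len x + len (ph i x)) + 8)" for i
  proof -
    have "\<bar>i\<bar> * 1 \<le> \<bar>i\<bar> * \<bar>expsum (Suc k) x\<bar>" using assms(3) by (intro mult_left_mono) auto
    also have "\<dots> = \<bar>expsum k (ph i x) - expsum k x\<bar>" using expsum_top1[OF assms(1,2), of i] by (simp add: abs_mult)
    finally show ?thesis using expsum_le_len[of k x] expsum_le_len[of k "ph i x"] by simp
  qed
  then show ?thesis by (simp add: ph_bounded_def)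
qed

lemma ph_bounded_ex2:
  assumes "x \<in> L (Suc (Suc k))" "k \<ge> 1" "expsum (Suc (Suc k)) x = 0" "expsum (Suc k) x \<noteq> 0"
  shows "ph_bounded x"
proof -
  have "\<bar>i\<bar> \<le> int (3 * (len x + len (ph i x)) + 8)" for i
  proof -
    have "\<bar>i\<bar> * 1 \<le> \<bar>i\<bar> * \<bar>expsum (Suc k) x\<bar>" using assms(4) by (intro mult_left_mono) auto
    also have "\<dots> = \<bar>expsum k (ph i x) - expsum k x\<bar>" using expsum_top2[OF assms(1-3), of i] by (simp add: abs_mult)
    finally show ?thesis using expsum_le_len[of k x] expsum_le_len[of k "ph i x"] by simp
  qed
  then show ?thesis by (simp add: ph_bounded_def)
qed

lemma len_conj: "len y \<le> len (ag k + y - ag k) + 2"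
proof -
  have "y = - ag k + (ag k + y - ag k) + ag k" by (simp add: add.assoc diff_conv_add_uminus del: add_uminus_conv_diff)
  then have "len y \<le> len (- ag k) + len (ag k + y - ag k) + len (ag k)"
    by (metis (no_types, lifting) add_le_mono1 le_trans len_plus)
  then show ?thesis by simp
qed

lemma abs_le_bound:
  fixes i :: int and a b c d :: nat
  assumes "\<bar>i\<bar> \<le> int (2 * a + b + 2)" "a \<le> c + 2" "b \<le> d + 2"
  shows "\<bar>i\<bar> \<le> int (3 * (d + c) + 8)" "\<bar>i\<bar> \<le> int (3 * (c + d) + 8)"
proof -
  have "2 * a + b + 2 \<le> 3 * (d + c) + 8" "3 * (d + c) = 3 * (c + d)" using assms(2,3) by simp_all
  then have "int (2 * a + b + 2) \<le> int (3 * (d + c) + 8)" "3 * (d + c) = 3 * (c + d)"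
    by (simp_all only: of_nat_le_iff)
  with assms(1) show "\<bar>i\<bar> \<le> int (3 * (d + c) + 8)" "\<bar>i\<bar> \<le> int (3 * (c + d) + 8)" by simp_all
qed

text \<open>With a = a_(k+1), \<phi>^i maps a w a^-1 to a Y a^-1, where Y is the conjugate of
  \<phi>^i(w) by \<open>P (Suc k) i\<close>. For k = 1 everything inside commutes and the element is
  fixed; for k \<ge> 2 either the exponent sum of a_k in w is nonzero and bounds i, or
  \<open>conj_P_bound\<close> does.\<close>

lemma ph_bounded_conj:
  assumes w: "w \<in> L k"
  shows "ph_bounded (ag (Suc k) + w - ag (Suc k))" (is "ph_bounded ?x")
proof -
  have a: "ag (Suc k) \<in> L (Suc k)" "ag (Suc k) \<in> L (Suc (k - 1 + 1))" by simp_all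
  have wL: "w \<in> L (Suc k)" using w L_mono[of k "Suc k"] by simp
  consider "k = 0" | "k = 1" | "k \<ge> 2" "expsum k w \<noteq> 0" | "k \<ge> 2" "expsum k w = 0" by linarith
  then show ?thesis
  proof cases
    case 1
    then show ?thesis using w L_0[of w] by (simp add: ph_bounded_def ph1_def)
  next
    case 2
    have "ph1 ?x = ag (Suc k) + (ag 1 + w - ag 1) - ag (Suc k)"
      using w 2 ph1_L1[of w] unfolding ph_1[symmetric]
      by (simp add: ph_1 minus_add add.assoc diff_conv_add_uminus del: add_uminus_conv_diff)
        (simp add: ph1_def ph_1[symmetric] minus_add add.assoc diff_conv_add_uminus One_nat_def del: add_uminus_conv_diff)
    then show ?thesis using ag1_commute[of w] w 2 by (simp add: ph_bounded_def)
  next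
    case 3
    then obtain l where l: "k = Suc l" "l \<ge> 1" by (cases k) auto
    show ?thesis
      by (rule ph_bounded_ex2[of _ l]) (use 3 l wL w in \<open>auto simp: expsum_L\<close>)
  next
    case 4
    have k1: "k \<ge> 1" using 4 by simp
    define Y where "Y i = P (Suc k) i + ph i w - P (Suc k) i" for i
    have PL: "P (Suc k) i \<in> L k" for i using P_L[of "Suc k" i] by simp
    have YL: "Y i \<in> L k" for i using PL w by (simp add: Y_def)
    have x: "ph i ?x = ag (Suc k) + Y i - ag (Suc k)" for i
      by (simp add: Y_def ph_ag minus_add add.assoc diff_conv_add_uminus del: add_uminus_conv_diff)
    have exY: "expsum k (Y i) = 0" for i using 4 expsum_top[OF w, of i] by (simp add: Y_def)
    have w0: "w = P (Suc k) (- i) + ph (- i) (Y i) - P (Suc k) (- i)" for i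
    proof -
      have "P (Suc k) (- i) + ph (- i) (P (Suc k) i) = 0" using P_add[of "Suc k" "- i" i] by simp
      then have *: "ph (- i) (P (Suc k) i) = - P (Suc k) (- i)" by (simp add: eq_neg_iff_add_eq_0 neg_eq_iff_add_eq_0 minus_unique)
      show ?thesis unfolding Y_def by (simp add: * add.assoc diff_conv_add_uminus del: add_uminus_conv_diff)
    qed
    have "w = 0 \<or> \<bar>i\<bar> \<le> int (3 * (len ?x + len (ph i ?x)) + 8)" for i
    proof (cases "i \<ge> 0")
      case True
      have "w = 0 \<or> i \<le> int (2 * len (Y i) + len w + 2)"
        by (rule conj_P_bound[OF k1 w True Y_def exY])
      moreover have "\<bar>i\<bar> \<le> int (3 * (len ?x + len (ph i ?x)) + 8)"
        if "i \<le> int (2 * len (Y i) + len w + 2)"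
        unfolding x by (rule abs_le_bound(1)[OF _ len_conj len_conj]) (use that True in simp)
      ultimately show ?thesis by blast
    next
      \<comment> \<open>For negative i the elements \<open>w\<close> and \<open>Y i\<close> change
        places, since \<open>w\<close> is the conjugate of \<phi>^-i(\<open>Y i\<close>) by
        \<open>w0\<close>.\<close>
      case False
      have "Y i = 0 \<or> - i \<le> int (2 * len w + len (Y i) + 2)"
        by (rule conj_P_bound[OF k1 YL _ w0 4(2)]) (use False in simp)
      moreover have "Y i = 0 \<longleftrightarrow> w = 0" unfolding Y_def by (rule P_conj_eq_0)
      moreover have "\<bar>i\<bar> \<le> int (3 * (len ?x + len (ph i ?x)) + 8)"
        if "- i \<le> int (2 * len w + len (Y i) + 2)"
        unfolding x by (rule abs_le_bound(2)[OF _ len_conj len_conj]) (use that False in simp)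
      ultimately show ?thesis by blast
    qed
    moreover have "ph1 ?x = ?x" if "w = 0" using that by (simp add: ph1_def)
    ultimately show ?thesis unfolding ph_bounded_def by blast
  qed
qed

text \<open>Lengths add up at a cut both before and after \<phi>^i, so the bound for a factor that
  \<phi> moves carries over to the product.\<close>

lemma ph_bounded_Cut:
  assumes "Cut k x y" "x \<in> L k" "y \<in> L k" "ph_bounded x" "ph_bounded y"
  shows "ph_bounded (x + y)"
proof (cases "ph1 x = x \<and> ph1 y = y")
  case True
  then show ?thesis by (simp add: ph_bounded_def ph1_plus)
next
  case False
  have "\<bar>i\<bar> \<le> int (3 * (len (x + y) + len (ph i (x + y))) + 8)" for i
  proof -
    have "Cut k (ph i x) (ph i y)" using assms by (simp add: Cut_ph)
    from wd_Cut[OF this] wd_Cut[OF assms(1)]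
    have e: "len (x + y) = len x + len y" "len (ph i (x + y)) = len (ph i x) + len (ph i y)" by simp_all
    have "\<bar>i\<bar> \<le> int (3 * (len x + len (ph i x)) + 8) \<or> \<bar>i\<bar> \<le> int (3 * (len y + len (ph i y)) + 8)"
      using False assms(4,5) unfolding ph_bounded_def by blast
    then show ?thesis unfolding e by presburger
  qed
  then show ?thesis by (simp add: ph_bounded_def)
qed

text \<open>With n the new rank, splitting at cuts leaves pieces of smaller rank and the pieces a_n
  w, w a_n^-1 and a_n w a_n^-1 with w of smaller rank. The first two of these have exponent sum 1 or
  -1 at a_n (and are fixed if n = 1), the last is \<open>ph_bounded_conj\<close>.\<close>

theorem ph_bounded_L: "x \<in> L k \<Longrightarrow> ph_bounded x"
proof (induction k arbitrary: x)
  case 0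
  then show ?case using L_0[of x] by (simp add: ph_bounded_def ph1_def)
next
  case (Suc k)
  note IHk = Suc.IH
  let ?n = "Suc k"
  from Suc.prems show ?case
  proof (induction "len x" arbitrary: x rule: less_induct)
    case less
    have split: "ph_bounded x" if "x = u + v" "Cut ?n u v" "u \<noteq> 0" "v \<noteq> 0" for u v
    proof -
      have "u + v \<in> L ?n" using less.prems that(1) by simp
      note uv = Cut_L[OF that(2) this]
      have "len x = len u + len v" using wd_Cut[OF that(2)] that(1) by simp
      then have "ph_bounded u" "ph_bounded v" using that(3,4) uv by (auto intro: less.hyps)
      then show ?thesis using ph_bounded_Cut[OF that(2) uv] that(1) by simp
    qed
    show ?case
    proof (cases "x \<in> L (?n - 1)")
      case True
      then show ?thesis using IHk by simp
    next
      case False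
      note a = L_level[OF less.prems False]
      have aw: "ph_bounded v" if "v \<in> L ?n" "\<bar>expsum ?n v\<bar> = 1" for v
      proof (cases "k = 0")
        case True
        then show ?thesis using that ph1_L1[of v] by (simp add: ph_bounded_def One_nat_def)
      next
        case False
        then show ?thesis using that by (intro ph_bounded_ex[of v k]) auto
      qed
      from less.prems False show ?thesis
      proof (cases rule: first_split)
        case (pos w z)
        have St: "St ?n (ag ?n + z)" using pos by (intro St_pos)
        show ?thesis
        proof (cases "w = 0")
          case False
          have "Cut ?n w (ag ?n + z)" using St pos(1) by (simp add: Cut_def)
          moreover have "ag ?n + z \<noteq> 0" using St by auto
          moreover have "x = w + (ag ?n + z)" using pos(4) by (simp add: add.assoc)
          ultimately show ?thesis using split False by blast
        next
          case w: True
          show ?thesis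
          proof (cases "z \<in> L (?n - 1)")
            case True
            have "expsum ?n z = 0" using True by (simp add: expsum_L)
            then show ?thesis using aw[OF less.prems] pos(4) w by simp
          next
            case False
            from pos(2) False show ?thesis
            proof (cases rule: first_split)
              case zpos: (pos w' z')
              have "St ?n (ag ?n + z')" using zpos by (intro St_pos)
              moreover have "\<not> St ?n (- w' - ag ?n + 0)" using zpos(1) by (intro St_neg_L) auto
              ultimately have "Cut ?n (ag ?n + w') (ag ?n + z')"
                by (simp add: Cut_def minus_add)
              moreover have "ag ?n + w' \<noteq> 0"
                using wd_pos[of 0 ?n w'] zpos(1) by (metis L_not_Sn L_zero add_0 list.distinct(1) wd_zero append_Nil)
              moreover have "ag ?n + z' \<noteq> 0" using \<open>St ?n (ag ?n + z')\<close> by auto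
              moreover have "x = (ag ?n + w') + (ag ?n + z')" using pos(4) w zpos(4) by (simp add: add.assoc)
              ultimately show ?thesis using split by blast
            next
              case zneg: (neg w' z')
              have "w' \<noteq> 0" using pos(3) zneg Sn_neg_L[of w' ?n z'] by simp
              then have "\<not> Sn ?n (- w' - ag ?n + 0)" using zneg(1) Sn_neg_L[of "- w'" ?n 0] by simp
              then have St': "St ?n (ag ?n + (- w' - ag ?n))" unfolding St_ag_iff by simp
              let ?u = "ag ?n + w' - ag ?n"
              have "- ?u = ag ?n + (- w' - ag ?n)"
                by (simp add: minus_add add.assoc diff_conv_add_uminus del: add_uminus_conv_diff)
              then have St'': "St ?n (- ?u)" using St' by simp
              then have C: "Cut ?n ?u z'" using zneg(3) by (simp add: Cut_def)
              have x: "x = ?u + z'" using pos(4) w zneg(4)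
                by (simp add: add.assoc diff_conv_add_uminus del: add_uminus_conv_diff)
              show ?thesis
              proof (cases "z' = 0")
                case True
                then show ?thesis using x ph_bounded_conj[of w' k] zneg(1) by simp
              next
                case False
                moreover have "?u \<noteq> 0" using St'' by (metis St_zero neg_equal_0_iff_equal)
                ultimately show ?thesis using split[OF x C] by blast
              qed
            qed
          qed
        qed
      next
        case (neg w z)
        have St: "St ?n (ag ?n - w)" using St_ag_iff[of ?n "- w"] neg(1) by simp
        have "- (w - ag ?n) = ag ?n - w" by simp
        then have C: "Cut ?n (w - ag ?n) z" using neg(3) St by (simp add: Cut_def)
        show ?thesis
        proof (cases "z = 0")
          case True
          have "expsum ?n w = 0" using neg(1) by (simp add: expsum_L)
          then show ?thesis using aw[OF less.prems] neg(4) True by simp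
        next
          case False
          moreover have "w - ag ?n \<noteq> 0" using St by auto
          ultimately show ?thesis using split[OF neg(4) C] by blast
        qed
      qed
    qed
  qed
qed

section \<open>Normal forms\<close>

text \<open>\<open>HE p x\<close> stands for $s^p x$.\<close>

datatype hel = HE int "gen fg"

instantiation hel :: group_add
begin

fun plus_hel :: "hel \<Rightarrow> hel \<Rightarrow> hel" where "HE p x + HE q y = HE (p + q) (ph q x + y)"
definition zero_hel :: hel where "0 = HE 0 0"
fun uminus_hel :: "hel \<Rightarrow> hel" where "- HE p x = HE (- p) (- ph (- p) x)"
definition minus_hel :: "hel \<Rightarrow> hel \<Rightarrow> hel" where "minus_hel g h = g + - h"

instance
proof
  fix a b c :: hel
  show "a + b + c = a + (b + c)"
    by (cases a; cases b; cases c) (simp add: ph_ph add.assoc add.commute)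
  show "0 + a = a" "a + 0 = a" by (cases a; simp add: zero_hel_def)+
  show "- a + a = 0" by (cases a) (simp add: zero_hel_def)
  show "a + - b = a - b" by (simp add: minus_hel_def)
qed

end

definition hgen :: "gen \<Rightarrow> hel" where
  "hgen g = (case g of Gen_a i \<Rightarrow> HE 0 (ag i) | Gen_s \<Rightarrow> HE 1 0)"

definition val :: "gen word \<Rightarrow> hel" where
  "val w = sum_list (map (slet hgen) w)"

lemma val_simps [simp]: "val [] = 0" "val (u @ v) = val u + val v"
  by (simp_all add: val_def)

lemma val_Cons: "val (l # w) = slet hgen l + val w"
  by (simp add: val_def)

lemma val_inv_word [simp]: "val (inv_word w) = - val w"
  by (induction w) (simp_all add: val_Cons slet_linv minus_add)

definition HL :: "nat \<Rightarrow> hel set" where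
  "HL k = {HE p x |p x. x \<in> L k}"

lemma HE_HL [simp]: "HE p x \<in> HL k \<longleftrightarrow> x \<in> L k"
  by (simp add: HL_def)

lemma HL_closed [simp]: "g \<in> HL k \<Longrightarrow> h \<in> HL k \<Longrightarrow> g + h \<in> HL k" "- g \<in> HL k \<longleftrightarrow> g \<in> HL k" "0 \<in> HL k"
  by (cases g; cases h; simp add: zero_hel_def)+

lemma slet_hgen_HL: "fst l \<in> H_gens m \<Longrightarrow> slet hgen l \<in> HL m"
  by (auto simp: slet_def H_gens_def hgen_def split: gen.splits)

lemma val_HL: "w \<in> words (H_gens m) \<Longrightarrow> val w \<in> HL m"
  by (induction w) (auto simp: val_Cons slet_hgen_HL)

definition spow :: "int \<Rightarrow> gen fg" where
  "spow p = (if p \<ge> 0 then fg_of (replicate (nat p) (Gen_s, True))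
             else fg_of (replicate (nat (- p)) (Gen_s, False)))"

lemma reduced_replicate: "reduced (replicate n l)"
  by (induction n) (auto simp: reduced_Cons)

lemma wd_spow: "wd (spow p) = (if p \<ge> 0 then replicate (nat p) (Gen_s, True)
    else replicate (nat (- p)) (Gen_s, False))"
  by (simp add: spow_def reduced_replicate)

lemma fg_of_Cons': "fg_of ((g, True) # w) = gn g + fg_of w" "fg_of ((g, False) # w) = - gn g + fg_of w"
  by (simp_all add: fg_of_Cons slet_def)

lemma spow_0 [simp]: "spow 0 = 0"
  by (simp add: spow_def)

lemma spow_plus_1: "spow (p + 1) = sg + spow p"
proof (cases "p \<ge> 0")
  case True
  then have "nat (p + 1) = Suc (nat p)" by simp
  with True show ?thesis by (simp add: spow_def fg_of_Cons')
next
  case False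
  then have n: "nat (- p) = Suc (nat (- (p + 1)))" by simp
  show ?thesis
  proof (cases "p = - 1")
    case True
    then show ?thesis by (simp add: spow_def fg_of_single One_nat_def)
  next
    case f: False
    show ?thesis using False f unfolding spow_def n by (simp add: fg_of_Cons' add.assoc[symmetric])
  qed
qed

lemma spow_minus_1: "spow (p - 1) = - sg + spow p"
  using spow_plus_1[of "p - 1"] by (simp add: add.assoc[symmetric])

lemma spow_commute: "spow p + sg = sg + spow p"
proof (induction p rule: int_induct[where k = 0])
  case (step1 i)
  then show ?case by (simp add: spow_plus_1 add.assoc)
next
  case (step2 i)
  have "spow (i - 1) + sg = - sg + (spow i + sg)" by (simp add: spow_minus_1 add.assoc)
  also have "\<dots> = spow i" unfolding step2.IH by (simp add: add.assoc[symmetric])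
  also have "\<dots> = sg + spow (i - 1)" using spow_plus_1[of "i - 1"] by simp
  finally show ?case .
qed simp

lemma ph_spow [simp]: "ph i (spow p) = spow p"
  by (induction p rule: int_induct[where k = 0]) (simp_all add: spow_plus_1 spow_minus_1)

primrec hw :: "hel \<Rightarrow> gen word" where
  "hw (HE p x) = wd (spow p + x)"

lemma wd_spow_plus:
  assumes "x \<in> L k"
  shows "wd (spow p + x) = wd (spow p) @ wd x"
proof (rule wd_plus_reduced)
  show "reduced (wd (spow p) @ wd x)"
  proof (cases "spow p = 0 \<or> x = 0")
    case False
    then have "last (wd (spow p)) \<in> set (wd (spow p))" "hd (wd x) \<in> set (wd x)" by auto
    then have "fst (last (wd (spow p))) = Gen_s" "fst (hd (wd x)) \<in> Gen_a ` {1..k}"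
      using assms by (auto simp: wd_spow L_def split: if_splits)
    then show ?thesis by (auto simp: reduced_append linv_def prod_eq_iff)
  qed auto
qed

lemma hw_HE: "x \<in> L k \<Longrightarrow> hw (HE p x) = wd (spow p) @ wd x"
  by (simp add: wd_spow_plus)

definition subst :: "(gen \<Rightarrow> gen fg) \<Rightarrow> gen word \<Rightarrow> gen word" where
  "subst f w = concat (map (\<lambda>l. wd (slet f l)) w)"

lemma fg_of_subst: "fg_of (subst f w) = ext f (fg_of w)"
  unfolding ext_fg_of by (induction w) (simp_all add: subst_def fg_of_append)

text \<open>Right multiplication of a normal form by one letter. The rule is z s = s \<phi>(z), with
  \<phi> applied to all of z, including the leading power of s, which it fixes.\<close>

definition nfstep :: "gen word \<Rightarrow> gen \<times> bool \<Rightarrow> gen word" where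
  "nfstep z l = (case fst l of
     Gen_a i \<Rightarrow> red (z @ [l])
   | Gen_s \<Rightarrow> red (l # subst (if snd l then phi_img else phi_inv_img) z))"

definition nfw :: "gen word \<Rightarrow> gen word" where
  "nfw w = foldl nfstep [] w"

lemma wd_cong: "fg_of w = x \<Longrightarrow> red w = wd x"
  by auto

lemma nfstep_hw: "nfstep (hw g) l = hw (g + slet hgen l)"
proof (cases g)
  case (HE p x)
  obtain a b where l: "l = (a, b)" by (cases l)
  show ?thesis
  proof (cases a)
    case (Gen_a i)
    then show ?thesis
      by (cases b; simp add: HE nfstep_def l slet_def hgen_def)
        (rule wd_cong, simp add: fg_of_append fg_of_single add.assoc diff_conv_add_uminus del: add_uminus_conv_diff)+
  next
    case Gen_s
    show ?thesis
    proof (cases b)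
      case True
      have "fg_of ((Gen_s, True) # subst phi_img (wd (spow p + x))) = sg + ph 1 (spow p + x)"
        by (simp only: fg_of_Cons' fg_of_subst fg_of_wd ph_1 ph1_def)
      then have "red ((Gen_s, True) # subst phi_img (wd (spow p + x))) = wd (spow (p + 1) + ph 1 x)"
        by (intro wd_cong) (simp add: spow_plus_1 add.assoc)
      then show ?thesis by (simp add: HE nfstep_def l slet_def hgen_def Gen_s True)
    next
      case False
      have "ph (- 1) y = ph1' y" for y using ph_minus_1[of 0 y] by simp
      then have "fg_of ((Gen_s, False) # subst phi_inv_img (wd (spow p + x))) = - sg + ph (- 1) (spow p + x)"
        by (simp only: fg_of_Cons' fg_of_subst fg_of_wd ph1'_def)
      then have "red ((Gen_s, False) # subst phi_inv_img (wd (spow p + x))) = wd (spow (p - 1) + ph (- 1) x)"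
        by (intro wd_cong) (simp add: spow_minus_1 add.assoc)
      then show ?thesis by (simp add: HE nfstep_def l slet_def hgen_def Gen_s False)
    qed
  qed
qed

lemma nfw_hw: "nfw w = hw (val w)"
proof (induction w rule: rev_induct)
  case Nil
  then show ?case by (simp add: nfw_def zero_hel_def)
next
  case (snoc l w)
  then show ?case by (simp add: nfw_def nfstep_hw val_Cons)
qed

lemma val_wd_L: "x \<in> L k \<Longrightarrow> val (wd x) = HE 0 x"
proof -
  assume x: "x \<in> L k"
  have "val w = HE 0 (fg_of w)" if "fst ` set w \<subseteq> Gen_a ` {1..k}" for w
    using that
  proof (induction w)
    case (Cons l w)
    then show ?case by (auto simp: val_Cons slet_def hgen_def fg_of_Cons)
  qed (simp add: zero_hel_def)
  from this[of "wd x"] show ?thesis using x by (simp add: L_def)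
qed

lemma val_spow: "val (wd (spow p)) = HE p 0"
proof (cases "p \<ge> 0")
  case True
  have "val (replicate n (Gen_s, True)) = HE (int n) 0" for n
    by (induction n) (simp_all add: val_Cons slet_def hgen_def zero_hel_def)
  then show ?thesis using True by (simp add: wd_spow)
next
  case False
  have "val (replicate n (Gen_s, False)) = HE (- int n) 0" for n
    by (induction n) (simp_all add: val_Cons slet_def hgen_def zero_hel_def)
  then show ?thesis using False by (simp add: wd_spow)
qed

lemma val_hw: "g \<in> HL k \<Longrightarrow> val (hw g) = g"
  by (cases g) (simp add: wd_spow_plus val_spow val_wd_L)

lemma wd_L_words: "x \<in> L m \<Longrightarrow> wd x \<in> words (H_gens m)"
  by (auto simp: L_def words_def H_gens_def)

lemma wd_spow_words: "wd (spow p) \<in> words (H_gens m)"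
  by (auto simp: wd_spow words_def H_gens_def)

lemma hw_words: "g \<in> HL m \<Longrightarrow> hw g \<in> words (H_gens m)"
  by (cases g) (simp add: wd_spow_plus wd_L_words wd_spow_words)

section \<open>The presentation defines the semidirect product\<close>

lemma H_rels_words: "H_rels m \<subseteq> words (H_gens m) \<times> words (H_gens m)"
proof -
  have "phi i \<in> words (H_gens m)" if "i \<in> {1..m}" for i
  proof (cases "i = 1")
    case False
    then have "i - 1 \<in> {1..m}" using that by auto
    with that False show ?thesis by (auto simp: phi_def H_gens_def)
  qed (use that in \<open>simp add: phi_def H_gens_def\<close>)
  then show ?thesis by (auto simp: H_rels_def H_gens_def)
qed

abbreviation pe :: "nat \<Rightarrow> gen word \<Rightarrow> gen word \<Rightarrow> bool" where
  "pe m \<equiv> pres_eq (H_gens m) (H_rels m)"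

lemma pe_join: "pe m u w \<Longrightarrow> pe m v w \<Longrightarrow> pe m u v"
  by (rule pres_eq.trans[OF _ pres_eq.sym])

lemma slet_hgen_cancel: "slet hgen (x, b) + slet hgen (x, \<not> b) = 0"
  using slet_linv[of hgen "(x, b)"] by (simp add: linv_def)

lemma val_phi: "1 \<le> i \<Longrightarrow> val (phi i) = HE 0 (phi_img (Gen_a i))"
  by (auto simp: phi_def val_Cons slet_def hgen_def zero_hel_def)

lemma pe_val: "pe m u v \<Longrightarrow> val u = val v"
proof (induction rule: pres_eq.induct)
  case (cancel u v x b)
  then show ?case by (simp add: val_Cons slet_hgen_cancel add.assoc[symmetric])
next
  case (rel u v l r)
  then obtain i where i: "1 \<le> i" "l = [(Gen_s, False), (Gen_a i, True), (Gen_s, True)]" "r = phi i"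
    by (auto simp: H_rels_def)
  have "val l = val r"
    unfolding i(2,3) val_phi[OF i(1)] by (simp add: val_Cons slet_def hgen_def zero_hel_def ph_1 ph1_def)
  then show ?case by simp
qed simp_all

lemmas pe_append = pres_eq_append[OF H_rels_words]

lemma pe_red: "w \<in> words (H_gens m) \<Longrightarrow> pe m w (red w)"
proof (induction w)
  case Nil
  then show ?case by (simp add: pres_eq.refl)
next
  case (Cons l w)
  then have l: "[l] \<in> words (H_gens m)" and w: "pe m w (red w)" by simp_all
  have 1: "pe m (l # w) (l # red w)" using pe_append[OF pres_eq.refl[OF l] w] by simp
  have "pe m (l # red w) (ccons l (red w))"
  proof (cases "red w \<noteq> [] \<and> hd (red w) = linv l")
    case True
    then obtain z where z: "red w = linv l # z" by (cases "red w") auto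
    have "z \<in> words (H_gens m)" using pres_eq_words(2)[OF H_rels_words w] z by simp
    then have "pe m ([] @ [(fst l, snd l), (fst l, \<not> snd l)] @ z) ([] @ z)"
      using Cons.prems by (intro pres_eq.cancel) simp_all
    then show ?thesis using True z by (simp add: ccons_def linv_def)
  next
    case False
    then show ?thesis using 1 pres_eq_words(2)[OF H_rels_words 1]
      by (auto simp: ccons_def intro: pres_eq.refl)
  qed
  with 1 show ?case by (simp add: red_Cons) (rule pres_eq.trans)
qed

lemma inv_word_pe: "w \<in> words (H_gens m) \<Longrightarrow> pe m (w @ inv_word w) []"
  using pres_eq_inv_word[of "inv_word w" "H_gens m" "H_rels m"] inv_word_words[of w] by simp

lemma pe_cancel_left:
  assumes "w \<in> words (H_gens m)" "u \<in> words (H_gens m)" "v \<in> words (H_gens m)" "pe m (w @ u) (w @ v)"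
  shows "pe m u v"
proof -
  have i: "pe m (inv_word w) (inv_word w)" using assms(1) by (intro pres_eq.refl inv_word_words)
  have e: "pe m (inv_word w @ w @ z) z" if "z \<in> words (H_gens m)" for z
    using pe_append[OF pres_eq_inv_word[OF assms(1)] pres_eq.refl[OF that]] by simp
  have "pe m (inv_word w @ w @ u) v" by (rule pres_eq.trans[OF pe_append[OF i assms(4)] e[OF assms(3)]])
  then show ?thesis by (rule pres_eq.trans[OF pres_eq.sym[OF e[OF assms(2)]]])
qed

lemma pe_cancel_right:
  assumes "w \<in> words (H_gens m)" "u \<in> words (H_gens m)" "v \<in> words (H_gens m)" "pe m (u @ w) (v @ w)"
  shows "pe m u v"
proof -
  have i: "pe m (inv_word w) (inv_word w)" using assms(1) by (intro pres_eq.refl inv_word_words)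
  have e: "pe m ((z @ w) @ inv_word w) z" if "z \<in> words (H_gens m)" for z
    using pe_append[OF pres_eq.refl[OF that] inv_word_pe[OF assms(1)]] by simp
  have "pe m ((u @ w) @ inv_word w) v" by (rule pres_eq.trans[OF pe_append[OF assms(4) i] e[OF assms(3)]])
  then show ?thesis by (rule pres_eq.trans[OF pres_eq.sym[OF e[OF assms(2)]]])
qed

lemma letter_s:
  assumes i: "1 \<le> i" "i \<le> m"
  shows "pe m ([(Gen_a i, b)] @ [(Gen_s, True)]) ([(Gen_s, True)] @ wd (slet phi_img (Gen_a i, b)))"
proof -
  let ?a = "[(Gen_a i, True)]" and ?s = "[(Gen_s, True)]"
  have W: "?a \<in> words (H_gens m)" "?s \<in> words (H_gens m)" "inv_word ?s \<in> words (H_gens m)"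
    using i by (auto simp: H_gens_def linv_def)
  have ph: "phi i = wd (phi_img (Gen_a i))"
    using i by (auto simp: phi_def wd_plus reduced_Cons linv_def)
  have "(inv_word ?s @ ?a @ ?s, phi i) \<in> H_rels m" using i by (auto simp: H_rels_def linv_def)
  then have r: "pe m (inv_word ?s @ ?a @ ?s) (phi i)"
    using pres_eq.rel[of "[]" "H_gens m" "[]"] by simp
  have phW: "phi i \<in> words (H_gens m)" using pres_eq_words(2)[OF H_rels_words r] .
  have "pe m (inv_word ?s @ (?s @ phi i)) (phi i)"
    using pe_append[OF pres_eq_inv_word[OF W(2)] pres_eq.refl[OF phW]] by simp
  then have q: "pe m (inv_word ?s @ (?a @ ?s)) (inv_word ?s @ (?s @ phi i))"
    by (rule pe_join[OF r])
  have p: "pe m (?a @ ?s) (?s @ phi i)"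
    by (rule pe_cancel_left[OF W(3) _ _ q]) (use W phW in simp_all)
  show ?thesis
  proof (cases b)
    case True
    then show ?thesis using p by (simp add: slet_def ph)
  next
    case False
    let ?ia = "[(Gen_a i, False)]"
    have ia: "?ia \<in> words (H_gens m)" "inv_word (phi i) \<in> words (H_gens m)"
      using W inv_word_words[OF phW] by auto
    have "pe m (?a @ (?ia @ ?s)) ?s"
      using inv_word_pe[OF W(1)] pe_append[OF _ pres_eq.refl[OF W(2)], of "?a @ ?ia" "[]"]
      by (simp add: linv_def)
    moreover have "pe m (?a @ (?s @ inv_word (phi i))) ?s"
    proof -
      have "pe m (?a @ (?s @ inv_word (phi i))) ((?s @ phi i) @ inv_word (phi i))"
        using pe_append[OF p pres_eq.refl[OF ia(2)]] by simp
      moreover have "pe m ((?s @ phi i) @ inv_word (phi i)) ?s"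
        using pe_append[OF pres_eq.refl[OF W(2)] inv_word_pe[OF phW]] by simp
      ultimately show ?thesis by (rule pres_eq.trans)
    qed
    ultimately have q': "pe m (?a @ (?ia @ ?s)) (?a @ (?s @ inv_word (phi i)))"
      by (rule pe_join)
    have "pe m (?ia @ ?s) (?s @ inv_word (phi i))"
      by (rule pe_cancel_left[OF W(1) _ _ q']) (use W ia in simp_all)
    then show ?thesis using False by (simp add: slet_def wd_uminus ph)
  qed
qed

lemma wd_s:
  assumes x: "x \<in> L m"
  shows "pe m (wd x @ [(Gen_s, True)]) ([(Gen_s, True)] @ wd (ph 1 x))"
proof -
  let ?s = "[(Gen_s, True)]"
  have sW: "?s \<in> words (H_gens m)" by (simp add: H_gens_def)
  have "pe m (w @ ?s) (?s @ subst phi_img w)" if "fst ` set w \<subseteq> Gen_a ` {1..m}" for w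
    using that
  proof (induction w)
    case Nil
    then show ?case using sW by (simp add: subst_def pres_eq.refl)
  next
    case (Cons l w)
    then obtain i where i: "1 \<le> i" "i \<le> m" "l = (Gen_a i, snd l)" by (cases l) auto
    have lW: "[l] \<in> words (H_gens m)" using i by (cases l) (simp add: H_gens_def)
    have IH: "pe m (w @ ?s) (?s @ subst phi_img w)" using Cons by simp
    have sW': "subst phi_img w \<in> words (H_gens m)"
      using pres_eq_words(2)[OF H_rels_words IH] by simp
    have 1: "pe m ([l] @ (w @ ?s)) ([l] @ (?s @ subst phi_img w))"
      by (rule pe_append[OF pres_eq.refl[OF lW] IH])
    have 2: "pe m (([l] @ ?s) @ subst phi_img w) ((?s @ wd (slet phi_img l)) @ subst phi_img w)"
      using letter_s[OF i(1,2), of "snd l"] i(3) by (intro pe_append[OF _ pres_eq.refl[OF sW']]) simp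
    from pres_eq.trans[OF 1 2[unfolded append_assoc]]
    show ?case by (simp add: subst_def)
  qed
  then have 1: "pe m (wd x @ ?s) (?s @ subst phi_img (wd x))" using x by (simp add: L_def)
  have "subst phi_img (wd x) \<in> words (H_gens m)" using pres_eq_words(2)[OF H_rels_words 1] by simp
  then have "pe m (?s @ subst phi_img (wd x)) (?s @ red (subst phi_img (wd x)))"
    using sW by (intro pe_append pres_eq.refl pe_red)
  moreover have "red (subst phi_img (wd x)) = wd (ph 1 x)"
    by (rule wd_cong) (simp add: fg_of_subst ph_1 ph1_def)
  ultimately show ?thesis using pres_eq.trans[OF 1] by simp
qed

text \<open>Follows from \<open>wd_s\<close> for \<phi>^-1(x) by multiplying with s on the right and
  cancelling.\<close>

lemma wd_s_inverse:
  assumes x: "x \<in> L m"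
  shows "pe m (wd x @ [(Gen_s, False)]) ([(Gen_s, False)] @ wd (ph (- 1) x))"
proof -
  let ?s = "[(Gen_s, True)]" and ?t = "[(Gen_s, False)]" and ?y = "wd (ph (- 1) x)"
  have W: "?s \<in> words (H_gens m)" "?t \<in> words (H_gens m)" "wd x \<in> words (H_gens m)" "?y \<in> words (H_gens m)"
    using wd_L_words[OF x] wd_L_words[of "ph (- 1) x" m] x by (auto simp: H_gens_def)
  have st: "pe m (?s @ ?t) []" "pe m (?t @ ?s) []"
    using inv_word_pe[OF W(1)] inv_word_pe[OF W(2)] by (simp_all add: linv_def)
  have 1: "pe m (?y @ ?s) (?s @ wd x)" using wd_s[of "ph (- 1) x" m] x ph_cancel(2)[of 1 x] by simp
  show ?thesis
  proof (rule pe_cancel_right[OF W(1)])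
    show "pe m ((wd x @ ?t) @ ?s) ((?t @ ?y) @ ?s)"
    proof (rule pres_eq.trans)
      show "pe m ((wd x @ ?t) @ ?s) (wd x)"
        using pe_append[OF pres_eq.refl[OF W(3)] st(2)] by simp
      have "pe m (wd x) (?t @ ?s @ wd x)"
        using pres_eq.sym[OF pe_append[OF st(2) pres_eq.refl[OF W(3)]]] by simp
      moreover have "pe m (?t @ ?s @ wd x) (?t @ ?y @ ?s)"
        by (rule pe_append[OF pres_eq.refl[OF W(2)] pres_eq.sym[OF 1]])
      ultimately show "pe m (wd x) ((?t @ ?y) @ ?s)" unfolding append_assoc by (rule pres_eq.trans)
    qed
  qed (use W in simp_all)
qed

text \<open>The defining relations suffice to reach the normal form letter by letter. Together with
  \<open>pe_val\<close> this reduces the word problem to comparing normal forms.\<close>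

lemma pe_nfw: "w \<in> words (H_gens m) \<Longrightarrow> pe m w (hw (val w))"
proof (induction w rule: rev_induct)
  case Nil
  then show ?case by (simp add: zero_hel_def pres_eq.refl)
next
  case (snoc l w)
  then have lW: "[l] \<in> words (H_gens m)" and w: "w \<in> words (H_gens m)" by simp_all
  obtain p x where v: "val w = HE p x" by (cases "val w")
  have x: "x \<in> L m" using val_HL[OF w] by (simp add: v)
  have 1: "pe m (w @ [l]) (hw (val w) @ [l])"
    using snoc w by (intro pe_append[OF _ pres_eq.refl[OF lW]]) simp
  obtain a b where l: "l = (a, b)" by (cases l)
  have "pe m (hw (val w) @ [l]) (hw (val w + slet hgen l))"
  proof (cases a)
    case (Gen_a i)
    then have "red (hw (val w) @ [l]) = hw (val w + slet hgen l)"
      unfolding nfstep_hw[symmetric] by (simp add: nfstep_def l)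
    then show ?thesis using pe_red[OF pres_eq_words(2)[OF H_rels_words 1]] by simp
  next
    case Gen_s
    define y where "y = ph (if b then 1 else - 1) x"
    have "pe m (wd x @ [l]) ([l] @ wd y)"
      using wd_s[OF x] wd_s_inverse[OF x] by (simp add: l Gen_s y_def)
    then have 2: "pe m (wd (spow p) @ (wd x @ [l])) (wd (spow p) @ ([l] @ wd y))"
      by (rule pe_append[OF pres_eq.refl[OF wd_spow_words]])
    have "red (wd (spow p) @ [l] @ wd y) = hw (val w + slet hgen l)"
    proof (cases b)
      case True
      then show ?thesis
        by (simp add: l Gen_s v slet_def hgen_def y_def, intro wd_cong)
          (simp add: fg_of_append fg_of_Cons' spow_plus_1 spow_commute[symmetric] add.assoc)
    next
      case False
      have "spow p + - sg = - sg + spow p"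
        using spow_commute[of p] by (metis add.assoc add.left_inverse add.right_inverse add_0 add_0_right)
      then have "spow p + (- sg + z) = - sg + (spow p + z)" for z by (metis add.assoc)
      with False show ?thesis
        by (simp add: l Gen_s v slet_def hgen_def y_def, intro wd_cong)
          (simp add: fg_of_append fg_of_Cons' spow_minus_1 add.assoc)
    qed
    moreover have "hw (val w) @ [l] = wd (spow p) @ (wd x @ [l])" using wd_spow_plus[OF x] by (simp add: v)
    ultimately show ?thesis
      using pres_eq.trans[OF 2 pe_red[OF pres_eq_words(2)[OF H_rels_words 2]]] by simp
  qed
  with 1 show ?case by (simp add: val_Cons) (rule pres_eq.trans)
qed

theorem pe_iff_val:
  assumes "u \<in> words (H_gens m)" "v \<in> words (H_gens m)"
  shows "pe m u v \<longleftrightarrow> val u = val v"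
proof
  assume "val u = val v"
  then show "pe m u v" using pe_join[OF pe_nfw[OF assms(1)]] pe_nfw[OF assms(2)] by simp
qed (rule pe_val)

lemma H_elem_mult:
  "u \<in> words (H_gens m) \<Longrightarrow> v \<in> words (H_gens m) \<Longrightarrow>
    H_elem m u \<otimes>\<^bsub>H m\<^esub> H_elem m v = H_elem m (u @ v)"
  unfolding H_def H_elem_def by (rule pres_class_mult[OF H_rels_words])

lemma H_elem_mult_eq_iff:
  assumes "u \<in> words (H_gens m)" "v \<in> words (H_gens m)" "w \<in> words (H_gens m)"
  shows "H_elem m u \<otimes>\<^bsub>H m\<^esub> H_elem m w = H_elem m w \<otimes>\<^bsub>H m\<^esub> H_elem m v \<longleftrightarrow>
    val u + val w = val w + val v"
  using assms pe_iff_val[of "u @ w" m "w @ v"] pres_class_eq_iff[of "u @ w" "H_gens m" "H_rels m" "w @ v"]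
  by (simp add: H_elem_mult) (simp add: H_elem_def)

lemma conjugate_iff_val:
  assumes "u \<in> words (H_gens m)" "v \<in> words (H_gens m)"
  shows "conjugate (H m) (H_elem m u) (H_elem m v) \<longleftrightarrow> (\<exists>g\<in>HL m. val u + g = g + val v)"
proof -
  interpret G: group "H m" by (rule group_H)
  have c: "carrier (H m) = H_elem m ` words (H_gens m)"
    by (auto simp: H_def presented_group_def H_elem_def)
  have "conjugate (H m) (H_elem m u) (H_elem m v) \<longleftrightarrow>
      (\<exists>w\<in>words (H_gens m). H_elem m u \<otimes>\<^bsub>H m\<^esub> H_elem m w = H_elem m w \<otimes>\<^bsub>H m\<^esub> H_elem m v)"
  proof -
    have "inv\<^bsub>H m\<^esub> g \<otimes>\<^bsub>H m\<^esub> a \<otimes>\<^bsub>H m\<^esub> g = b \<longleftrightarrow> a \<otimes>\<^bsub>H m\<^esub> g = g \<otimes>\<^bsub>H m\<^esub> b"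
      if "g \<in> carrier (H m)" "a \<in> carrier (H m)" "b \<in> carrier (H m)" for a b g
      using that G.inv_solve_left[of "b" g "a \<otimes>\<^bsub>H m\<^esub> g"] by (metis G.m_assoc G.inv_closed G.m_closed)
    then show ?thesis unfolding conjugate_def using assms by (auto simp: c)
  qed
  also have "\<dots> \<longleftrightarrow> (\<exists>w\<in>words (H_gens m). val u + val w = val w + val v)"
    using assms by (simp add: H_elem_mult_eq_iff)
  also have "\<dots> \<longleftrightarrow> (\<exists>g\<in>HL m. val u + g = g + val v)"
    using val_HL val_hw hw_words by metis
  finally show ?thesis .
qed

section \<open>Functions computable in polynomial time\<close>

lemma poly_mono_nat: "n \<le> m \<Longrightarrow> poly (p :: nat poly) n \<le> poly p m"
  by (induction p) (auto intro: add_mono mult_mono)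

text \<open>Only boundedness by a polynomial is recorded, so time functions can be assembled from
  sums, products and compositions without being written out as polynomials.\<close>

definition pb :: "(nat \<Rightarrow> nat) \<Rightarrow> bool" where
  "pb f \<longleftrightarrow> (\<exists>p. \<forall>n. f n \<le> poly p n)"

lemma pb_poly [simp]: "pb (poly p)"
  by (auto simp: pb_def)

lemma pb_const [simp]: "pb (\<lambda>_. c)"
  unfolding pb_def by (rule exI[of _ "[:c:]"]) simp

lemma pb_id [simp]: "pb (\<lambda>n. n)"
  unfolding pb_def by (rule exI[of _ "[:0, 1:]"]) simp

lemma pb_add [simp]: "pb f \<Longrightarrow> pb g \<Longrightarrow> pb (\<lambda>n. f n + g n)"
  unfolding pb_def by (metis add_mono poly_add)

lemma pb_mult [simp]: "pb f \<Longrightarrow> pb g \<Longrightarrow> pb (\<lambda>n. f n * g n)"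
  unfolding pb_def by (metis mult_le_mono poly_mult)

lemma pb_Suc [simp]: "pb f \<Longrightarrow> pb (\<lambda>n. Suc (f n))"
  using pb_add[of f "\<lambda>_. Suc 0"] by simp

lemma pb_poly_comp [simp]: "pb f \<Longrightarrow> pb (\<lambda>n. poly p (f n))"
proof -
  assume "pb f"
  then obtain q where "\<And>n. f n \<le> poly q n" by (auto simp: pb_def)
  then have "poly p (f n) \<le> poly (pcompose p q) n" for n
    unfolding poly_pcompose by (rule poly_mono_nat)
  then show ?thesis unfolding pb_def by blast
qed

lemma pb_sum [simp]: "(\<And>i. i \<in> I \<Longrightarrow> pb (f i)) \<Longrightarrow> pb (\<lambda>n. \<Sum>i\<in>I. f i n)"
  by (induction I rule: infinite_finite_induct) auto

section \<open>Renaming of stacks, and execution with an upper bound on time\<close>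

primrec ren :: "(nat \<Rightarrow> nat) \<Rightarrow> 'a prog \<Rightarrow> 'a prog" where
  "ren r Skip = Skip"
| "ren r (Push x a) = Push (r x) a"
| "ren r (Pop x) = Pop (r x)"
| "ren r (Seq c d) = Seq (ren r c) (ren r d)"
| "ren r (IfTop x a c d) = IfTop (r x) a (ren r c) (ren r d)"
| "ren r (WhileNonempty x c) = WhileNonempty (r x) (ren r c)"

text \<open>Stacks outside the range of the renaming are untouched; this lets a program run as a
  subroutine beside the data of its caller.\<close>

lemma exec_ren:
  assumes "exec c s t s'" and "inj r" and "\<And>i. q (r i) = s i"
  shows "\<exists>q'. exec (ren r c) q t q' \<and> (\<forall>i. q' (r i) = s' i) \<and> (\<forall>j. j \<notin> range r \<longrightarrow> q' j = q j)"
  using assms(1,3)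
proof (induction arbitrary: q rule: exec.induct)
  case (Skip s)
  then show ?case by (auto intro: exec.Skip)
next
  case (Push x a s)
  show ?case
  proof (intro exI conjI)
    show "exec (ren r (Defs.Push x a)) q 1 (q(r x := a # q (r x)))"
      unfolding ren.simps by (rule exec.Push)
  qed (use Push assms(2) in \<open>auto simp: inj_eq\<close>)
next
  case (Pop x s)
  show ?case
  proof (intro exI conjI)
    show "exec (ren r (Defs.Pop x)) q 1 (q(r x := tl (q (r x))))"
      unfolding ren.simps by (rule exec.Pop)
  qed (use Pop assms(2) in \<open>auto simp: inj_eq\<close>)
next
  case (Seq c s t s' d t' s'')
  from Seq.IH(1)[OF Seq.prems] obtain q1 where
    q1: "exec (ren r c) q t q1" "\<forall>i. q1 (r i) = s' i" "\<forall>j. j \<notin> range r \<longrightarrow> q1 j = q j" by blast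
  from Seq.IH(2)[of q1] q1 obtain q2 where
    "exec (ren r d) q1 t' q2" "\<forall>i. q2 (r i) = s'' i" "\<forall>j. j \<notin> range r \<longrightarrow> q2 j = q1 j" by blast
  with q1 show ?case using exec.Seq[OF q1(1)] by (intro exI[of _ q2]) simp
next
  case (IfTrue s x a c t s' d)
  from IfTrue.IH[OF IfTrue.prems] obtain q1 where
    q1: "exec (ren r c) q t q1" "\<forall>i. q1 (r i) = s' i" "\<forall>j. j \<notin> range r \<longrightarrow> q1 j = q j" by blast
  then show ?case using exec.IfTrue[of q "r x" a, OF _ q1(1)] IfTrue by (intro exI[of _ q1]) simp
next
  case (IfFalse s x a d t s' c)
  from IfFalse.IH[OF IfFalse.prems] obtain q1 where
    q1: "exec (ren r d) q t q1" "\<forall>i. q1 (r i) = s' i" "\<forall>j. j \<notin> range r \<longrightarrow> q1 j = q j" by blast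
  then show ?case using exec.IfFalse[of q "r x" a, OF _ q1(1)] IfFalse by (intro exI[of _ q1]) simp
next
  case (WhileFalse s x c)
  then show ?case using exec.WhileFalse[of q "r x"] by (intro exI[of _ q]) simp
next
  case (WhileTrue s x c t s' t' s'')
  from WhileTrue.IH(1)[OF WhileTrue.prems] obtain q1 where
    q1: "exec (ren r c) q t q1" "\<forall>i. q1 (r i) = s' i" "\<forall>j. j \<notin> range r \<longrightarrow> q1 j = q j" by blast
  from WhileTrue.IH(2)[of q1] q1 obtain q2 where
    q2: "exec (ren r (WhileNonempty x c)) q1 t' q2" "\<forall>i. q2 (r i) = s'' i" "\<forall>j. j \<notin> range r \<longrightarrow> q2 j = q1 j"
    by blast
  have "q (r x) \<noteq> []" using WhileTrue by simp
  from exec.WhileTrue[OF this q1(1)] q1 q2 show ?case by (intro exI[of _ q2]) simp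
qed

definition run :: "'a prog \<Rightarrow> 'a store \<Rightarrow> nat \<Rightarrow> 'a store \<Rightarrow> bool" where
  "run c s b s' \<longleftrightarrow> (\<exists>t\<le>b. exec c s t s')"

lemma runI: "exec c s t s' \<Longrightarrow> t \<le> b \<Longrightarrow> run c s b s'"
  by (auto simp: run_def)

lemma run_mono: "run c s b s' \<Longrightarrow> b \<le> b' \<Longrightarrow> run c s b' s'"
  unfolding run_def by (meson le_trans)

lemma run_Skip: "run Skip s 1 s"
  by (rule runI[OF exec.Skip order_refl])

lemma run_Push: "run (Push x a) s 1 (s(x := a # s x))"
  by (rule runI[OF exec.Push order_refl])

lemma run_Pop: "run (Pop x) s 1 (s(x := tl (s x)))"
  by (rule runI[OF exec.Pop order_refl])

lemma run_Seq: "run c s b s' \<Longrightarrow> run d s' b' s'' \<Longrightarrow> run (Seq c d) s (b + b') s''"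
  by (auto simp: run_def[of c] run_def[of d] intro!: runI exec.Seq add_mono)

lemma run_IfTrue: "s x \<noteq> [] \<and> hd (s x) = a \<Longrightarrow> run c s b s' \<Longrightarrow> run (IfTop x a c d) s (1 + b) s'"
  by (auto simp: run_def[of c] intro!: runI exec.IfTrue add_mono)

lemma run_IfFalse: "\<not> (s x \<noteq> [] \<and> hd (s x) = a) \<Longrightarrow> run d s b s' \<Longrightarrow> run (IfTop x a c d) s (1 + b) s'"
  by (simp add: run_def[of d]) (auto intro!: runI exec.IfFalse add_mono)

text \<open>The family \<open>st\<close> lists the stores after n rounds, each of which consumes one
  letter of the controlling stack. A round costs \<open>b\<close> plus one test, and the final
  failing test costs 1.\<close>

lemma run_While:
  assumes "\<And>n. n \<le> length w \<Longrightarrow> st n i = drop n w"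
    and "\<And>n. n < length w \<Longrightarrow> run c (st n) b (st (Suc n))"
  shows "run (WhileNonempty i c) (st 0) ((1 + b) * length w + 1) (st (length w))"
proof -
  have "run (WhileNonempty i c) (st (length w - k)) ((1 + b) * k + 1) (st (length w))" if "k \<le> length w" for k
    using that
  proof (induction k)
    case 0
    then show ?case using assms(1)[of "length w"] exec.WhileFalse[of "st (length w)" i c]
      by (auto simp: run_def)
  next
    case (Suc k)
    let ?n = "length w - Suc k"
    have n: "?n < length w" "Suc ?n = length w - k" using Suc.prems by auto
    obtain t t' where t: "t \<le> b" "exec c (st ?n) t (st (length w - k))"
      "t' \<le> (1 + b) * k + 1" "exec (WhileNonempty i c) (st (length w - k)) t' (st (length w))"
      using assms(2)[OF n(1)] Suc n(2) by (auto simp: run_def)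
    have "st ?n i \<noteq> []" using assms(1)[of ?n] n(1) by simp
    from exec.WhileTrue[OF this t(2,4)] t(1,3) show ?case
      unfolding run_def by (intro exI[of _ "1 + t + t'"]) (simp add: algebra_simps)
  qed
  from this[of "length w"] show ?thesis by simp
qed

lemma run_ren:
  assumes "run c s b (s(n := w))" and "inj r" and "\<And>i. q (r i) = s i"
  shows "run (ren r c) q b (q(r n := w))"
proof -
  from assms(1) obtain t where t: "t \<le> b" "exec c s t (s(n := w))" by (auto simp: run_def)
  from exec_ren[OF t(2) assms(2,3)] obtain q' where
    q': "exec (ren r c) q t q'" "\<forall>i. q' (r i) = (s(n := w)) i" "\<forall>j. j \<notin> range r \<longrightarrow> q' j = q j"
    by blast
  have "q' = q(r n := w)"
  proof
    fix j
    show "q' j = (q(r n := w)) j"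
    proof (cases "j \<in> range r")
      case True
      then show ?thesis using q'(2) assms(2,3) by (auto simp: inj_eq)
    next
      case False
      then show ?thesis using q'(3) by auto
    qed
  qed
  with q'(1) t(1) show ?thesis by (auto simp: run_def)
qed

definition clear :: "nat \<Rightarrow> 'a prog" where
  "clear i = WhileNonempty i (Pop i)"

lemma run_clear:
  assumes "length (s i) \<le> l"
  shows "run (clear i) s (2 * l + 1) (s(i := []))"
proof -
  have *: "run (Pop i) (s(i := drop n (s i))) 1 (s(i := drop (Suc n) (s i)))" for n
    using run_Pop[of i "s(i := drop n (s i))"] by (simp add: drop_Suc tl_drop)
  have "run (clear i) s (2 * length (s i) + 1) (s(i := []))"
    using run_While[of "s i" "\<lambda>n. s(i := drop n (s i))" i "Pop i" 1, OF _ *]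
    by (simp add: clear_def mult.commute)
  then show ?thesis by (rule run_mono) (use assms in simp)
qed

locale symbols =
  fixes S :: "'a set"
  assumes finite_S: "finite S"
begin

declare One_nat_def [simp del]

definition syms :: "'a list" where
  "syms = (SOME xs. set xs = S)"

lemma set_syms: "set syms = S"
  unfolding syms_def using finite_list[OF finite_S] by (rule someI_ex)

text \<open>A program compares the top of a stack with one fixed symbol only, so a case distinction
  on the top symbol is a chain of tests over the finite alphabet, of constant cost.\<close>

definition dispatch :: "nat \<Rightarrow> ('a \<Rightarrow> 'a prog) \<Rightarrow> 'a prog \<Rightarrow> 'a prog" where
  "dispatch i f d = foldr (\<lambda>a c. IfTop i a (f a) c) syms d"

lemma run_dispatch:
  assumes "s i = a # w" "a \<in> S" "run (f a) s b s'"
  shows "run (dispatch i f d) s (length syms + b) s'"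
proof -
  have "run (foldr (\<lambda>a c. IfTop i a (f a) c) xs d) s (length xs + b) s'" if "a \<in> set xs" for xs
    using that
  proof (induction xs)
    case (Cons x xs)
    show ?case
    proof (cases "x = a")
      case True
      then have "run (IfTop i a (f a) (foldr (\<lambda>a c. IfTop i a (f a) c) xs d)) s (1 + b) s'"
        using assms by (intro run_IfTrue) auto
      then show ?thesis using True by (auto intro: run_mono)
    next
      case False
      then have "run (IfTop i x (f x) (foldr (\<lambda>a c. IfTop i a (f a) c) xs d)) s (1 + (length xs + b)) s'"
        using assms Cons by (intro run_IfFalse) auto
      then show ?thesis by (simp add: One_nat_def)
    qed
  qed simp
  then show ?thesis using assms(2) by (simp add: dispatch_def set_syms)
qed

lemma run_dispatch_Nil:
  assumes "s i = []" "run d s b s'"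
  shows "run (dispatch i f d) s (length syms + b) s'"
proof -
  have "run (foldr (\<lambda>a c. IfTop i a (f a) c) xs d) s (length xs + b) s'" for xs
  proof (induction xs)
    case (Cons x xs)
    have "run (IfTop i x (f x) (foldr (\<lambda>a c. IfTop i a (f a) c) xs d)) s (1 + (length xs + b)) s'"
      using assms Cons by (intro run_IfFalse) auto
    then show ?case by (simp add: One_nat_def)
  qed (use assms in simp)
  then show ?thesis by (simp add: dispatch_def)
qed

definition for_each :: "nat \<Rightarrow> ('a \<Rightarrow> 'a prog) \<Rightarrow> 'a prog" where
  "for_each i f = WhileNonempty i (dispatch i (\<lambda>a. Seq (Pop i) (f a)) Skip)"

lemma run_for_each:
  assumes "w \<in> lists S" and st: "\<And>n. st n i = drop n w" and "length w \<le> l"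
    and "\<And>n. n < length w \<Longrightarrow> run (f (w ! n)) ((st n)(i := drop (Suc n) w)) b (st (Suc n))"
  shows "run (for_each i f) (st 0) ((length syms + b + 2) * l + 1) (st (length w))"
proof -
  have "run (dispatch i (\<lambda>a. Seq (Pop i) (f a)) Skip) (st n) (length syms + (1 + b)) (st (Suc n))"
    if n: "n < length w" for n
  proof (rule run_dispatch)
    show "st n i = w ! n # drop (Suc n) w" using n by (simp add: st Cons_nth_drop_Suc)
    show "w ! n \<in> S" using assms(1) n by (auto simp: in_lists_conv_set)
    show "run (Seq (Pop i) (f (w ! n))) (st n) (1 + b) (st (Suc n))"
      using run_Seq[OF run_Pop[of i "st n"]] assms(4)[OF n] by (simp add: st tl_drop drop_Suc)
  qed
  from run_While[of w st i, OF st this]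
  have "run (for_each i f) (st 0) ((1 + (length syms + (1 + b))) * length w + 1) (st (length w))"
    by (simp only: for_each_def)
  moreover have "(1 + (length syms + (1 + b))) * length w \<le> (length syms + b + 2) * l"
    using assms(3) by (intro mult_le_mono) simp_all
  ultimately show ?thesis by (auto intro: run_mono)
qed

definition mv_time :: "nat \<Rightarrow> nat" where
  "mv_time l = 2 * ((length syms + 4) * l + 1)"

lemma pb_mv_time [simp]: "pb f \<Longrightarrow> pb (\<lambda>n. mv_time (f n))"
  unfolding mv_time_def by simp

definition rmove :: "nat \<Rightarrow> nat \<Rightarrow> 'a prog" where
  "rmove i j = for_each i (\<lambda>a. Push j a)"

lemma take_Suc_rev: "n < length w \<Longrightarrow> rev (take (Suc n) w) = w ! n # rev (take n w)"
  by (simp add: take_Suc_conv_app_nth)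

lemma run_rmove:
  assumes "i \<noteq> j" "s i \<in> lists S" "length (s i) \<le> l"
  shows "run (rmove i j) s ((length syms + 4) * l + 1) (s(i := [], j := rev (s i) @ s j))"
proof -
  define st where "st n = s(i := drop n (s i), j := rev (take n (s i)) @ s j)" for n
  have "run (rmove i j) (st 0) ((length syms + 1 + 2) * l + 1) (st (length (s i)))"
    unfolding rmove_def
  proof (rule run_for_each[OF assms(2) _ assms(3)])
    fix n assume n: "n < length (s i)"
    let ?s = "(st n)(i := drop (Suc n) (s i))"
    have "st (Suc n) = ?s(j := s i ! n # ?s j)"
      using assms n by (auto simp: st_def take_Suc_rev fun_eq_iff)
    then show "run (Push j (s i ! n)) ?s 1 (st (Suc n))" by (simp only: run_Push)
  qed (use assms in \<open>simp add: st_def\<close>)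
  moreover have "st 0 = s" "st (length (s i)) = s(i := [], j := rev (s i) @ s j)" by (auto simp: st_def)
  ultimately show ?thesis by (auto elim!: run_mono simp: algebra_simps)
qed

definition rmove2 :: "nat \<Rightarrow> nat \<Rightarrow> nat \<Rightarrow> 'a prog" where
  "rmove2 i j k = for_each i (\<lambda>a. Seq (Push j a) (Push k a))"

lemma run_rmove2:
  assumes "i \<noteq> j" "i \<noteq> k" "j \<noteq> k" "s i \<in> lists S" "length (s i) \<le> l"
  shows "run (rmove2 i j k) s ((length syms + 4) * l + 1)
    (s(i := [], j := rev (s i) @ s j, k := rev (s i) @ s k))"
proof -
  define st where
    "st n = s(i := drop n (s i), j := rev (take n (s i)) @ s j, k := rev (take n (s i)) @ s k)" for n
  have "run (rmove2 i j k) (st 0) ((length syms + (1 + 1) + 2) * l + 1) (st (length (s i)))"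
    unfolding rmove2_def
  proof (rule run_for_each[OF assms(4) _ assms(5)])
    fix n assume n: "n < length (s i)"
    let ?s = "(st n)(i := drop (Suc n) (s i))"
    let ?s' = "?s(j := s i ! n # ?s j)"
    have "st (Suc n) = ?s'(k := s i ! n # ?s' k)"
      using assms n by (auto simp: st_def take_Suc_rev fun_eq_iff)
    then show "run (Seq (Push j (s i ! n)) (Push k (s i ! n))) ?s (1 + 1) (st (Suc n))"
      by (intro run_Seq[of _ _ _ ?s']) (simp_all only: run_Push)
  qed (use assms in \<open>simp add: st_def\<close>)
  moreover have "st 0 = s" "st (length (s i)) = s(i := [], j := rev (s i) @ s j, k := rev (s i) @ s k)"
    by (auto simp: st_def)
  ultimately show ?thesis by (auto elim!: run_mono simp: algebra_simps)
qed

text \<open>Popping from one stack and pushing to another reverses the word, hence the detour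
  through an empty third stack.\<close>

definition mv :: "nat \<Rightarrow> nat \<Rightarrow> nat \<Rightarrow> 'a prog" where
  "mv i j k = Seq (rmove i k) (rmove k j)"

lemma run_mv:
  assumes "i \<noteq> j" "i \<noteq> k" "j \<noteq> k" "s i \<in> lists S" "s j = []" "s k = []" "length (s i) \<le> l"
  shows "run (mv i j k) s (mv_time l) (s(i := [], j := s i))"
proof -
  let ?s = "s(i := [], k := rev (s i) @ s k)"
  have "?s(k := [], j := rev (?s k) @ ?s j) = s(i := [], j := s i)" using assms by (auto simp: fun_eq_iff)
  moreover have "?s k \<in> lists S" "length (?s k) \<le> l" using assms by auto
  ultimately show ?thesis
    unfolding mv_def mv_time_def mult_2 using run_Seq[OF run_rmove[of i k s] run_rmove[of k j ?s]] assms by simp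
qed

definition cp :: "nat \<Rightarrow> nat \<Rightarrow> nat \<Rightarrow> 'a prog" where
  "cp i j k = Seq (rmove i k) (rmove2 k i j)"

lemma run_cp:
  assumes "i \<noteq> j" "i \<noteq> k" "j \<noteq> k" "s i \<in> lists S" "s j = []" "s k = []" "length (s i) \<le> l"
  shows "run (cp i j k) s (mv_time l) (s(j := s i))"
proof -
  let ?s = "s(i := [], k := rev (s i) @ s k)"
  have "?s(k := [], i := rev (?s k) @ ?s i, j := rev (?s k) @ ?s j) = s(j := s i)"
    using assms by (auto simp: fun_eq_iff)
  moreover have "?s k \<in> lists S" "length (?s k) \<le> l" using assms by auto
  ultimately show ?thesis
    unfolding cp_def mv_time_def mult_2 using run_Seq[OF run_rmove[of i k s] run_rmove2[of k i j ?s]] assms by simp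
qed

definition valid :: "nat \<Rightarrow> 'a store \<Rightarrow> bool" where
  "valid n e \<longleftrightarrow> (\<forall>i. e i \<in> lists S) \<and> (\<forall>i\<ge>n. e i = [])"

definition esize :: "nat \<Rightarrow> 'a store \<Rightarrow> nat" where
  "esize n e = (\<Sum>i<n. length (e i))"

text \<open>\<open>FP n F\<close>: the function \<open>F\<close> of the contents of the stacks \<open>0, \<dots>, n - 1\<close> is computed in
  polynomial time by a program which writes the value to stack \<open>n\<close> and leaves all other stacks
  as they were; the stacks from \<open>n\<close> on are empty in the beginning.\<close>

definition FP :: "nat \<Rightarrow> ('a store \<Rightarrow> 'a list) \<Rightarrow> bool" where
  "FP n F \<longleftrightarrow> (\<exists>c b. pb b \<and> (\<forall>e. valid n e \<longrightarrow>
     F e \<in> lists S \<and> length (F e) \<le> b (esize n e) \<and> run c e (b (esize n e)) (e(n := F e))))"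

lemma FPI:
  assumes "pb b" "pb b'"
    and "\<And>e. valid n e \<Longrightarrow> F e \<in> lists S"
    and "\<And>e. valid n e \<Longrightarrow> length (F e) \<le> b (esize n e)"
    and "\<And>e. valid n e \<Longrightarrow> run c e (b' (esize n e)) (e(n := F e))"
  shows "FP n F"
  unfolding FP_def
proof (intro exI conjI allI impI)
  show "pb (\<lambda>n. b n + b' n)" using assms by simp
  fix e assume e: "valid n e"
  show "F e \<in> lists S" using assms(3)[OF e] .
  show "length (F e) \<le> b (esize n e) + b' (esize n e)" using assms(4)[OF e] by simp
  show "run c e (b (esize n e) + b' (esize n e)) (e(n := F e))" using assms(5)[OF e] by (rule run_mono) simp
qed

definition computes :: "'a prog \<Rightarrow> nat poly \<Rightarrow> nat \<Rightarrow> ('a store \<Rightarrow> 'a list) \<Rightarrow> bool" where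
  "computes c p n F \<longleftrightarrow> (\<forall>e. valid n e \<longrightarrow> F e \<in> lists S \<and> length (F e) \<le> poly p (esize n e) \<and>
     run c e (poly p (esize n e)) (e(n := F e)))"

lemma computesD:
  assumes "computes c p n F" "valid n e"
  shows "F e \<in> lists S" "length (F e) \<le> poly p (esize n e)" "run c e (poly p (esize n e)) (e(n := F e))"
  using assms by (auto simp: computes_def)

lemma FPE:
  assumes "FP n F"
  obtains c p where "computes c p n F"
proof -
  from assms obtain c b where b: "pb b" and c: "\<And>e. valid n e \<Longrightarrow>
     F e \<in> lists S \<and> length (F e) \<le> b (esize n e) \<and> run c e (b (esize n e)) (e(n := F e))"
    unfolding FP_def by blast
  from b obtain p where "\<And>n. b n \<le> poly p n" by (auto simp: pb_def)
  then have "computes c p n F" unfolding computes_def using c by (blast intro: le_trans run_mono)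
  then show ?thesis by (rule that)
qed

lemma FP_lists: "FP n A \<Longrightarrow> valid n e \<Longrightarrow> A e \<in> lists S"
  by (auto simp: FP_def)

lemma FP_cong: "FP n F \<Longrightarrow> (\<And>e. valid n e \<Longrightarrow> F e = G e) \<Longrightarrow> FP n G"
  unfolding FP_def by metis

lemma valid_upd: "valid n e \<Longrightarrow> w \<in> lists S \<Longrightarrow> valid (Suc n) (e(n := w))"
  by (auto simp: valid_def)

lemma valid_lists: "valid n e \<Longrightarrow> e i \<in> lists S"
  by (simp add: valid_def)

lemma esize_upd: "esize (Suc n) (e(n := w)) = esize n e + length w"
  by (simp add: esize_def)

lemma length_le_esize: "i < n \<Longrightarrow> length (e i) \<le> esize n e"
  unfolding esize_def by (rule member_le_sum[of i "{..<n}" "\<lambda>i. length (e i)"]) auto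

section \<open>Closure properties of polynomial time functions\<close>

lemma FP_proj: "i < n \<Longrightarrow> FP n (\<lambda>e. e i)"
proof (rule FPI[where b = "\<lambda>n. n" and b' = mv_time and c = "cp i n (Suc n)"])
  fix e assume "i < n" and e: "valid n e"
  then show "length (e i) \<le> esize n e" by (simp add: length_le_esize)
  then show "run (cp i n (Suc n)) e (mv_time (esize n e)) (e(n := e i))"
    using \<open>i < n\<close> e by (intro run_cp) (auto simp: valid_def)
qed (auto simp: valid_def)

lemma FP_Nil: "FP n (\<lambda>e. [])"
  by (rule FPI[where b = "\<lambda>_. 0" and b' = "\<lambda>_. 1" and c = Skip])
    (use run_Skip in \<open>auto simp: valid_def fun_upd_idem\<close>)

lemma FP_Cons:
  assumes "a \<in> S" "FP n A"
  shows "FP n (\<lambda>e. a # A e)"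
proof -
  obtain c p where Cc: "computes c p n A" by (rule FPE[OF assms(2)])
  note c = computesD[OF Cc]
  show ?thesis
  proof (rule FPI[where b = "\<lambda>n. poly p n + 1" and b' = "\<lambda>n. poly p n + 1" and c = "Seq c (Push n a)"])
    fix e assume e: "valid n e"
    show "run (Seq c (Push n a)) e (poly p (esize n e) + 1) (e(n := a # A e))"
      using run_Seq[OF c(3)[OF e] run_Push[of n a "e(n := A e)"]] by simp
  qed (use c assms in auto)
qed

lemma FP_tl:
  assumes "FP n A"
  shows "FP n (\<lambda>e. tl (A e))"
proof -
  obtain c p where Cc: "computes c p n A" by (rule FPE[OF assms])
  note c = computesD[OF Cc]
  show ?thesis
  proof (rule FPI[where b = "poly p" and b' = "\<lambda>n. poly p n + 1" and c = "Seq c (Pop n)"])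
    fix e assume e: "valid n e"
    show "run (Seq c (Pop n)) e (poly p (esize n e) + 1) (e(n := tl (A e)))"
      using run_Seq[OF c(3)[OF e] run_Pop[of n "e(n := A e)"]] by simp
    show "length (tl (A e)) \<le> poly p (esize n e)" using c(2)[OF e] by simp
    show "tl (A e) \<in> lists S" using c(1)[OF e] by (cases "A e") auto
  qed simp_all
qed

text \<open>Shifts the stacks from n on by one, which frees stack n for a local value during a
  subroutine.\<close>

definition skip :: "nat \<Rightarrow> nat \<Rightarrow> nat" where
  "skip n i = (if i < n then i else Suc i)"

lemma inj_skip: "inj (skip n)"
  by (auto simp: inj_def skip_def split: if_splits)

lemma valid_restrict: "valid (Suc n) e \<Longrightarrow> valid n (e(n := []))"
  by (auto simp: valid_def Suc_le_eq)

lemma esize_restrict: "esize n (e(n := [])) = esize n e"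
  by (simp add: esize_def)

text \<open>Variables are treated in de Bruijn style: stack n holds the newest one, and
  \<open>e(n := [])\<close> is the environment without it.\<close>

lemma FP_weaken:
  assumes "FP n A"
  shows "FP (Suc n) (\<lambda>e. A (e(n := [])))"
proof -
  obtain c p where Cc: "computes c p n A" by (rule FPE[OF assms])
  note c = computesD[OF Cc]
  have le: "poly p (esize n e) \<le> poly p (esize (Suc n) e)" for e
    by (rule poly_mono_nat) (simp add: esize_def)
  show ?thesis
  proof (rule FPI[where b = "poly p" and b' = "poly p" and c = "ren (skip n) c"])
    fix e assume e: "valid (Suc n) e"
    note v = valid_restrict[OF e]
    show "A (e(n := [])) \<in> lists S" using c(1)[OF v] .
    show "length (A (e(n := []))) \<le> poly p (esize (Suc n) e)"
      using c(2)[OF v] le[of e] unfolding esize_restrict by (rule le_trans)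
    have "run (ren (skip n) c) e (poly p (esize n e)) (e(skip n n := A (e(n := []))))"
      using c(3)[OF v] inj_skip unfolding esize_restrict
      by (rule run_ren) (use e in \<open>auto simp: skip_def valid_def Suc_le_eq\<close>)
    then show "run (ren (skip n) c) e (poly p (esize (Suc n) e)) (e(Suc n := A (e(n := []))))"
      using le[of e] by (auto simp: skip_def intro: run_mono)
  qed simp_all
qed

text \<open>Composition: the local value sits in stack n while the result is computed in stack n +
  1; then the local value is erased and the result moved down.\<close>

lemma FP_Let:
  assumes "FP (Suc n) F" "FP n A"
  shows "FP n (\<lambda>e. F (e(n := A e)))"
proof -
  obtain c p where Cc: "computes c p n A" by (rule FPE[OF assms(2)])
  note c = computesD[OF Cc]
  obtain d q where Cd: "computes d q (Suc n) F" by (rule FPE[OF assms(1)])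
  note d = computesD[OF Cd]
  define b where "b k = poly q (k + poly p k)" for k
  define b' where "b' k = poly p k + (b k + ((2 * poly p k + 1) + mv_time (b k)))" for k
  show ?thesis
  proof (rule FPI[where b = b and b' = b' and c = "Seq c (Seq d (Seq (clear n) (mv (Suc n) n (Suc (Suc n)))))"])
    show "pb b" unfolding b_def by simp
    then show "pb b'" unfolding b'_def by simp
    fix e assume e: "valid n e"
    let ?e1 = "e(n := A e)"
    have e1: "valid (Suc n) ?e1" using e c(1)[OF e] by (rule valid_upd)
    have le: "poly q (esize (Suc n) ?e1) \<le> b (esize n e)"
      unfolding esize_upd b_def using c(2)[OF e] by (intro poly_mono_nat) simp
    show "F ?e1 \<in> lists S" using d(1)[OF e1] .
    show l: "length (F ?e1) \<le> b (esize n e)" using d(2)[OF e1] le by (rule le_trans)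
    let ?e2 = "?e1(Suc n := F ?e1)"
    let ?e3 = "?e2(n := [])"
    have 3: "run (clear n) ?e2 (2 * poly p (esize n e) + 1) ?e3"
      by (rule run_clear) (use c(2)[OF e] in simp)
    have "run (mv (Suc n) n (Suc (Suc n))) ?e3 (mv_time (b (esize n e))) (?e3(Suc n := [], n := ?e3 (Suc n)))"
      using e d(1)[OF e1] l by (intro run_mv) (auto simp: valid_def)
    moreover have "?e3(Suc n := [], n := ?e3 (Suc n)) = e(n := F ?e1)"
      using e by (auto simp: valid_def fun_eq_iff)
    ultimately have 4: "run (mv (Suc n) n (Suc (Suc n))) ?e3 (mv_time (b (esize n e))) (e(n := F ?e1))"
      by (simp only:)
    show "run (Seq c (Seq d (Seq (clear n) (mv (Suc n) n (Suc (Suc n)))))) e (b' (esize n e)) (e(n := F ?e1))"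
      unfolding b'_def using c(3)[OF e] run_mono[OF d(3)[OF e1] le] 3 4 by (intro run_Seq)
  qed
qed

lemma FP_if_reg:
  assumes "FP n B" "FP n C"
  shows "FP n (\<lambda>e. if e i = [] then B e else C e)"
proof -
  obtain c p where Cc: "computes c p n B" by (rule FPE[OF assms(1)])
  note c = computesD[OF Cc]
  obtain d q where Cd: "computes d q n C" by (rule FPE[OF assms(2)])
  note d = computesD[OF Cd]
  define b where "b k = length syms + (poly p k + poly q k)" for k
  have pbb: "pb b" unfolding b_def by simp
  show ?thesis
  proof (rule FPI[where c = "dispatch i (\<lambda>_. d) c", OF pbb pbb])
    fix e assume e: "valid n e"
    show "(if e i = [] then B e else C e) \<in> lists S" using c(1)[OF e] d(1)[OF e] by simp
    show "length (if e i = [] then B e else C e) \<le> b (esize n e)"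
      using c(2)[OF e] d(2)[OF e] by (simp add: b_def)
    show "run (dispatch i (\<lambda>_. d) c) e (b (esize n e)) (e(n := if e i = [] then B e else C e))"
    proof (cases "e i")
      case Nil
      have "run (dispatch i (\<lambda>_. d) c) e (length syms + poly p (esize n e)) (e(n := B e))"
        using Nil c(3)[OF e] by (rule run_dispatch_Nil)
      then show ?thesis using Nil by (auto simp: b_def intro: run_mono)
    next
      case (Cons a w)
      have "a \<in> S" using Cons valid_lists[OF e, of i] by simp
      then have "run (dispatch i (\<lambda>_. d) c) e (length syms + poly q (esize n e)) (e(n := C e))"
        using Cons d(3)[OF e] by (intro run_dispatch)
      then show ?thesis using Cons by (auto simp: b_def intro: run_mono)
    qed
  qed
qed

lemma FP_hd_reg:
  assumes "FP n B" "FP n C"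
  shows "FP n (\<lambda>e. if e i \<noteq> [] \<and> hd (e i) = a then B e else C e)"
proof -
  obtain c p where Cc: "computes c p n B" by (rule FPE[OF assms(1)])
  note c = computesD[OF Cc]
  obtain d q where Cd: "computes d q n C" by (rule FPE[OF assms(2)])
  note d = computesD[OF Cd]
  define b where "b k = 1 + (poly p k + poly q k)" for k
  have pbb: "pb b" unfolding b_def by (intro pb_add pb_const pb_poly)
  show ?thesis
  proof (rule FPI[where c = "IfTop i a c d", OF pbb pbb])
    fix e assume e: "valid n e"
    show "(if e i \<noteq> [] \<and> hd (e i) = a then B e else C e) \<in> lists S" using c(1)[OF e] d(1)[OF e] by simp
    show "length (if e i \<noteq> [] \<and> hd (e i) = a then B e else C e) \<le> b (esize n e)"
      using c(2)[OF e] d(2)[OF e] by (simp add: b_def)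
    show "run (IfTop i a c d) e (b (esize n e)) (e(n := if e i \<noteq> [] \<and> hd (e i) = a then B e else C e))"
    proof (cases "e i \<noteq> [] \<and> hd (e i) = a")
      case True
      have "run (IfTop i a c d) e (1 + poly p (esize n e)) (e(n := B e))"
        using True c(3)[OF e] by (rule run_IfTrue)
      then show ?thesis using True by (auto simp: b_def intro: run_mono)
    next
      case False
      have "run (IfTop i a c d) e (1 + poly q (esize n e)) (e(n := C e))"
        using False d(3)[OF e] by (rule run_IfFalse)
      then show ?thesis using False by (auto simp: b_def intro: run_mono)
    qed
  qed
qed

lemma valid_fun_upd_Nil: "valid n e \<Longrightarrow> e(n := w, n := []) = e" "valid n e \<Longrightarrow> e(n := []) = e"
  by (auto simp: valid_def)

lemma FP_if:
  assumes "FP n A" "FP n B" "FP n C"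
  shows "FP n (\<lambda>e. if A e = [] then B e else C e)"
proof -
  note FP_Let[OF FP_if_reg[OF FP_weaken[OF assms(2)] FP_weaken[OF assms(3)], of n] assms(1)]
  then show ?thesis by (rule FP_cong) (simp add: valid_fun_upd_Nil)
qed

lemma FP_hd:
  assumes "FP n A" "FP n B" "FP n C"
  shows "FP n (\<lambda>e. if A e \<noteq> [] \<and> hd (A e) = a then B e else C e)"
proof -
  note FP_Let[OF FP_hd_reg[OF FP_weaken[OF assms(2)] FP_weaken[OF assms(3)], of n a] assms(1)]
  then show ?thesis by (rule FP_cong) (simp add: valid_fun_upd_Nil)
qed

text \<open>Polynomial steps may compose to exponential growth, hence the hypothesis on all
  intermediate accumulators. The list is consumed in stack n and the accumulator kept in stack n +
  1; the step programs expect it in stack n, which is corrected by \<open>skip\<close>.\<close>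

lemma FP_fold:
  assumes "\<And>a. a \<in> S \<Longrightarrow> FP (Suc n) (\<lambda>e. F (e(n := [])) (e n) a)" "FP n A" "FP n B"
    and "pb r"
    and bound: "\<And>e k. valid n e \<Longrightarrow> length (foldl (F e) (B e) (take k (A e))) \<le> r (esize n e)"
  shows "FP n (\<lambda>e. foldl (F e) (B e) (A e))"
proof -
  obtain c p where Cc: "computes c p n A" by (rule FPE[OF assms(2)])
  note c = computesD[OF Cc]
  obtain d0 q0 where Cd0: "computes d0 q0 (Suc n) (\<lambda>e. B (e(n := [])))"
    by (rule FPE[OF FP_weaken[OF assms(3)]])
  note d0 = computesD[OF Cd0]
  have "\<exists>d q. computes d q (Suc n) (\<lambda>e. F (e(n := [])) (e n) a)" if "a \<in> S" for a
    by (rule FPE[OF assms(1)[OF that]]) blast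
  then have "\<exists>d. \<forall>a\<in>S. \<exists>q. computes (d a) q (Suc n) (\<lambda>e. F (e(n := [])) (e n) a)"
    by (intro bchoice) blast
  then obtain d where "\<forall>a\<in>S. \<exists>q. computes (d a) q (Suc n) (\<lambda>e. F (e(n := [])) (e n) a)" ..
  from bchoice[OF this] obtain q where
    Cd: "\<And>a. a \<in> S \<Longrightarrow> computes (d a) (q a) (Suc n) (\<lambda>e. F (e(n := [])) (e n) a)" by blast
  note d = computesD[OF Cd]
  define body where "body a = Seq (ren (skip n) (d a))
    (Seq (clear (Suc n)) (mv (Suc (Suc n)) (Suc n) (Suc (Suc (Suc n)))))" for a
  define b1 where "b1 k = (\<Sum>a\<in>S. poly (q a) (k + r k)) + ((2 * r k + 1) + mv_time (r k))" for k
  define b where "b k = poly p k + (poly q0 (k + poly p k) +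
    (((length syms + b1 k + 2) * poly p k + 1) + mv_time (r k)))" for k
  show ?thesis
  proof (rule FPI[where b = r and b' = b and c = "Seq c (Seq d0 (Seq (for_each n body) (mv (Suc n) n (Suc (Suc n)))))"])
    show "pb r" by fact
    then have "pb (\<lambda>k. k + r k)" by simp
    then have "pb b1" unfolding b1_def using \<open>pb r\<close>
      by (intro pb_add pb_const pb_mult pb_sum pb_poly_comp pb_id pb_mv_time)
    then show "pb b" unfolding b_def using \<open>pb r\<close>
      by (intro pb_add pb_const pb_mult pb_poly_comp pb_poly pb_id pb_mv_time)
    fix e assume e: "valid n e"
    let ?w = "A e" and ?n = "esize n e"
    define z where "z k = foldl (F e) (B e) (take k ?w)" for k
    note w = c(1)[OF e] and len_w = c(2)[OF e]
    have e1: "valid (Suc n) (e(n := ?w))" using e w by (rule valid_upd)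
    have restrict: "e(n := v, n := []) = e" and restrict0: "e(n := []) = e" for v
      using e by (rule valid_fun_upd_Nil)+
    have z_Suc: "z (Suc k) = F e (z k) (?w ! k)" if "k < length ?w" for k
      using that by (simp add: z_def take_Suc_conv_app_nth)
    have w_nth: "?w ! k \<in> S" if "k < length ?w" for k
      using w that by (auto simp: in_lists_conv_set)
    have z_S: "z k \<in> lists S" if "k \<le> length ?w" for k
      using that
    proof (induction k)
      case 0
      have "B e \<in> lists S" using d0(1)[OF e1] unfolding restrict .
      then show ?case by (simp add: z_def)
    next
      case (Suc k)
      then have "valid (Suc n) (e(n := z k))" using e by (intro valid_upd) simp_all
      from d(1)[OF w_nth this, of k] Suc.prems show ?case by (simp add: z_Suc restrict0)
    qed
    have z_len: "length (z k) \<le> r ?n" for k unfolding z_def by (rule bound[OF e])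
    have fin: "z (length ?w) = foldl (F e) (B e) ?w" by (simp add: z_def)
    show "foldl (F e) (B e) ?w \<in> lists S" using z_S[of "length ?w"] unfolding fin by simp
    show "length (foldl (F e) (B e) ?w) \<le> r ?n" using z_len[of "length ?w"] unfolding fin .
    define st where "st k = e(n := drop k ?w, Suc n := z k)" for k
    have st_n: "st k n = drop k ?w" for k by (simp add: st_def)
    have e_Nil: "e j = []" if "n \<le> j" for j using e that by (simp add: valid_def)
    have 1: "run c e (poly p ?n) (e(n := ?w))" by (rule c(3)[OF e])
    have "run d0 (e(n := ?w)) (poly q0 (esize (Suc n) (e(n := ?w)))) (st 0)"
      using d0(3)[OF e1] unfolding restrict by (simp add: st_def z_def)
    then have 2: "run d0 (e(n := ?w)) (poly q0 (?n + poly p ?n)) (st 0)"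
      unfolding esize_upd by (rule run_mono) (use len_w in \<open>auto intro: poly_mono_nat\<close>)
    have "run (body (?w ! k)) ((st k)(n := drop (Suc k) ?w)) (b1 ?n) (st (Suc k))" if k: "k < length ?w" for k
    proof -
      let ?a = "?w ! k"
      let ?s1 = "e(n := drop (Suc k) ?w, Suc n := z k)"
      have s1: "(st k)(n := drop (Suc k) ?w) = ?s1" by (auto simp: st_def fun_eq_iff)
      have v: "valid (Suc n) (e(n := z k))" using e k by (intro valid_upd z_S) simp_all
      let ?s2 = "?s1(Suc (Suc n) := z (Suc k))"
      have "run (ren (skip n) (d ?a)) ?s1 (poly (q ?a) (esize (Suc n) (e(n := z k))))
          (?s1(skip n (Suc n) := z (Suc k)))"
      proof (rule run_ren)
        show "run (d ?a) (e(n := z k)) (poly (q ?a) (esize (Suc n) (e(n := z k)))) ((e(n := z k))(Suc n := z (Suc k)))"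
          using d(3)[OF w_nth[OF k] v] k by (simp add: restrict0 z_Suc)
        show "?s1 (skip n i) = (e(n := z k)) i" for i
          using e_Nil by (auto simp: skip_def)
      qed (rule inj_skip)
      moreover have "poly (q ?a) (esize (Suc n) (e(n := z k))) \<le> (\<Sum>a\<in>S. poly (q a) (?n + r ?n))"
      proof -
        have "poly (q ?a) (esize (Suc n) (e(n := z k))) \<le> poly (q ?a) (?n + r ?n)"
          unfolding esize_upd using z_len by (intro poly_mono_nat) simp
        also have "\<dots> \<le> (\<Sum>a\<in>S. poly (q a) (?n + r ?n))"
          using w_nth[OF k] finite_S by (intro member_le_sum) simp_all
        finally show ?thesis .
      qed
      ultimately have b2: "run (ren (skip n) (d ?a)) ?s1 (\<Sum>a\<in>S. poly (q a) (?n + r ?n)) ?s2"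
        unfolding skip_def by (simp add: run_mono)
      let ?s3 = "?s2(Suc n := [])"
      have b3: "run (clear (Suc n)) ?s2 (2 * r ?n + 1) ?s3"
        by (rule run_clear) (use z_len in simp)
      have "run (mv (Suc (Suc n)) (Suc n) (Suc (Suc (Suc n)))) ?s3 (mv_time (r ?n))
          (?s3(Suc (Suc n) := [], Suc n := ?s3 (Suc (Suc n))))"
        using e_Nil k z_len by (intro run_mv) (simp_all add: z_S Suc_le_eq)
      moreover have "?s3(Suc (Suc n) := [], Suc n := ?s3 (Suc (Suc n))) = st (Suc k)"
        using e_Nil by (auto simp: st_def fun_eq_iff)
      ultimately have b4: "run (mv (Suc (Suc n)) (Suc n) (Suc (Suc (Suc n)))) ?s3 (mv_time (r ?n)) (st (Suc k))"
        by (simp only:)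
      show ?thesis
        unfolding s1 body_def b1_def using b2 b3 b4 by (intro run_Seq)
    qed
    from run_for_each[of ?w st n, OF w st_n len_w this]
    have 3: "run (for_each n body) (st 0) ((length syms + b1 ?n + 2) * poly p ?n + 1) (st (length ?w))" .
    let ?s = "st (length ?w)"
    have s: "?s = e(Suc n := z (length ?w))" using e_Nil[of n] by (auto simp: st_def fun_eq_iff)
    have "run (mv (Suc n) n (Suc (Suc n))) ?s (mv_time (r ?n)) (?s(Suc n := [], n := ?s (Suc n)))"
      unfolding s using e_Nil z_S[of "length ?w"] z_len by (intro run_mv) simp_all
    moreover have "?s(Suc n := [], n := ?s (Suc n)) = e(n := foldl (F e) (B e) ?w)"
      unfolding s fin using e_Nil by (auto simp: fun_eq_iff)
    ultimately have 4: "run (mv (Suc n) n (Suc (Suc n))) ?s (mv_time (r ?n)) (e(n := foldl (F e) (B e) ?w))"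
      by (simp only:)
    show "run (Seq c (Seq d0 (Seq (for_each n body) (mv (Suc n) n (Suc (Suc n))))))
        e (b ?n) (e(n := foldl (F e) (B e) ?w))"
      unfolding b_def using 1 2 3 4 by (intro run_Seq)
  qed
qed

end

section \<open>Polynomial time functions on words\<close>

text \<open>A bounded search written as a fold: the word is both the first candidate and the supply
  of rounds. If no suffix qualifies the result is \<open>[]\<close>, so the outcome still has to be
  checked.\<close>

definition find_suf :: "('a list \<Rightarrow> bool) \<Rightarrow> 'a list \<Rightarrow> 'a list" where
  "find_suf Q x = foldl (\<lambda>z _. if Q z then z else tl z) x x"

lemma find_suf_suffix: "suffix (find_suf Q x) x"
proof -
  have "suffix (foldl (\<lambda>z _. if Q z then z else tl z) z c) z" for z and c :: "'a list"
  proof (induction c arbitrary: z)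
    case (Cons a c)
    then show ?case using suffix_order.trans[OF Cons.IH suffix_tl] by auto
  qed simp
  then show ?thesis by (simp add: find_suf_def)
qed

lemma find_suf_works:
  assumes "suffix y x" "Q y"
  shows "Q (find_suf Q x)"
proof -
  have stay: "foldl (\<lambda>z _. if Q z then z else tl z) z c = z" if "Q z" for z and c :: "'a list"
    using that by (induction c) auto
  have "Q (foldl (\<lambda>z _. if Q z then z else tl z) z c)" if "suffix y z" "length z \<le> length c"
    for z and c :: "'a list"
    using that
  proof (induction c arbitrary: z)
    case Nil
    then show ?case using assms(2) by simp
  next
    case (Cons a c)
    show ?case
    proof (cases "Q z")
      case True
      then show ?thesis using stay[of z "a # c"] by simp
    next
      case False
      then have "y \<noteq> z" using assms(2) by auto
      then have "suffix y (tl z)" using Cons.prems(1) by (cases z) (auto simp: suffix_Cons)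
      moreover have "length (tl z) \<le> length c" using Cons.prems(2) by simp
      ultimately show ?thesis using False Cons.IH by simp
    qed
  qed
  then show ?thesis using assms(1) by (simp add: find_suf_def)
qed

context symbols
begin

lemma FP_length:
  assumes "FP n A"
  obtains p where "\<And>e. valid n e \<Longrightarrow> length (A e) \<le> poly p (esize n e)"
  by (rule FPE[OF assms]) (blast dest: computesD(2))

text \<open>A step that lengthens the accumulator by at most a constant satisfies the size condition
  by itself. All folds below are of this kind, except the one that computes normal forms.\<close>

lemma FP_fold_linear:
  assumes "\<And>a. a \<in> S \<Longrightarrow> FP (Suc n) (\<lambda>e. F (e(n := [])) (e n) a)" "FP n A" "FP n B"
    and le: "\<And>e z a. a \<in> S \<Longrightarrow> length (F e z a) \<le> length z + c"
  shows "FP n (\<lambda>e. foldl (F e) (B e) (A e))"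
proof -
  obtain p where p: "\<And>e. valid n e \<Longrightarrow> length (A e) \<le> poly p (esize n e)" by (rule FP_length[OF assms(2)]) blast
  obtain q where q: "\<And>e. valid n e \<Longrightarrow> length (B e) \<le> poly q (esize n e)" by (rule FP_length[OF assms(3)]) blast
  have AS: "valid n e \<Longrightarrow> A e \<in> lists S" for e by (rule FP_lists[OF assms(2)])
  have *: "length (foldl (F e) z w) \<le> length z + c * length w" if "set w \<subseteq> S" for e z w
    using that
  proof (induction w arbitrary: z)
    case (Cons a w)
    then have "length (foldl (F e) (F e z a) w) \<le> length (F e z a) + c * length w" by simp
    then show ?case using le[of a e z] Cons.prems by simp
  qed simp
  show ?thesis
  proof (rule FP_fold[OF assms(1-3)])
    show "pb (\<lambda>k. poly q k + c * poly p k)" by simp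
    fix e k assume e: "valid n e"
    have "set (take k (A e)) \<subseteq> S" using AS[OF e] set_take_subset[of k "A e"] by auto
    then have "length (foldl (F e) (B e) (take k (A e))) \<le> length (B e) + c * length (take k (A e))" by (rule *)
    also have "\<dots> \<le> poly q (esize n e) + c * poly p (esize n e)"
      using p[OF e] q[OF e] by (intro add_mono mult_le_mono) simp_all
    finally show "length (foldl (F e) (B e) (take k (A e))) \<le> poly q (esize n e) + c * poly p (esize n e)" .
  qed
qed

lemma FP_const: "w \<in> lists S \<Longrightarrow> FP n (\<lambda>e. w)"
  by (induction w) (auto intro: FP_Nil FP_Cons)

lemma FP_top: "FP (Suc n) (\<lambda>e. e n)"
  by (rule FP_proj) simp

lemma FP_let:
  assumes "FP (Suc n) (\<lambda>e. F (e(n := [])) (e n))" "FP n A"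
  shows "FP n (\<lambda>e. let x = A e in F e x)"
  using FP_Let[OF assms] by (rule FP_cong) (simp add: valid_fun_upd_Nil)

lemma foldl_Cons: "foldl (\<lambda>z a. a # z) z w = rev w @ z"
  by (induction w arbitrary: z) auto

lemma FP_rev:
  assumes "FP n A"
  shows "FP n (\<lambda>e. rev (A e))"
proof -
  have "FP n (\<lambda>e. foldl (\<lambda>z a. a # z) [] (A e))"
    by (rule FP_fold_linear[where c = 1]) (auto intro: assms FP_Nil FP_Cons FP_top simp: One_nat_def)
  then show ?thesis by (simp add: foldl_Cons)
qed

lemma FP_append:
  assumes "FP n A" "FP n B"
  shows "FP n (\<lambda>e. A e @ B e)"
proof -
  have "FP n (\<lambda>e. foldl (\<lambda>z a. a # z) (B e) (rev (A e)))"
    by (rule FP_fold_linear[where c = 1]) (auto intro: assms FP_rev FP_Cons FP_top simp: One_nat_def)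
  then show ?thesis by (simp add: foldl_Cons)
qed

lemma FP_concat_map:
  assumes "FP n A" and f: "\<And>a. a \<in> S \<Longrightarrow> f a \<in> lists S"
  shows "FP n (\<lambda>e. concat (map f (A e)))"
proof -
  have "FP n (\<lambda>e. foldl (\<lambda>z a. rev (f a) @ z) [] (A e))"
  proof (rule FP_fold_linear[where c = "\<Sum>a\<in>S. length (f a)"])
    show "length (rev (f a) @ z) \<le> length z + (\<Sum>a\<in>S. length (f a))" if "a \<in> S" for z a
      using member_le_sum[of a S "\<lambda>a. length (f a)"] finite_S that by simp
    show "FP (Suc n) (\<lambda>e. rev (f a) @ e n)" if "a \<in> S" for a
      using f[OF that] by (intro FP_append FP_top FP_const) auto
  qed (auto intro: assms FP_Nil)
  then have "FP n (\<lambda>e. rev (foldl (\<lambda>z a. rev (f a) @ z) [] (A e)))" by (rule FP_rev)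
  moreover have "rev (foldl (\<lambda>z a. rev (f a) @ z) y w) = rev y @ concat (map f w)" for y w
    by (induction w arbitrary: y) auto
  ultimately show ?thesis by simp
qed

lemma FP_filter:
  assumes "FP n A"
  shows "FP n (\<lambda>e. filter Q (A e))"
proof -
  have "concat (map (\<lambda>a. if Q a then [a] else []) w) = filter Q w" for w by (induction w) auto
  moreover have "FP n (\<lambda>e. concat (map (\<lambda>a. if Q a then [a] else []) (A e)))"
    by (rule FP_concat_map[OF assms]) auto
  ultimately show ?thesis by simp
qed

lemma FP_find:
  assumes "FP (Suc n) (\<lambda>e. T (e(n := [])) (e n))" "FP n A"
  shows "FP n (\<lambda>e. find_suf (\<lambda>z. T e z \<noteq> []) (A e))"
proof -
  have "FP n (\<lambda>e. foldl (\<lambda>z _. if T e z = [] then tl z else z) (A e) (A e))"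
    by (rule FP_fold_linear[where c = 0, OF FP_if[OF assms(1) FP_tl[OF FP_top] FP_top] assms(2,2)]) simp
  moreover have "(\<lambda>z (_ :: 'a). if T e z = [] then tl z else z) = (\<lambda>z _. if T e z \<noteq> [] then z else tl z)" for e
    by (auto simp: fun_eq_iff)
  ultimately show ?thesis unfolding find_suf_def by simp
qed

end

locale H_words =
  fixes m :: nat

sublocale H_words \<subseteq> symbols "H_gens m \<times> (UNIV :: bool set)"
  by unfold_locales (simp add: H_gens_def)

context H_words
begin

abbreviation W :: "gen word set" where "W \<equiv> words (H_gens m)"

lemma lists_S: "lists (H_gens m \<times> UNIV) = W"
  by (simp add: words_def)

lemma FP_inv_word:
  assumes "FP n A"
  shows "FP n (\<lambda>e. inv_word (A e))"
proof -
  have "rev (map linv w) = inv_word w" for w :: "gen word" by (induction w) auto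
  moreover have "FP n (\<lambda>e. rev (concat (map (\<lambda>a. [linv a]) (A e))))"
    by (intro FP_rev FP_concat_map assms) (auto simp: linv_def)
  ultimately show ?thesis by simp
qed

lemma FP_red:
  assumes "FP n A"
  shows "FP n (\<lambda>e. red (A e))"
proof -
  have "FP n (\<lambda>e. foldl (\<lambda>z a. ccons a z) [] (rev (A e)))"
    unfolding ccons_def
    by (rule FP_fold_linear[where c = 1])
      (auto intro!: assms FP_rev FP_Nil FP_hd FP_top FP_tl FP_Cons simp: One_nat_def)
  then show ?thesis by (rule FP_cong) (simp add: red_def foldr_conv_foldl)
qed

lemma subst_letter_words:
  assumes "a \<in> H_gens m \<times> UNIV"
  shows "wd (slet phi_img a) \<in> W" "wd (slet phi_inv_img a) \<in> W"
proof -
  obtain g b where a: "a = (g, b)" by (cases a)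
  have sW: "wd sg \<in> W" "wd (- sg) \<in> W" by (auto simp: H_gens_def)
  show "wd (slet phi_img a) \<in> W"
  proof (cases g)
    case (Gen_a i)
    then have i: "1 \<le> i" "i \<le> m" using assms a by (auto simp: H_gens_def)
    have "phi_img g \<in> L m" using i unfolding Gen_a by (cases "i \<le> 1") (auto intro!: L_plus)
    then show ?thesis using a by (auto simp: slet_def intro!: wd_L_words)
  qed (use sW a in \<open>auto simp: slet_def\<close>)
  show "wd (slet phi_inv_img a) \<in> W"
  proof (cases g)
    case (Gen_a i)
    then have i: "1 \<le> i" "i \<le> m" using assms a by (auto simp: H_gens_def)
    have "phi_inv_img g \<in> L m" using phi_inv_a_L[OF i(1)] L_mono[OF i(2)] unfolding Gen_a by simp
    then show ?thesis using a by (auto simp: slet_def intro!: wd_L_words)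
  qed (use sW a in \<open>auto simp: slet_def\<close>)
qed

lemma FP_subst:
  assumes "FP n A"
  shows "FP n (\<lambda>e. subst phi_img (A e))" "FP n (\<lambda>e. subst phi_inv_img (A e))"
  unfolding subst_def by (intro FP_concat_map assms; simp only: lists_S subst_letter_words)+

lemma FP_nfstep:
  assumes "FP n A" "a \<in> H_gens m \<times> UNIV"
  shows "FP n (\<lambda>e. nfstep (A e) a)"
proof (cases "fst a")
  case (Gen_a i)
  then show ?thesis using assms by (simp add: nfstep_def) (intro FP_red FP_append FP_Cons FP_Nil; simp)
next
  case Gen_s
  then show ?thesis using assms
    by (cases "snd a"; simp add: nfstep_def) (intro FP_red FP_Cons FP_subst; simp)+
qed

section \<open>Polynomial growth of normal forms\<close>

abbreviation lcnt :: "gen \<Rightarrow> gen word \<Rightarrow> nat" where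
  "lcnt g z \<equiv> length (filter (\<lambda>l. fst l = g) z)"

lemma cnt_ag: "cnt i (ag j) = (if i = j then 1 else 0)"
  by (auto simp: cnt_def One_nat_def)

lemma cnt_phi_img: "cnt i (phi_img (Gen_a j)) \<le> (if i \<le> j then 1 else 0)"
  using cnt_plus[of i "ag j" "ag (j - 1)"] by (auto simp: cnt_ag split: if_splits)

text \<open>Each step of the recursion adds one new letter of higher index, so no index is repeated.
  Thus the inverse of \<phi> obeys the same letter bound as \<phi>, and both signs of s are treated
  alike.\<close>

lemma cnt_phi_inv_a: "cnt i (phi_inv_a j) \<le> (if i \<le> j then 1 else 0)"
proof (induction j rule: phi_inv_a.induct)
  case (3 k)
  then show ?case
    using cnt_plus[of i "ag (Suc (Suc k))" "- phi_inv_a (Suc k)"]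
    by (auto simp: cnt_ag split: if_splits)
qed (auto simp: cnt_ag One_nat_def)

lemma lcnt_subst:
  assumes f: "\<And>i j. cnt i (f (Gen_a j)) \<le> (if i \<le> j then 1 else 0)" "f Gen_s = sg" and z: "z \<in> W"
  shows "lcnt (Gen_a i) (subst f z) \<le> lcnt (Gen_a i) z + (\<Sum>j\<in>{i<..m}. lcnt (Gen_a j) z)"
  using z
proof (induction z)
  case (Cons l z)
  then have l: "fst l \<in> H_gens m" and z: "z \<in> W" by auto
  have "lcnt (Gen_a i) (wd (slet f l)) \<le> lcnt (Gen_a i) [l] + (\<Sum>j\<in>{i<..m}. lcnt (Gen_a j) [l])"
  proof (cases "fst l")
    case Gen_s
    then show ?thesis using f(2) by (auto simp: slet_def)
  next
    case (Gen_a j)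
    have "lcnt (Gen_a i) (wd (slet f l)) = cnt i (f (Gen_a j))"
      using Gen_a cnt_uminus[of i "f (Gen_a j)"] by (auto simp: slet_def cnt_def)
    also have "\<dots> \<le> (if i \<le> j then 1 else 0)" by (rule f(1))
    also have "\<dots> \<le> lcnt (Gen_a i) [l] + (\<Sum>j\<in>{i<..m}. lcnt (Gen_a j) [l])"
    proof (cases "i < j")
      case True
      then have "j \<in> {i<..m}" using l Gen_a by (auto simp: H_gens_def)
      then have "lcnt (Gen_a j) [l] \<le> (\<Sum>j\<in>{i<..m}. lcnt (Gen_a j) [l])"
        by (rule member_le_sum) auto
      then show ?thesis using Gen_a by (simp add: One_nat_def)
    qed (use Gen_a in \<open>auto simp: One_nat_def\<close>)
    finally show ?thesis .
  qed
  moreover have "lcnt g (subst f (l # z)) = lcnt g (wd (slet f l)) + lcnt g (subst f z)"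
    "lcnt g (l # z) = lcnt g [l] + lcnt g z" for g
    by (simp_all add: subst_def)
  ultimately show ?case using Cons.IH[OF z] by (simp add: sum.distrib del: filter.simps)
qed (simp add: subst_def)

lemma lcnt_s_subst:
  assumes f: "\<And>a. a \<in> H_gens m \<times> UNIV \<Longrightarrow> fst a \<noteq> Gen_s \<Longrightarrow> slet f a \<in> L m" "f Gen_s = sg"
    and z: "z \<in> W"
  shows "lcnt Gen_s (subst f z) \<le> lcnt Gen_s z"
  using z
proof (induction z)
  case (Cons l z)
  then have l: "l \<in> H_gens m \<times> UNIV" and z: "z \<in> W" by (auto simp: mem_Times_iff)
  have "lcnt Gen_s (wd (slet f l)) \<le> lcnt Gen_s [l]"
  proof (cases "fst l = Gen_s")
    case True
    then show ?thesis using f(2) by (auto simp: slet_def)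
  next
    case False
    then have "\<forall>k\<in>set (wd (slet f l)). fst k \<noteq> Gen_s" using f(1)[OF l] by (auto simp: L_def)
    then show ?thesis by (simp add: filter_empty_conv[THEN iffD2])
  qed
  moreover have "lcnt Gen_s (subst f (l # z)) = lcnt Gen_s (wd (slet f l)) + lcnt Gen_s (subst f z)"
    "lcnt Gen_s (l # z) = lcnt Gen_s [l] + lcnt Gen_s z"
    by (simp_all add: subst_def)
  ultimately show ?case using Cons.IH[OF z] by (simp del: filter.simps)
qed (simp add: subst_def)

lemma lcnt_red: "lcnt g (red w) \<le> lcnt g w"
  by (rule filter_red)

lemma slet_phi_L:
  assumes "a \<in> H_gens m \<times> UNIV" "fst a \<noteq> Gen_s"
  shows "slet phi_img a \<in> L m" "slet phi_inv_img a \<in> L m"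
proof -
  obtain i where i: "fst a = Gen_a i" "1 \<le> i" "i \<le> m" using assms by (auto simp: H_gens_def)
  have "phi_img (Gen_a i) \<in> L m" using i by (cases "i \<le> 1") (auto intro!: L_plus)
  moreover have "phi_inv_img (Gen_a i) \<in> L m" using phi_inv_a_L[OF i(2)] L_mono[OF i(3)] by simp
  ultimately show "slet phi_img a \<in> L m" "slet phi_inv_img a \<in> L m" using i(1) by (auto simp: slet_def)
qed

lemma lcnt_nfstep:
  assumes "z \<in> W"
  shows "lcnt (Gen_a i) (nfstep z l) \<le> lcnt (Gen_a i) z + (\<Sum>j\<in>{i<..m}. lcnt (Gen_a j) z) + 1"
    and "lcnt Gen_s (nfstep z l) \<le> lcnt Gen_s z + 1"
proof -
  define f where "f = (if snd l then phi_img else phi_inv_img)"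
  have f: "cnt i (f (Gen_a j)) \<le> (if i \<le> j then 1 else 0)" "f Gen_s = sg" for i j
    unfolding f_def
    by (cases "snd l"; simp only: if_True if_False phi_inv_img.simps cnt_phi_img cnt_phi_inv_a)
      (cases "snd l"; simp)
  have f3: "slet f a \<in> L m" if "a \<in> H_gens m \<times> UNIV" "fst a \<noteq> Gen_s" for a
    unfolding f_def using slet_phi_L[OF that] by simp
  show "lcnt (Gen_a i) (nfstep z l) \<le> lcnt (Gen_a i) z + (\<Sum>j\<in>{i<..m}. lcnt (Gen_a j) z) + 1"
  proof (cases "fst l")
    case (Gen_a k)
    then show ?thesis using lcnt_red[of "Gen_a i" "z @ [l]"] by (simp add: nfstep_def One_nat_def split: if_splits)
  next
    case Gen_s
    then show ?thesis using lcnt_red[of "Gen_a i" "l # subst f z"] lcnt_subst[OF f(1,2) assms, of i]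
      by (simp add: nfstep_def f_def[symmetric])
  qed
  show "lcnt Gen_s (nfstep z l) \<le> lcnt Gen_s z + 1"
  proof (cases "fst l")
    case (Gen_a k)
    then show ?thesis using lcnt_red[of "Gen_s" "z @ [l]"] by (simp add: nfstep_def One_nat_def split: if_splits)
  next
    case Gen_s
    then show ?thesis using lcnt_red[of "Gen_s" "l # subst f z"] lcnt_s_subst[OF f3 f(2) assms]
      by (simp add: nfstep_def f_def[symmetric] One_nat_def)
  qed
qed

lemma nfw_snoc: "nfw (w @ [l]) = nfstep (nfw w) l"
  by (simp add: nfw_def)

lemma nfw_words: "w \<in> W \<Longrightarrow> nfw w \<in> W"
  unfolding nfw_hw by (intro hw_words val_HL)

text \<open>Every step adds to the number of letters $a_i$ at most the number of letters $a_j$ with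
  $j > i$; so this number grows polynomially, of degree at most $m - i + 1$.\<close>

lemma lcnt_nfw: "\<exists>p. \<forall>w\<in>W. lcnt (Gen_a i) (nfw w) \<le> poly p (length w)"
proof (induction "m - i" arbitrary: i rule: less_induct)
  case less
  have "\<forall>j\<in>{i<..m}. \<exists>p. \<forall>w\<in>W. lcnt (Gen_a j) (nfw w) \<le> poly p (length w)"
    using less by auto
  then obtain p where p: "\<And>j w. j \<in> {i<..m} \<Longrightarrow> w \<in> W \<Longrightarrow> lcnt (Gen_a j) (nfw w) \<le> poly (p j) (length w)"
    by metis
  define q where "q = (\<Sum>j\<in>{i<..m}. p j)"
  have q: "(\<Sum>j\<in>{i<..m}. lcnt (Gen_a j) (nfw w)) \<le> poly q (length w)" if "w \<in> W" for w
    unfolding q_def poly_sum using p[OF _ that] by (intro sum_mono) auto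
  have "lcnt (Gen_a i) (nfw w) \<le> length w * (poly q (length w) + 1)" if "w \<in> W" for w
    using that
  proof (induction w rule: rev_induct)
    case Nil
    then show ?case by (simp add: nfw_def)
  next
    case (snoc l w)
    then have w: "w \<in> W" by simp
    have mono: "poly q (length w) \<le> poly q (length (w @ [l]))" by (rule poly_mono_nat) simp
    have "lcnt (Gen_a i) (nfw (w @ [l])) \<le> length w * (poly q (length w) + 1) + poly q (length w) + 1"
      unfolding nfw_snoc using lcnt_nfstep(1)[OF nfw_words[OF w], of i l] snoc.IH[OF w] q[OF w] by linarith
    also have "\<dots> = Suc (length w) * (poly q (length w) + 1)" by simp
    also have "\<dots> \<le> length (w @ [l]) * (poly q (length (w @ [l])) + 1)"
      using mono by (intro mult_le_mono add_le_mono) simp_all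
    finally show ?case .
  qed
  then show ?case by (intro exI[of _ "[:0, 1:] * (q + [:1:])"]) (simp add: algebra_simps)
qed

lemma length_lcnt: "w \<in> W \<Longrightarrow> length w = lcnt Gen_s w + (\<Sum>i\<in>{1..m}. lcnt (Gen_a i) w)"
proof (induction w)
  case (Cons l w)
  have "1 = lcnt Gen_s [l] + (\<Sum>i\<in>{1..m}. lcnt (Gen_a i) [l])"
  proof (cases "fst l")
    case (Gen_a i)
    then have "i \<in> {1..m}" using Cons.prems by (auto simp: H_gens_def)
    then have "(\<Sum>k\<in>{1..m}. if i = k then 1 else 0 :: nat) = 1" by simp
    moreover have "lcnt (Gen_a k) [l] = (if i = k then 1 else 0)" for k using Gen_a by (simp add: One_nat_def)
    ultimately show ?thesis using Gen_a by simp
  qed (simp add: One_nat_def)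
  moreover have "lcnt g (l # w) = lcnt g [l] + lcnt g w" for g by simp
  ultimately show ?case using Cons by (simp add: sum.distrib del: filter.simps)
qed simp

lemma length_nfw: "\<exists>p. \<forall>w\<in>W. length (nfw w) \<le> poly p (length w)"
proof -
  have s: "lcnt Gen_s (nfw w) \<le> length w" if "w \<in> W" for w
    using that
  proof (induction w rule: rev_induct)
    case (snoc l w)
    then have "w \<in> W" by simp
    then show ?case using lcnt_nfstep(2)[OF nfw_words, of w l] snoc by (simp add: nfw_snoc)
  qed (simp add: nfw_def)
  obtain p where p: "\<And>i w. w \<in> W \<Longrightarrow> lcnt (Gen_a i) (nfw w) \<le> poly (p i) (length w)"
    using lcnt_nfw by metis
  have "length (nfw w) \<le> poly ([:0, 1:] + (\<Sum>i\<in>{1..m}. p i)) (length w)" if w: "w \<in> W" for w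
    unfolding length_lcnt[OF nfw_words[OF w]] poly_add poly_sum
    using s[OF w] p[OF w] by (intro add_mono sum_mono) simp_all
  then show ?thesis by blast
qed

lemma FP_nfw:
  assumes "FP n A"
  shows "FP n (\<lambda>e. nfw (A e))"
proof -
  obtain p where p: "\<And>e. valid n e \<Longrightarrow> length (A e) \<le> poly p (esize n e)" by (rule FP_length[OF assms]) blast
  obtain q where q: "\<And>w. w \<in> W \<Longrightarrow> length (nfw w) \<le> poly q (length w)" using length_nfw by blast
  have AS: "valid n e \<Longrightarrow> A e \<in> W" for e unfolding lists_S[symmetric] by (rule FP_lists[OF assms])
  show ?thesis
    unfolding nfw_def
  proof (rule FP_fold[OF _ assms FP_Nil])
    show "pb (\<lambda>k. poly q (poly p k))" by simp
    show "FP (Suc n) (\<lambda>e. nfstep (e n) a)" if "a \<in> H_gens m \<times> UNIV" for a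
      using that by (intro FP_nfstep FP_top)
    fix e k assume e: "valid n e"
    \<comment> \<open>The accumulator after k rounds is the normal form of a prefix of the input, so
      it is bounded by \<open>length_nfw\<close>; a bound for a single round, when iterated, would
      give exponential growth only.\<close>
    have "take k (A e) \<in> W" using AS[OF e] by (metis append_take_drop_id words_append)
    then have "length (nfw (take k (A e))) \<le> poly q (length (take k (A e)))" by (rule q)
    also have "\<dots> \<le> poly q (poly p (esize n e))" using p[OF e] by (intro poly_mono_nat) simp
    finally show "length (foldl nfstep [] (take k (A e))) \<le> poly q (poly p (esize n e))" by (simp add: nfw_def)
  qed
qed

end

section \<open>The conjugacy algorithm\<close>

text \<open>Tests u w = w v. Truth values are words from here on, with nonempty words meaning true,
  in accordance with the output convention for decision problems.\<close>

definition okw :: "gen word \<Rightarrow> gen word \<Rightarrow> gen word \<Rightarrow> gen word" where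
  "okw u w v = (if nfw (u @ w @ inv_word v @ inv_word w) = [] then [(Gen_s, True)] else [])"

definition rot :: "gen word \<Rightarrow> gen word \<Rightarrow> gen word" where
  "rot t u = nfw (t @ u @ inv_word t)"

text \<open>The length of \<open>rng\<close> is the bound of \<open>ph_bounded\<close> on the exponent $i$.\<close>

definition rng :: "gen word \<Rightarrow> gen word \<Rightarrow> gen word \<Rightarrow> gen word \<Rightarrow> gen word" where
  "rng u v t r = (let z = rot t u @ rot r v in
     concat (map (\<lambda>_. [(Gen_s, True)]) (z @ z @ z)) @ replicate 8 (Gen_s, True))"

text \<open>The conjugators tried are $t^{-1} s^i r$ with suffixes $t$ of \<open>u\<close> and $r$ of \<open>v\<close>.\<close>

definition search_exponent :: "gen word \<Rightarrow> gen word \<Rightarrow> gen word \<Rightarrow> gen word \<Rightarrow> gen word" where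
  "search_exponent u v t r =
    (let a = inv_word t @ find_suf (\<lambda>z. okw u (inv_word t @ z @ r) v \<noteq> []) (rng u v t r) @ r in
     let b = inv_word t @ inv_word (find_suf (\<lambda>z. okw u (inv_word t @ inv_word z @ r) v \<noteq> []) (rng u v t r)) @ r in
     if okw u a v = [] then b else a)"

text \<open>A candidate suffix is judged by running the inner search with it and verifying the
  answer; the chosen suffix then serves to run the inner search once more.\<close>

definition search_right :: "gen word \<Rightarrow> gen word \<Rightarrow> gen word \<Rightarrow> gen word" where
  "search_right u v t = search_exponent u v t (find_suf (\<lambda>r. okw u (search_exponent u v t r) v \<noteq> []) v)"

definition search :: "gen word \<Rightarrow> gen word \<Rightarrow> gen word" where
  "search u v = search_right u v (find_suf (\<lambda>t. okw u (search_right u v t) v \<noteq> []) u)"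

definition conjby :: "gen word \<Rightarrow> gen word \<Rightarrow> gen word" where
  "conjby g u = nfw (inv_word g @ u @ g)"

definition loww :: "nat \<Rightarrow> gen word \<Rightarrow> gen word" where
  "loww k z = (if filter (\<lambda>l. case fst l of Gen_a j \<Rightarrow> k \<le> j | Gen_s \<Rightarrow> False) z = []
     then [(Gen_s, True)] else [])"

text \<open>Conjugates an element of $H_k$ into $H_{k-1}$ if possible.\<close>

definition elliptic_step :: "nat \<Rightarrow> gen word \<Rightarrow> gen word \<Rightarrow> gen word" where
  "elliptic_step k u g =
    (let z = conjby g u in
     let t = find_suf (\<lambda>t. loww k (rot t z) \<noteq> []) z in
     if loww k (rot t z) = [] then g else g @ inv_word t)"

text \<open>If the element is conjugate in $H_{k-1}$ to $a_k^{-1} s^p a_k$, it is conjugated to $s^p$;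
  this is the only way in which conjugacy classes of $H_{k-1}$ fuse in $H_k$.\<close>

definition edge_step :: "nat \<Rightarrow> gen word \<Rightarrow> gen word \<Rightarrow> gen word" where
  "edge_step k u g =
    (let z = conjby g u in
     let c = nfw ([(Gen_a k, False)] @ filter (\<lambda>l. fst l = Gen_s) z @ [(Gen_a k, True)]) in
     let w = search z c in
     if okw z w c = [] then g else g @ w @ [(Gen_a k, False)])"

text \<open>The ranks are visited downwards, starting from m. The third argument of
  \<open>elliptic_step\<close> is the conjugator accumulated so far.\<close>

primrec elliptic_steps :: "nat \<Rightarrow> nat \<Rightarrow> gen word \<Rightarrow> gen word" where
  "elliptic_steps m 0 u = []"
| "elliptic_steps m (Suc d) u = elliptic_step (m - d) u (elliptic_steps m d u)"

text \<open>The ranks visited are 2, 3, and so on. Rank 1 is omitted because a_1 commutes with s, so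
  that nothing fuses there.\<close>

primrec edge_steps :: "nat \<Rightarrow> nat \<Rightarrow> gen word \<Rightarrow> gen word" where
  "edge_steps m 0 u = elliptic_steps m m u"
| "edge_steps m (Suc d) u = edge_step (Suc (Suc d)) u (edge_steps m d u)"

text \<open>If w conjugates g^-1 u g to h^-1 v h, then g w h^-1 conjugates u to v.\<close>

definition conjugator :: "nat \<Rightarrow> gen word \<Rightarrow> gen word \<Rightarrow> gen word" where
  "conjugator m u v =
    (let g = edge_steps m (m - 1) u in
     let h = edge_steps m (m - 1) v in
     g @ search (conjby g u) (conjby h v) @ inv_word h)"

context H_words
begin

section \<open>The algorithm runs in polynomial time\<close>

lemmas FP_word_rules = FP_if FP_nfw FP_append FP_inv_word FP_Nil FP_weaken FP_top FP_filter

lemma FP_sT: "FP n (\<lambda>e. [(Gen_s, True)])"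
  by (rule FP_const) (auto simp: H_gens_def)

lemma FP_okw: "FP n U \<Longrightarrow> FP n A \<Longrightarrow> FP n V \<Longrightarrow> FP n (\<lambda>e. okw (U e) (A e) (V e))"
  unfolding okw_def by (intro FP_word_rules FP_sT)

lemma FP_rot: "FP n T \<Longrightarrow> FP n U \<Longrightarrow> FP n (\<lambda>e. rot (T e) (U e))"
  unfolding rot_def by (intro FP_word_rules)

lemma FP_rng: "FP n U \<Longrightarrow> FP n V \<Longrightarrow> FP n T \<Longrightarrow> FP n R \<Longrightarrow> FP n (\<lambda>e. rng (U e) (V e) (T e) (R e))"
  unfolding rng_def Let_def
  by (intro FP_append FP_concat_map FP_rot FP_const) (auto simp: H_gens_def)

lemma FP_search_exponent:
  "FP n U \<Longrightarrow> FP n V \<Longrightarrow> FP n T \<Longrightarrow> FP n R \<Longrightarrow> FP n (\<lambda>e. search_exponent (U e) (V e) (T e) (R e))"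
  unfolding search_exponent_def
  by (intro FP_let FP_okw FP_rng FP_find FP_word_rules)

lemma FP_search_right:
  "FP n U \<Longrightarrow> FP n V \<Longrightarrow> FP n T \<Longrightarrow> FP n (\<lambda>e. search_right (U e) (V e) (T e))"
  unfolding search_right_def
  by (intro FP_okw FP_search_exponent FP_find FP_weaken FP_top)

lemma FP_search: "FP n U \<Longrightarrow> FP n V \<Longrightarrow> FP n (\<lambda>e. search (U e) (V e))"
  unfolding search_def
  by (intro FP_okw FP_search_right FP_find FP_weaken FP_top)

lemma FP_conjby: "FP n G \<Longrightarrow> FP n U \<Longrightarrow> FP n (\<lambda>e. conjby (G e) (U e))"
  unfolding conjby_def by (intro FP_word_rules)

lemma FP_loww: "FP n A \<Longrightarrow> FP n (\<lambda>e. loww k (A e))"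
  unfolding loww_def by (intro FP_word_rules FP_sT)

lemma FP_elliptic_step: "FP n U \<Longrightarrow> FP n G \<Longrightarrow> FP n (\<lambda>e. elliptic_step k (U e) (G e))"
  unfolding elliptic_step_def
  by (intro FP_let FP_find FP_loww FP_rot FP_conjby FP_word_rules)

lemma FP_edge_step: "FP n U \<Longrightarrow> FP n G \<Longrightarrow> 1 \<le> k \<Longrightarrow> k \<le> m \<Longrightarrow> FP n (\<lambda>e. edge_step k (U e) (G e))"
  unfolding edge_step_def
  by (intro FP_let FP_okw FP_search FP_conjby FP_word_rules FP_const) (auto simp: H_gens_def)

lemma FP_elliptic_steps: "FP n U \<Longrightarrow> FP n (\<lambda>e. elliptic_steps m d (U e))"
  by (induction d) (simp_all add: FP_Nil FP_elliptic_step)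

lemma FP_edge_steps: "FP n U \<Longrightarrow> d \<le> m - 1 \<Longrightarrow> FP n (\<lambda>e. edge_steps m d (U e))"
  by (induction d) (simp_all add: FP_elliptic_steps FP_edge_step)

lemma FP_conjugator: "FP n U \<Longrightarrow> FP n V \<Longrightarrow> FP n (\<lambda>e. conjugator m (U e) (V e))"
  unfolding conjugator_def
  by (intro FP_let FP_append FP_search FP_conjby FP_inv_word FP_edge_steps FP_weaken FP_top) auto

section \<open>The algorithm is correct\<close>

lemma suffix_words: "suffix z w \<Longrightarrow> w \<in> W \<Longrightarrow> z \<in> W"
  by (auto simp: suffix_def)

lemma find_suf_words: "w \<in> W \<Longrightarrow> find_suf Q w \<in> W"
  using suffix_words[OF find_suf_suffix] .

lemmas words_rules = find_suf_words nfw_words inv_word_words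

lemma val_nfw: "w \<in> W \<Longrightarrow> val (nfw w) = val w"
  unfolding nfw_hw by (rule val_hw[OF val_HL])

lemma hw_eq_Nil: "g \<in> HL m \<Longrightarrow> hw g = [] \<longleftrightarrow> g = 0"
  using val_hw[of g m] by (auto simp: zero_hel_def)

lemma okw_iff:
  assumes "u \<in> W" "w \<in> W" "v \<in> W"
  shows "okw u w v \<noteq> [] \<longleftrightarrow> val u + val w = val w + val v"
proof -
  have "u @ w @ inv_word v @ inv_word w \<in> W" using assms by (simp add: inv_word_words)
  from hw_eq_Nil[OF val_HL[OF this]]
  have "okw u w v \<noteq> [] \<longleftrightarrow> val u + val w - val v - val w = 0"
    by (simp add: okw_def nfw_hw add.assoc diff_conv_add_uminus del: add_uminus_conv_diff)
  also have "\<dots> \<longleftrightarrow> val u + val w - val v = val w" by simp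
  also have "\<dots> \<longleftrightarrow> val u + val w = val w + val v" by (simp add: diff_eq_eq)
  finally show ?thesis .
qed

lemma rng_words: "rng u v t r \<in> W"
  by (auto simp: rng_def Let_def words_def H_gens_def)

lemma search_exponent_words: "t \<in> W \<Longrightarrow> r \<in> W \<Longrightarrow> search_exponent u v t r \<in> W"
  by (simp add: search_exponent_def Let_def words_rules rng_words)

lemma search_right_words: "v \<in> W \<Longrightarrow> t \<in> W \<Longrightarrow> search_right u v t \<in> W"
  by (simp add: search_right_def search_exponent_words words_rules)

lemma search_words: "u \<in> W \<Longrightarrow> v \<in> W \<Longrightarrow> search u v \<in> W"
  by (simp add: search_def search_right_words words_rules)

lemma conjby_words: "g \<in> W \<Longrightarrow> u \<in> W \<Longrightarrow> conjby g u \<in> W"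
  by (simp add: conjby_def words_rules)

lemma val_replicate_s: "val (replicate n (Gen_s, True)) = HE (int n) 0"
  using val_spow[of "int n"] by (simp add: wd_spow)

lemma rng_replicate:
  "rng u v t r = replicate (3 * (length (rot t u) + length (rot r v)) + 8) (Gen_s, True)"
proof -
  have "concat (map (\<lambda>_. [(Gen_s, True)]) w) = replicate (length w) (Gen_s, True)" for w :: "gen word"
    by (induction w) auto
  then show ?thesis
    unfolding rng_def Let_def by (simp only: replicate_add[symmetric]) (simp add: mult.commute)
qed

lemma search_exponent_complete:
  assumes W: "u \<in> W" "v \<in> W" "t \<in> W" "r \<in> W"
    and i: "\<bar>i\<bar> \<le> int (3 * (length (rot t u) + length (rot r v)) + 8)"
    and eq: "val u + (- val t + HE i 0 + val r) = (- val t + HE i 0 + val r) + val v"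
  shows "okw u (search_exponent u v t r) v \<noteq> []"
proof -
  define z where "z = replicate (nat \<bar>i\<bar>) (Gen_s, True)"
  have "rng u v t r = replicate (3 * (length (rot t u) + length (rot r v)) + 8 - nat \<bar>i\<bar>) (Gen_s, True) @ z"
    unfolding rng_replicate z_def replicate_add[symmetric] using i by simp
  then have z: "suffix z (rng u v t r)" by (auto simp: suffix_def)
  have zW: "z \<in> W" by (auto simp: z_def words_def H_gens_def)
  define a where "a = inv_word t @ find_suf (\<lambda>z. okw u (inv_word t @ z @ r) v \<noteq> []) (rng u v t r) @ r"
  define b where "b = inv_word t @ inv_word (find_suf (\<lambda>z. okw u (inv_word t @ inv_word z @ r) v \<noteq> []) (rng u v t r)) @ r"
  have S: "search_exponent u v t r = (if okw u a v = [] then b else a)"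
    by (simp add: search_exponent_def a_def b_def Let_def)
  show ?thesis
  proof (cases "i \<ge> 0")
    case True
    have "okw u (inv_word t @ z @ r) v \<noteq> []"
      using eq True W zW by (subst okw_iff) (simp_all add: inv_word_words z_def val_replicate_s add.assoc)
    from find_suf_works[of z _ "\<lambda>z. okw u (inv_word t @ z @ r) v \<noteq> []", OF z this]
    have "okw u a v \<noteq> []" by (simp add: a_def)
    then show ?thesis by (simp add: S)
  next
    case False
    have "okw u (inv_word t @ inv_word z @ r) v \<noteq> []"
      using eq False W zW by (subst okw_iff) (simp_all add: inv_word_words z_def val_replicate_s add.assoc)
    from find_suf_works[of z _ "\<lambda>z. okw u (inv_word t @ inv_word z @ r) v \<noteq> []", OF z this]
    have "okw u b v \<noteq> []" by (simp add: b_def)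
    then show ?thesis by (simp add: S)
  qed
qed

lemma search_complete:
  assumes W: "u \<in> W" "v \<in> W" and t: "suffix t u" and r: "suffix r v"
    and i: "\<bar>i\<bar> \<le> int (3 * (length (rot t u) + length (rot r v)) + 8)"
    and eq: "val u + (- val t + HE i 0 + val r) = (- val t + HE i 0 + val r) + val v"
  shows "okw u (search u v) v \<noteq> []"
proof -
  have "okw u (search_exponent u v t r) v \<noteq> []"
    using search_exponent_complete[OF W suffix_words[OF t W(1)] suffix_words[OF r W(2)] i eq] .
  from find_suf_works[of r v "\<lambda>r. okw u (search_exponent u v t r) v \<noteq> []", OF r this]
  have "okw u (search_right u v t) v \<noteq> []" by (simp add: search_right_def)
  from find_suf_works[of t u "\<lambda>t. okw u (search_right u v t) v \<noteq> []", OF t this]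
  show ?thesis by (simp add: search_def)
qed

lemma hw_W: "x \<in> L k \<Longrightarrow> k \<le> m \<Longrightarrow> hw (HE p x) \<in> W"
  by (rule hw_words) (simp add: L_mono)

lemma val_hw_W: "x \<in> L k \<Longrightarrow> val (hw (HE p x)) = HE p x"
  by (rule val_hw[of _ k]) simp

lemma rot_hw:
  assumes "x \<in> L k" "t \<in> L k" "k \<le> m"
  shows "rot (wd t) (hw (HE p x)) = hw (HE p (ph p t + x - t))"
proof -
  have "rot (wd t) (hw (HE p x)) = hw (HE 0 t + HE p x - HE 0 t)"
    unfolding rot_def nfw_hw using assms
    by (simp add: val_wd_L val_hw_W add.assoc diff_conv_add_uminus del: add_uminus_conv_diff hw.simps)
  also have "HE 0 t + HE p x - HE 0 t = HE p (ph p t + x - t)" by (simp add: minus_hel_def)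
  finally show ?thesis .
qed

text \<open>\<open>hyperbolic_conjugate\<close> supplies the suffixes and some exponent,
  \<open>ph_bounded_L\<close> an exponent within the range that is searched.\<close>

lemma search_hyperbolic:
  assumes x: "x \<in> L k" and y: "y \<in> L k" and k: "k \<le> m" and tc: "tc k p x y" and ell: "\<not> elliptic k p x"
  shows "okw (hw (HE p x)) (search (hw (HE p x)) (hw (HE p y))) (hw (HE p y)) \<noteq> []"
proof -
  let ?u = "hw (HE p x)" and ?v = "hw (HE p y)"
  obtain t r j where tr: "t \<in> L k" "r \<in> L k" "suffix (wd t) (wd x)" "suffix (wd r) (wd y)"
    and j: "ph p r + y - r = ph j (ph p t + x - t)"
    using hyperbolic_conjugate[OF x y tc ell] by blast
  define X where "X = ph p t + x - t"
  have X: "X \<in> L k" using x tr by (simp add: X_def)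
  \<comment> \<open>If \<phi> fixes \<open>X\<close>, then \<open>j\<close> may be as large as it
    likes, but the exponent 0 does the same.\<close>
  have "\<exists>i. ph i X = ph j X \<and> \<bar>i\<bar> \<le> int (3 * (len X + len (ph i X)) + 8)"
  proof (cases "ph1 X = X")
    case True
    then show ?thesis by (intro exI[of _ 0]) (simp add: ph1_fixed)
  next
    case False
    then show ?thesis using ph_bounded_L[OF X] unfolding ph_bounded_def by blast
  qed
  then obtain i where i: "ph i X = ph j X" "\<bar>i\<bar> \<le> int (3 * (len X + len (ph i X)) + 8)" by blast
  have Y: "ph p r + y - r = ph i X" using j i(1) by (simp add: X_def)
  have l: "len X \<le> length (rot (wd t) ?u)" "len (ph i X) \<le> length (rot (wd r) ?v)"
    using X by (simp_all add: rot_hw[OF x tr(1) k] rot_hw[OF y tr(2) k] Y X_def[symmetric] wd_spow_plus del: hw.simps)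
      (simp_all add: wd_spow_plus)
  show ?thesis
  proof (rule search_complete[of _ _ "wd t" "wd r" i])
    show "?u \<in> W" "?v \<in> W" using hw_W[OF x k] hw_W[OF y k] .
    show "suffix (wd t) ?u" "suffix (wd r) ?v"
      using tr x y by (auto simp: wd_spow_plus intro: suffix_appendI)
    show "\<bar>i\<bar> \<le> int (3 * (length (rot (wd t) ?u) + length (rot (wd r) ?v)) + 8)"
      using i(2) by (rule order_trans) (use l in simp)
    have "ph p r + y = ph i X + r" unfolding Y[symmetric] by simp
    have e: "ph i x - ph i t + r = - ph (p + i) t + (ph p r + y)"
      unfolding \<open>ph p r + y = ph i X + r\<close> X_def
      by (simp add: ph_ph add.assoc add.commute[of p] diff_conv_add_uminus del: add_uminus_conv_diff)
    show "val ?u + (- val (wd t) + HE i 0 + val (wd r)) = - val (wd t) + HE i 0 + val (wd r) + val ?v"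
      unfolding val_hw_W[OF x] val_hw_W[OF y] val_wd_L[OF tr(1)] val_wd_L[OF tr(2)]
      using e by (simp add: ph_ph add.assoc add.commute[of p] diff_conv_add_uminus del: add_uminus_conv_diff)
  qed
qed

lemma val_conjby: "g \<in> W \<Longrightarrow> u \<in> W \<Longrightarrow> val (conjby g u) = - val g + val u + val g"
  by (simp add: conjby_def val_nfw inv_word_words add.assoc)

lemma val_conjby_append:
  "g \<in> W \<Longrightarrow> w \<in> W \<Longrightarrow> u \<in> W \<Longrightarrow> val (conjby (g @ w) u) = - val w + val (conjby g u) + val w"
  by (simp add: val_conjby minus_add add.assoc diff_conv_add_uminus del: add_uminus_conv_diff)

lemma conjby_hw:
  assumes "g \<in> W" "u \<in> W"
  shows "conjby g u = hw (val (conjby g u))"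
proof -
  have "inv_word g @ u @ g \<in> W" using assms by (simp add: inv_word_words)
  then show ?thesis unfolding conjby_def by (simp only: val_nfw) (rule nfw_hw)
qed

lemma loww_iff:
  assumes "x \<in> L m" "1 \<le> k"
  shows "loww k (hw (HE p x)) \<noteq> [] \<longleftrightarrow> x \<in> L (k - 1)"
proof -
  have nb: "\<not> (case g of Gen_a j \<Rightarrow> k \<le> j | Gen_s \<Rightarrow> False) \<longleftrightarrow> (case g of Gen_a j \<Rightarrow> j < k | Gen_s \<Rightarrow> True)" for g
    by (cases g) auto
  have sp: "\<forall>l\<in>set (wd (spow p)). case fst l of Gen_a j \<Rightarrow> j < k | Gen_s \<Rightarrow> True" by (simp add: wd_spow)
  have "loww k (hw (HE p x)) \<noteq> [] \<longleftrightarrow>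
      (\<forall>l\<in>set (wd (spow p)) \<union> set (wd x). case fst l of Gen_a j \<Rightarrow> j < k | Gen_s \<Rightarrow> True)"
    unfolding nb[symmetric] by (simp only: hw_HE[OF assms(1)] loww_def filter_empty_conv set_append) simp
  also have "\<dots> \<longleftrightarrow> (\<forall>l\<in>set (wd x). case fst l of Gen_a j \<Rightarrow> j < k | Gen_s \<Rightarrow> True)"
    unfolding ball_Un using sp by simp
  also have "\<dots> \<longleftrightarrow> x \<in> L (k - 1)"
  proof
    assume *: "\<forall>l\<in>set (wd x). case fst l of Gen_a j \<Rightarrow> j < k | Gen_s \<Rightarrow> True"
    show "x \<in> L (k - 1)"
      unfolding L_def
    proof (intro CollectI subsetI)
      fix g assume "g \<in> fst ` set (wd x)"
      then obtain l where l: "l \<in> set (wd x)" "g = fst l" by auto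
      then obtain j where j: "fst l = Gen_a j" "1 \<le> j" using assms(1) by (auto simp: L_def)
      then have "j < k" using * l by auto
      then show "g \<in> Gen_a ` {1..k - 1}" using j l assms(2) by auto
    qed
  next
    assume "x \<in> L (k - 1)"
    then show "\<forall>l\<in>set (wd x). case fst l of Gen_a j \<Rightarrow> j < k | Gen_s \<Rightarrow> True"
      using assms(2) by (auto simp: L_def split: gen.splits) fastforce
  qed
  finally show ?thesis .
qed

lemma HE_conj: "- HE j g + HE p x + HE j g = HE p (- ph p g + ph j x + g)"
  by (simp add: ph_ph)

lemma commute_iff_conj:
  fixes a b g :: "'b :: group_add"
  shows "a + g = g + b \<longleftrightarrow> b = - g + a + g"
proof
  assume "a + g = g + b"
  then show "b = - g + a + g" unfolding add.assoc by simp
qed (simp add: add.assoc)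

lemma tc_HE:
  "(\<exists>g\<in>HL k. HE p x + g = g + HE q y) \<longleftrightarrow> p = q \<and> tc k p x y"
proof
  assume "\<exists>g\<in>HL k. HE p x + g = g + HE q y"
  then obtain j g where g: "g \<in> L k" "HE p x + HE j g = HE j g + HE q y" by (auto simp: HL_def)
  then show "p = q \<and> tc k p x y" unfolding commute_iff_conj HE_conj using g(1) tcI by blast
next
  assume "p = q \<and> tc k p x y"
  then obtain j g where g: "g \<in> L k" "p = q" "y = - ph p g + ph j x + g" unfolding tc_def by blast
  then have "HE p x + HE j g = HE j g + HE q y" unfolding commute_iff_conj HE_conj by simp
  moreover have "HE j g \<in> HL k" using g(1) by simp
  ultimately show "\<exists>g\<in>HL k. HE p x + g = g + HE q y" by blast
qed

lemma conj_tc: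
  assumes "g \<in> HL k" "- g + HE p x + g = HE q y"
  shows "p = q" "tc k p x y"
proof -
  have "HE p x + g = g + HE q y" unfolding commute_iff_conj assms(2) ..
  with assms(1) show "p = q" "tc k p x y" using tc_HE by blast+
qed

lemma elliptic_step_words: "u \<in> W \<Longrightarrow> g \<in> W \<Longrightarrow> elliptic_step k u g \<in> W"
  by (simp add: elliptic_step_def Let_def words_rules conjby_words)

lemma rot_tc:
  assumes "t \<in> words (H_gens k)" "x \<in> L k"
  shows "\<exists>y\<in>L k. rot t (hw (HE p x)) = hw (HE p y) \<and> val t + HE p x - val t = HE p y \<and> tc k p x y"
proof -
  obtain q y where y: "val t + HE p x - val t = HE q y" by (cases "val t + HE p x - val t")
  have t: "- val t \<in> HL k" using val_HL[OF assms(1)] by simp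
  have tc: "p = q" "tc k p x y" using conj_tc[OF t, of p x q y] y by simp_all
  have "rot t (hw (HE p x)) = hw (HE q y)"
    unfolding rot_def nfw_hw y[symmetric] using assms(2)
    by (simp add: val_hw_W add.assoc diff_conv_add_uminus del: add_uminus_conv_diff hw.simps)
  with y tc tc_L[OF tc(2) assms(2)] show ?thesis by auto
qed

lemma elliptic_step_elliptic:
  assumes W: "u \<in> W" "g \<in> W" and x: "val (conjby g u) = HE p x" "x \<in> L k" and k: "1 \<le> k" "k \<le> m"
    and ell: "elliptic k p x"
  shows "\<exists>x'. val (conjby (elliptic_step k u g) u) = HE p x' \<and> x' \<in> L (k - 1)"
proof -
  define z where "z = conjby g u"
  have z: "z = hw (HE p x)" unfolding z_def by (subst conjby_hw[OF W(2,1)]) (simp only: x(1))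
  have xm: "x \<in> L m" using x(2) L_mono k(2) by blast
  define t where "t = find_suf (\<lambda>t. loww k (rot t z) \<noteq> []) z"
  from ell obtain y where "tc k p x y" "y \<in> L (k - 1)" by (auto simp: elliptic_def)
  from elliptic_suffix[OF x(2) this] obtain s where
    s: "s \<in> L k" "suffix (wd s) (wd x)" "ph p s + x - s \<in> L (k - 1)" by blast
  have "suffix (wd s) z" using s(2) x(2) by (simp add: z wd_spow_plus suffix_appendI)
  moreover have "loww k (rot (wd s) z) \<noteq> []"
    unfolding z rot_hw[OF x(2) s(1) k(2)] using s(3) k L_mono[of "k - 1" m] by (subst loww_iff) auto
  ultimately have low: "loww k (rot t z) \<noteq> []"
    unfolding t_def by (rule find_suf_works[of "wd s" z "\<lambda>t. loww k (rot t z) \<noteq> []"])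
  have tW: "t \<in> W" unfolding t_def z_def using W by (intro find_suf_words conjby_words)
  have step: "elliptic_step k u g = g @ inv_word t"
    using low by (simp add: elliptic_step_def Let_def z_def t_def)
  obtain y where y: "y \<in> L m" "rot t z = hw (HE p y)" "val t + HE p x - val t = HE p y"
    using rot_tc[OF tW xm, of p] unfolding z by blast
  have "val (conjby (g @ inv_word t) u) = HE p y"
    unfolding val_conjby_append[OF W(2) inv_word_words[OF tW] W(1)] x(1) y(3)[symmetric] by simp
  moreover have "y \<in> L (k - 1)" using low y(2) loww_iff[OF y(1) k(1)] by simp
  ultimately show ?thesis using step by auto
qed

text \<open>Suffixes of the normal form stay in rank k', so rotation by them only yields conjugates
  within H_k'. None of these has rank below k', hence the test for a rank below k \<le> k'
  fails.\<close>

lemma elliptic_step_id: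
  assumes W: "u \<in> W" "g \<in> W" and x: "val (conjby g u) = HE p x" "x \<in> L k'" and k: "1 \<le> k" "k \<le> k'" "k' \<le> m"
    and ell: "\<not> elliptic k' p x"
  shows "elliptic_step k u g = g"
proof -
  define z where "z = conjby g u"
  have z: "z = hw (HE p x)" unfolding z_def by (subst conjby_hw[OF W(2,1)]) (simp only: x(1))
  have zk: "z \<in> words (H_gens k')" unfolding z using x(2) by (intro hw_words) simp
  define t where "t = find_suf (\<lambda>t. loww k (rot t z) \<noteq> []) z"
  have "suffix t z" unfolding t_def by (rule find_suf_suffix)
  then obtain a where "z = a @ t" by (auto simp: suffix_def)
  then have "t \<in> words (H_gens k')" using zk by simp
  then obtain y where y: "y \<in> L k'" "rot t z = hw (HE p y)" "tc k' p x y"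
    using rot_tc[OF _ x(2), of t p] unfolding z by blast
  have "loww k (rot t z) = []"
  proof (rule ccontr)
    assume "loww k (rot t z) \<noteq> []"
    then have "y \<in> L (k - 1)" using y(2) loww_iff[of y k p] L_mono[OF k(3) y(1)] k(1) by simp
    then have "y \<in> L (k' - 1)" using L_mono[of "k - 1" "k' - 1"] k by simp
    then show False using ell y(3) by (auto simp: elliptic_def)
  qed
  then show ?thesis by (simp add: elliptic_step_def Let_def z_def t_def)
qed

lemma elliptic_steps_spec:
  assumes u: "u \<in> W"
  shows "d \<le> m \<Longrightarrow> elliptic_steps m d u \<in> W \<and> (\<exists>p x. val (conjby (elliptic_steps m d u) u) = HE p x \<and>
    (x \<in> L (m - d) \<or> (\<exists>k. m - d < k \<and> k \<le> m \<and> x \<in> L k \<and> \<not> elliptic k p x)))"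
proof (induction d)
  case 0
  have "val (conjby [] u) \<in> HL m" using u by (intro val_HL conjby_words) auto
  then show ?case by (cases "val (conjby [] u)") simp
next
  case (Suc d)
  let ?g = "elliptic_steps m d u" and ?k = "m - d"
  obtain p x where g: "?g \<in> W" and x: "val (conjby ?g u) = HE p x"
    "x \<in> L ?k \<or> (\<exists>k. ?k < k \<and> k \<le> m \<and> x \<in> L k \<and> \<not> elliptic k p x)"
    using Suc by auto
  have k: "1 \<le> ?k" "?k \<le> m" "m - Suc d = ?k - 1" "m - Suc d < ?k" using Suc.prems by auto
  have gW: "elliptic_steps m (Suc d) u \<in> W" using u g by (simp add: elliptic_step_words)
  consider "x \<in> L ?k" "elliptic ?k p x" | k' where "?k \<le> k'" "k' \<le> m" "x \<in> L k'" "\<not> elliptic k' p x"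
    using x(2) k(2) by (meson less_imp_le order_refl)
  then show ?case
  proof cases
    case 1
    from elliptic_step_elliptic[OF u g x(1) 1(1) k(1,2) 1(2)] show ?thesis using gW k(3) by auto
  next
    case (2 k')
    from elliptic_step_id[OF u g x(1) 2(3) k(1) 2(1,2,4)]
    have "elliptic_steps m (Suc d) u = ?g" by simp
    then show ?thesis using g x(1) 2 k by (metis less_le_trans)
  qed
qed

text \<open>A success is always genuine, as \<open>okw\<close> has verified it. That the search does
  succeed is known only for elements that are not elliptic, hence the hypotheses of the third
  claim.\<close>

lemma edge_step_spec:
  assumes W: "u \<in> W" "g \<in> W" and x: "val (conjby g u) = HE p x" and k: "1 \<le> k" "Suc k \<le> m"
  shows "edge_step (Suc k) u g \<in> W"
    and "edge_step (Suc k) u g = g \<or> val (conjby (edge_step (Suc k) u g) u) = HE p 0"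
    and "x \<in> L k \<Longrightarrow> \<not> elliptic k p x \<Longrightarrow> tc k p x (- P (Suc k) p) \<Longrightarrow>
      val (conjby (edge_step (Suc k) u g) u) = HE p 0"
proof -
  define z where "z = conjby g u"
  have z: "z = hw (HE p x)" unfolding z_def by (subst conjby_hw[OF W(2,1)]) (simp only: x(1))
  have zW: "z \<in> W" unfolding z_def using W by (intro conjby_words)
  have xm: "x \<in> L m" using val_HL[OF zW] x(1) by (simp add: z_def)
  define c where "c = nfw ([(Gen_a (Suc k), False)] @ filter (\<lambda>l. fst l = Gen_s) z @ [(Gen_a (Suc k), True)])"
  have aW: "[(Gen_a (Suc k), b)] \<in> W" for b using k by (simp add: H_gens_def)
  \<comment> \<open>The letters s of the normal form s^p x make up exactly the word s^p.\<close>
  have f: "filter (\<lambda>l. fst l = Gen_s) z = wd (spow p)"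
  proof -
    have "filter (\<lambda>l. fst l = Gen_s) (wd x) = []" using xm by (auto simp: L_def filter_empty_conv)
    moreover have "filter (\<lambda>l. fst l = Gen_s) (wd (spow p)) = wd (spow p)"
      by (auto simp: wd_spow filter_id_conv)
    ultimately show ?thesis using xm by (simp add: z wd_spow_plus)
  qed
  let ?a = "HE 0 (ag (Suc k))"
  have vala: "val [(Gen_a (Suc k), False)] = - ?a" "val [(Gen_a (Suc k), True)] = ?a"
    by (simp_all add: val_Cons slet_def hgen_def zero_hel_def)
  have c: "c = hw (HE p (- P (Suc k) p))"
  proof -
    have "c = hw (- ?a + HE p 0 + ?a)"
      unfolding c_def f nfw_hw val_simps vala val_spow by (simp only: add.assoc)
    also have "- ?a + HE p 0 + ?a = HE p (- P (Suc k) p)"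
      unfolding HE_conj by (simp add: P_def minus_add)
    finally show ?thesis .
  qed
  have PL: "- P (Suc k) p \<in> L k" using P_L[of "Suc k" p] by simp
  have cW: "c \<in> W" unfolding c by (rule hw_W[OF PL]) (use k in simp)
  have valc: "val c = - ?a + HE p 0 + ?a"
    unfolding c val_hw_W[OF PL] HE_conj by (simp add: P_def minus_add)
  define w where "w = search z c"
  have wW: "w \<in> W" unfolding w_def using zW cW by (rule search_words)
  have step: "edge_step (Suc k) u g = (if okw z w c = [] then g else g @ w @ [(Gen_a (Suc k), False)])"
    unfolding edge_step_def Let_def z_def[symmetric] c_def[symmetric] w_def[symmetric] ..
  show "edge_step (Suc k) u g \<in> W" using W wW aW by (simp add: step)
  have ok: "val (conjby (edge_step (Suc k) u g) u) = HE p 0" if "okw z w c \<noteq> []"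
  proof -
    have "val z + val w = val w + val c" using that okw_iff[OF zW wW cW] by simp
    then have "- val w + val z + val w = val c" unfolding commute_iff_conj by simp
    moreover have "val (conjby (edge_step (Suc k) u g) u) = ?a + (- val w + val z + val w) - ?a"
    proof -
      have e: "edge_step (Suc k) u g = g @ (w @ [(Gen_a (Suc k), False)])" using that by (simp add: step)
      have W': "w @ [(Gen_a (Suc k), False)] \<in> W" using wW aW by simp
      show ?thesis
        unfolding e val_conjby_append[OF W(2) W' W(1)] z_def val_simps vala
        by (simp add: minus_add add.assoc diff_conv_add_uminus del: add_uminus_conv_diff uminus_hel.simps)
    qed
    ultimately show ?thesis unfolding valc by (simp add: add.assoc diff_conv_add_uminus del: add_uminus_conv_diff)
  qed
  show "edge_step (Suc k) u g = g \<or> val (conjby (edge_step (Suc k) u g) u) = HE p 0"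
    using ok step by auto
  assume "x \<in> L k" "\<not> elliptic k p x" "tc k p x (- P (Suc k) p)"
  then have "okw z w c \<noteq> []"
    unfolding w_def z c using PL k by (intro search_hyperbolic[of _ k]) simp_all
  then show "val (conjby (edge_step (Suc k) u g) u) = HE p 0" by (rule ok)
qed

text \<open>Here k is the rank at which the descent stopped, and d records that the edge steps of
  ranks 2 to d + 1 have been done; the one that concerns rank k is that of rank k + 1.\<close>

definition rank_good :: "nat \<Rightarrow> nat \<Rightarrow> int \<Rightarrow> gen fg \<Rightarrow> bool" where
  "rank_good d k p x \<longleftrightarrow> 1 \<le> k \<and> k \<le> m \<and> x \<in> L k \<and> \<not> elliptic k p x \<and> (k \<le> d \<longrightarrow> \<not> tc k p x (- P (Suc k) p))"

lemma edge_steps_spec: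
  assumes u: "u \<in> W"
  shows "d \<le> m - 1 \<Longrightarrow> edge_steps m d u \<in> W \<and>
    (\<exists>p x. val (conjby (edge_steps m d u) u) = HE p x \<and> (x = 0 \<or> (\<exists>k. rank_good d k p x)))"
proof (induction d)
  case 0
  from elliptic_steps_spec[OF u, of m] obtain p x where
    "elliptic_steps m m u \<in> W" "val (conjby (elliptic_steps m m u) u) = HE p x"
    "x \<in> L 0 \<or> (\<exists>k>0. k \<le> m \<and> x \<in> L k \<and> \<not> elliptic k p x)" by auto
  then show ?case using L_0[of x] by (auto simp: rank_good_def Suc_le_eq One_nat_def)
next
  case (Suc d)
  let ?g = "edge_steps m d u" and ?h = "edge_steps m (Suc d) u"
  obtain p x where g: "?g \<in> W" and x: "val (conjby ?g u) = HE p x" "x = 0 \<or> (\<exists>k. rank_good d k p x)"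
    using Suc by auto
  have k: "1 \<le> Suc d" "Suc (Suc d) \<le> m" using Suc.prems by auto
  note spec = edge_step_spec[OF u g x(1) k, folded edge_steps.simps]
  show ?case
  proof (cases "val (conjby ?h u) = HE p 0")
    case True
    then show ?thesis using spec(1) by auto
  next
    case False
    then have h: "?h = ?g" using spec(2) by simp
    then have "x \<noteq> 0" using False x(1) by auto
    then obtain k where k: "rank_good d k p x" using x(2) by blast
    have "rank_good (Suc d) k p x"
      using k False spec(3) unfolding rank_good_def by (metis le_Suc_eq)
    then show ?thesis using g x(1) unfolding h by blast
  qed
qed

abbreviation good :: "nat \<Rightarrow> int \<Rightarrow> gen fg \<Rightarrow> bool" where
  "good \<equiv> rank_good (m - 1)"

lemma expsum_P: "k \<ge> 1 \<Longrightarrow> expsum k (P (Suc k) i) = i"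
  using expsum_top1[of "ag (Suc k)" k i] by (simp add: P_def)

text \<open>Above its own rank a good element meets no edge group. Were s^p x conjugate in H_(n+1)
  to a_(n+2)^-1 s^p a_(n+2), the exponent sums of a_(n+1), which are 0 and -p, would force p = 0;
  but then it would be conjugate to s^p, which \<open>tc_elliptic\<close> and the induction
  hypothesis exclude.\<close>

lemma good_climb:
  assumes "good k p x"
  shows "k \<le> n \<Longrightarrow> n \<le> m \<Longrightarrow> \<not> tc n p x 0 \<and> (n < m \<longrightarrow> \<not> tc n p x (- P (Suc n) p))"
proof (induction n rule: dec_induct)
  case base
  have "\<not> tc k p x 0" using assms by (auto simp: rank_good_def elliptic_def)
  moreover have "k < m \<longrightarrow> \<not> tc k p x (- P (Suc k) p)" using assms by (auto simp: rank_good_def)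
  ultimately show ?case by blast
next
  case (step n)
  have k: "1 \<le> k" "x \<in> L k" using assms by (auto simp: rank_good_def)
  have xn: "x \<in> L n" using k(2) step.hyps L_mono by blast
  have IH: "\<not> tc n p x 0" "\<not> tc n p x (- P (Suc n) p)" using step by auto
  have 1: "\<not> tc (Suc n) p x 0"
    using tc_elliptic[of x "Suc n" 0 p] xn IH by auto
  moreover have "\<not> tc (Suc n) p x (- P (Suc (Suc n)) p)"
  proof
    assume tc: "tc (Suc n) p x (- P (Suc (Suc n)) p)"
    then obtain j g where g: "g \<in> L (Suc n)" "- P (Suc (Suc n)) p = - ph p g + ph j x + g"
      unfolding tc_def by blast
    have "x \<in> L (Suc n)" using xn L_mono[of n "Suc n"] by simp
    then have "expsum (Suc n) (- P (Suc (Suc n)) p) = expsum (Suc n) x"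
      unfolding g(2) using g(1) by (simp add: expsum_top)
    then have "p = 0" using xn by (simp add: expsum_P expsum_L)
    then show False using tc 1 by simp
  qed
  ultimately show ?case by blast
qed

text \<open>Descent from n: \<open>good_climb\<close> excludes the two exceptional cases of
  \<open>tc_elliptic\<close>, so conjugacy passes from H_(n+1) to H_n until the larger of the two
  ranks is reached. Were the ranks different, the element of larger rank would be elliptic
  there.\<close>

lemma good_meet:
  assumes x: "good k p x" and y: "good l p y" and "tc n p x y" "k \<le> n" "l \<le> n" "n \<le> m"
  shows "k = l \<and> tc k p x y"
  using assms(3-6)
proof (induction n)
  case 0
  then show ?case using x by (simp add: rank_good_def)
next
  case (Suc n)
  have kl: "x \<in> L k" "y \<in> L l" "\<not> elliptic k p x" "\<not> elliptic l p y" "1 \<le> k" "1 \<le> l"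
    using x y by (auto simp: rank_good_def)
  consider "k = Suc n" "l = Suc n" | "k = Suc n" "l \<le> n" | "k \<le> n" "l = Suc n" | "k \<le> n" "l \<le> n"
    using Suc.prems by linarith
  then show ?case
  proof cases
    case 1
    then show ?thesis using Suc.prems by simp
  next
    case 2
    then have "y \<in> L (k - 1)" using kl(2) L_mono[of l "k - 1"] by simp
    then show ?thesis using 2 Suc.prems(1) kl(3) by (auto simp: elliptic_def)
  next
    case 3
    then have "x \<in> L (l - 1)" using kl(1) L_mono[of k "l - 1"] by simp
    then show ?thesis using 3 tc_sym[OF Suc.prems(1)] kl(4) by (auto simp: elliptic_def)
  next
    case 4
    have xy: "x \<in> L n" "y \<in> L n" using 4 kl L_mono by blast+
    have "n < m" using Suc.prems by simp
    with good_climb[OF x 4(1)] have "\<not> tc n p x 0" "\<not> tc n p x (- P (Suc n) p)" by auto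
    then have "tc n p x y" using tc_elliptic[of x "Suc n" y p] xy Suc.prems(1) by auto
    then show ?thesis using 4 Suc.prems(4) by (intro Suc.IH) simp_all
  qed
qed

lemma search_trivial: "okw (hw (HE p 0)) (search (hw (HE p 0)) (hw (HE p 0))) (hw (HE p 0)) \<noteq> []"
proof (rule search_complete[of _ _ "[]" "[]" 0])
  show "hw (HE p 0) \<in> W" "hw (HE p 0) \<in> W" using hw_W[of 0 0 p] by simp_all
qed (simp_all add: zero_hel_def[symmetric])

lemma conjugator_words: "u \<in> W \<Longrightarrow> v \<in> W \<Longrightarrow> conjugator m u v \<in> W"
  using edge_steps_spec[of u "m - 1"] edge_steps_spec[of v "m - 1"]
  by (simp add: conjugator_def Let_def search_words conjby_words inv_word_words)

theorem conjugator_correct: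
  assumes u: "u \<in> W" and v: "v \<in> W" and conj: "\<exists>g\<in>HL m. val u + g = g + val v"
  shows "val u + val (conjugator m u v) = val (conjugator m u v) + val v"
proof -
  define g h where "g = edge_steps m (m - 1) u" and "h = edge_steps m (m - 1) v"
  obtain p x where g: "g \<in> W" "val (conjby g u) = HE p x" "x = 0 \<or> (\<exists>k. good k p x)"
    using edge_steps_spec[OF u, of "m - 1"] by (auto simp: g_def)
  obtain q y where h: "h \<in> W" "val (conjby h v) = HE q y" "y = 0 \<or> (\<exists>k. good k q y)"
    using edge_steps_spec[OF v, of "m - 1"] by (auto simp: h_def)
  define u' v' where "u' = conjby g u" and "v' = conjby h v"
  have u': "u' = hw (HE p x)" unfolding u'_def by (subst conjby_hw[OF g(1) u]) (simp only: g(2))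
  have v': "v' = hw (HE q y)" unfolding v'_def by (subst conjby_hw[OF h(1) v]) (simp only: h(2))
  have W': "u' \<in> W" "v' \<in> W" using u v g h by (simp_all add: u'_def v'_def conjby_words)
  have Hp: "HE p x = - val g + val u + val g" and Hq: "HE q y = - val h + val v + val h"
    using val_conjby[OF g(1) u] val_conjby[OF h(1) v] g(2) h(2) by simp_all
  from conj obtain c where c: "c \<in> HL m" "val u + c = c + val v" by blast
  have "HE p x + (- val g + c + val h) = (- val g + c + val h) + HE q y"
  proof -
    have "HE p x + (- val g + c + val h) = - val g + (val u + c) + val h"
      unfolding Hp by (simp add: add.assoc)
    also have "\<dots> = (- val g + c + val h) + HE q y"
      unfolding Hq c(2) by (simp add: add.assoc)
    finally show ?thesis .
  qed
  moreover have "- val g + c + val h \<in> HL m" using c(1) val_HL[OF g(1)] val_HL[OF h(1)] by simp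
  ultimately have pq: "p = q" "tc m p x y" using tc_HE[of m p x q y] by blast+
  have ok: "okw u' (search u' v') v' \<noteq> []"
  proof (cases "x = 0 \<or> y = 0")
    case True
    \<comment> \<open>Powers of s are the only representatives that are not good, and by
      \<open>good_climb\<close> in rank m no good element is conjugate to one.\<close>
    have "x = 0 \<and> y = 0"
    proof (rule ccontr)
      assume "\<not> (x = 0 \<and> y = 0)"
      with True consider k where "good k p x" "y = 0" | k where "good k p y" "x = 0"
        using g(3) h(3) pq(1) by auto
      then show False
      proof cases
        case (1 k)
        then show False using good_climb[OF 1(1), of m] pq(2) by (auto simp: rank_good_def)
      next
        case (2 k)
        then show False using good_climb[OF 2(1), of m] tc_sym[OF pq(2)] by (auto simp: rank_good_def)
      qed
    qed
    then show ?thesis using search_trivial[of p] pq(1) unfolding u' v' by simp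
  next
    case False
    then obtain k l where kl: "good k p x" "good l p y" using g(3) h(3) pq(1) by auto
    have "k = l \<and> tc k p x y"
      by (rule good_meet[OF kl pq(2)]) (use kl in \<open>auto simp: rank_good_def\<close>)
    then show ?thesis unfolding u' v' pq(1)[symmetric]
      using kl by (intro search_hyperbolic[of _ k]) (auto simp: rank_good_def)
  qed
  let ?w = "search u' v'"
  have wW: "?w \<in> W" using W' by (rule search_words)
  have e: "val u' + val ?w = val ?w + val v'" using ok okw_iff[OF W'(1) wW W'(2)] by simp
  have C: "val (conjugator m u v) = val g + val ?w - val h"
    unfolding conjugator_def Let_def g_def[symmetric] h_def[symmetric] u'_def[symmetric] v'_def[symmetric]
    by (simp add: add.assoc diff_conv_add_uminus del: add_uminus_conv_diff)
  have "val u = val g + val u' - val g" "val v = val h + val v' - val h"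
    unfolding u'_def v'_def val_conjby[OF g(1) u] val_conjby[OF h(1) v]
    by (simp_all add: add.assoc diff_conv_add_uminus del: add_uminus_conv_diff)
  then have "val u + (val g + val ?w - val h) = val g + (val u' + val ?w) - val h"
    "(val g + val ?w - val h) + val v = val g + (val ?w + val v') - val h"
    by (simp_all add: add.assoc diff_conv_add_uminus del: add_uminus_conv_diff)
  then show ?thesis unfolding C e by simp
qed

text \<open>A function in \<open>FP\<close> leaves the inputs in stacks 0 and 1 and writes to stack
  2, whereas the answer is expected in stack 0; so stack 0 is cleared and the value moved there,
  with stack 3 as auxiliary.\<close>

lemma FP_algorithm:
  assumes FP: "FP 2 (\<lambda>e. f (e 0) (e 1))"
    and D: "D \<subseteq> W \<times> W" and spec: "\<And>u v. (u, v) \<in> D \<Longrightarrow> spec u v (f u v)"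
  shows "\<exists>c. poly_time_algorithm c D spec"
proof -
  obtain c p where Cc: "computes c p 2 (\<lambda>e. f (e 0) (e 1))" by (rule FPE[OF FP])
  note c = computesD[OF Cc]
  define b where "b k = poly p k + ((2 * k + 1) + mv_time (poly p k))" for k
  have "pb b" unfolding b_def by simp
  then obtain q where q: "\<And>n. b n \<le> poly q n" by (auto simp: pb_def)
  have "\<exists>t s. exec (Seq c (Seq (clear 0) (mv 2 0 3))) (input u v) t s \<and> t \<le> poly q (length u + length v) \<and> spec u v (s 0)"
    if uv: "(u, v) \<in> D" for u v
  proof -
    let ?e = "input u v" and ?w = "f u v"
    have e01: "?e 0 = u" "?e 1 = v" "?e i = []" if "2 \<le> i" for i using that by (auto simp: input_def)
    have e: "valid 2 ?e" using D uv by (auto simp: valid_def input_def lists_S)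
    have es: "esize 2 ?e = length u + length v"
      by (simp add: esize_def input_def numeral_2_eq_2)
    let ?n = "length u + length v"
    let ?e1 = "?e(2 := ?w)"
    let ?e2 = "?e1(0 := [])"
    have 1: "run c ?e (poly p ?n) ?e1" using c(3)[OF e] unfolding es by (simp add: input_def)
    have 2: "run (clear 0) ?e1 (2 * ?n + 1) ?e2"
      by (rule run_clear) (simp add: input_def)
    have wS: "?w \<in> lists (H_gens m \<times> UNIV)" "length ?w \<le> poly p ?n"
      using c(1,2)[OF e] unfolding es by (simp_all add: input_def)
    have 3: "run (mv 2 0 3) ?e2 (mv_time (poly p ?n)) (?e2(2 := [], 0 := ?e2 2))"
      using wS by (intro run_mv) (simp_all add: input_def)
    have "run (Seq c (Seq (clear 0) (mv 2 0 3))) ?e (b ?n) (?e2(2 := [], 0 := ?e2 2))"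
      unfolding b_def using 1 2 3 by (intro run_Seq)
    then obtain t where t: "exec (Seq c (Seq (clear 0) (mv 2 0 3))) ?e t (?e2(2 := [], 0 := ?e2 2))" "t \<le> b ?n"
      unfolding run_def by blast
    show ?thesis
    proof (intro exI conjI)
      show "exec (Seq c (Seq (clear 0) (mv 2 0 3))) ?e t (?e2(2 := [], 0 := ?e2 2))" by (rule t(1))
      show "t \<le> poly q ?n" using t(2) q by (rule order_trans)
      show "spec u v ((?e2(2 := [], 0 := ?e2 2)) 0)" using spec[OF uv] by simp
    qed
  qed
  then show ?thesis unfolding poly_time_algorithm_def by blast
qed

end

theorem theorem2:
  fixes m :: nat
  assumes "m \<ge> 2"
  shows "(\<exists>c. solves_conjugacy_problem_in_poly_time m c) \<and>
         (\<exists>c. solves_conjugacy_search_problem_in_poly_time m c)"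
proof
  interpret H_words m .
  have FP: "FP 2 (\<lambda>e. conjugator m (e 0) (e 1))"
    by (intro FP_conjugator FP_proj) simp_all
  have eq: "H_elem m u \<otimes>\<^bsub>H m\<^esub> H_elem m (conjugator m u v) = H_elem m (conjugator m u v) \<otimes>\<^bsub>H m\<^esub> H_elem m v \<longleftrightarrow>
      val u + val (conjugator m u v) = val (conjugator m u v) + val v" if "u \<in> W" "v \<in> W" for u v
    using that conjugator_words[OF that] by (rule H_elem_mult_eq_iff)
  show "\<exists>c. solves_conjugacy_search_problem_in_poly_time m c"
    unfolding solves_conjugacy_search_problem_in_poly_time_def
  proof (rule FP_algorithm[where f = "conjugator m", OF FP])
    fix u v
    assume "(u, v) \<in> {(u, v). u \<in> W \<and> v \<in> W \<and> conjugate (H m) (H_elem m u) (H_elem m v)}"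
    then have W: "u \<in> W" "v \<in> W" and "conjugate (H m) (H_elem m u) (H_elem m v)" by auto
    then show "conjugator m u v \<in> W \<and>
        H_elem m u \<otimes>\<^bsub>H m\<^esub> H_elem m (conjugator m u v) = H_elem m (conjugator m u v) \<otimes>\<^bsub>H m\<^esub> H_elem m v"
      using conjugator_correct[OF W] conjugate_iff_val[OF W] eq[OF W] conjugator_words[OF W] by simp
  qed auto
  have FP': "FP 2 (\<lambda>e. okw (e 0) (conjugator m (e 0) (e 1)) (e 1))"
    by (intro FP_okw FP FP_proj) simp_all
  show "\<exists>c. solves_conjugacy_problem_in_poly_time m c"
    unfolding solves_conjugacy_problem_in_poly_time_def
  proof (rule FP_algorithm[where f = "\<lambda>u v. okw u (conjugator m u v) v", OF FP'])
    fix u v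
    assume "(u, v) \<in> W \<times> W"
    then have W: "u \<in> W" "v \<in> W" by auto
    \<comment> \<open>The decision procedure runs the search and verifies its output: the word
      returned is a conjugator whenever one exists.\<close>
    have "conjugate (H m) (H_elem m u) (H_elem m v) \<longleftrightarrow>
        val u + val (conjugator m u v) = val (conjugator m u v) + val v"
      unfolding conjugate_iff_val[OF W]
      using conjugator_correct[OF W] val_HL[OF conjugator_words[OF W]] by blast
    then show "okw u (conjugator m u v) v \<noteq> [] \<longleftrightarrow> conjugate (H m) (H_elem m u) (H_elem m v)"
      using okw_iff[OF W(1) conjugator_words[OF W] W(2)] by simp
  qed auto
qed

end
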